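(* Let $K$ be a number field and let $v_1,\ldots,v_n$ be a finite set of (distinct) non-archimedean places of $K$. For $i=1,\ldots,n$ let $L_i$ be a non-archimedean local field and let $\alpha_i:G_{K_{v_i}}\to G_{L_i}$ be an arbitrary isomorphism of topological groups. Then there exist: (1) finite extensions $L_i'/L_i$ (for all $i$), a number field $M'$ with dense embeddings $M'\hookrightarrow L_i'$ for all $i$, and places $w_1,\ldots,w_n$ of $M'$ induced by these embeddings, such that the valuations induced on $M'$ are pairwise inequivalent (i.e. the collection $\{L_i'\}$ is cohesive via $M'$); and (2) a finite extension $K'/K$ and, for all $i$, places $u_i$ of $K'$ lying over the places $v_i$ of $K$, together with anabelomorphisms $G_{K'_{u_i}}\simeq G_{L_i'}$. (3) In particular, the number fields $K'$ and $M'$ are anabelomorphically connected along $u_1,\ldots,u_n$ and $w_1,\ldots,w_n$, i.e. $G_{K'_{u_i}}\simeq G_{M'_{w_i}}$ as topological groups for all $i=1,\ldots,n$, and $u_i|v_i$ for all $i=1,\ldots,n$.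
   Context: A non-archimedean local field here means a finite extension of $\mathbb{Q}_p$ for some (unspecified) prime $p$. $G_F$ denotes the absolute Galois group of a field $F$, and an anabelomorphism between two such fields is a topological isomorphism between their absolute Galois groups. $K_v$ is the completion of a number field $K$ at a place $v$. An embedding $M\hookrightarrow L$ of a number field in a non-archimedean local field is dense if its image is dense, so that $L$ is identified with the completion of $M$ at the place induced by the embedding. A finite set $\{L_1,\dots,L_n\}$ of non-archimedean local fields (some of which may be isomorphic to each other and which may have distinct residue characteristics) is cohesive if there is a number field $M$ with dense embeddings $M\hookrightarrow L_i$ for all $i$ such that the induced valuations on $M$ are pairwise inequivalent. *)

theory Defs
  imports
    "HOL-Analysis.Analysis"
    "HOL-Algebra.Algebra"
    "HOL-Algebra.Algebraic_Closure_Type"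
begin

section \<open>Finite extensions and number fields\<close>

text \<open>
  Extensions are given by an explicit embedding \<open>h\<close> rather than by an inclusion of carriers.
  Hence, for an infinite field on a type \<open>'a\<close>, every finite extension is up to isomorphism again
  a ring on \<open>'a\<close>: it has the same cardinality, so its structure can be transported.
\<close>

definition finite_field_ext ::
  "('a, 'm) ring_scheme \<Rightarrow> ('a \<Rightarrow> 'b) \<Rightarrow> ('b, 'k) ring_scheme \<Rightarrow> bool" where
  "finite_field_ext F h E \<longleftrightarrow>
     field F \<and> field E \<and> h \<in> ring_hom F E \<and>
     ring.finite_dimension E (h ` carrier F) (carrier E)"

definition number_field :: "('a, 'm) ring_scheme \<Rightarrow> bool" where
  "number_field K \<longleftrightarrow> (\<exists>h. finite_field_ext (ring_of_type_algebra :: rat ring) h K)"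

section \<open>Non-archimedean absolute values, places, completions\<close>

definition nonarch_absval :: "('a, 'm) ring_scheme \<Rightarrow> ('a \<Rightarrow> real) \<Rightarrow> bool" where
  "nonarch_absval K v \<longleftrightarrow>
     v \<zero>\<^bsub>K\<^esub> = 0 \<and>
     (\<forall>x\<in>carrier K. x \<noteq> \<zero>\<^bsub>K\<^esub> \<longrightarrow> v x > 0) \<and>
     (\<forall>x\<in>carrier K. \<forall>y\<in>carrier K. v (x \<otimes>\<^bsub>K\<^esub> y) = v x * v y) \<and>
     (\<forall>x\<in>carrier K. \<forall>y\<in>carrier K. v (x \<oplus>\<^bsub>K\<^esub> y) \<le> max (v x) (v y))"

text \<open>
  A place is an equivalence class of nontrivial absolute values; it is represented here by a
  member of the class, and two places are distinct iff their representatives are inequivalent.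
\<close>

definition nonarch_place :: "('a, 'm) ring_scheme \<Rightarrow> ('a \<Rightarrow> real) \<Rightarrow> bool" where
  "nonarch_place K v \<longleftrightarrow>
     nonarch_absval K v \<and> (\<exists>x\<in>carrier K. x \<noteq> \<zero>\<^bsub>K\<^esub> \<and> v x \<noteq> 1)"

definition equiv_absval :: "('a, 'm) ring_scheme \<Rightarrow> ('a \<Rightarrow> real) \<Rightarrow> ('a \<Rightarrow> real) \<Rightarrow> bool" where
  "equiv_absval K v w \<longleftrightarrow> (\<exists>s>0. \<forall>x\<in>carrier K. w x = v x powr s)"

definition lies_over ::
  "('a, 'm) ring_scheme \<Rightarrow> ('a \<Rightarrow> 'b) \<Rightarrow> ('b \<Rightarrow> real) \<Rightarrow> ('a \<Rightarrow> real) \<Rightarrow> bool" where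
  "lies_over K \<iota> u v \<longleftrightarrow> equiv_absval K v (u \<circ> \<iota>)"

definition cauchy_ring :: "('a, 'm) ring_scheme \<Rightarrow> ('a \<Rightarrow> real) \<Rightarrow> (nat \<Rightarrow> 'a) ring" where
  "cauchy_ring K v =
     \<lparr>carrier = {x. (\<forall>n. x n \<in> carrier K) \<and>
                    (\<forall>\<epsilon>>0. \<exists>N. \<forall>m\<ge>N. \<forall>n\<ge>N. v (x m \<ominus>\<^bsub>K\<^esub> x n) < \<epsilon>)},
      monoid.mult = (\<lambda>x y n. x n \<otimes>\<^bsub>K\<^esub> y n),
      monoid.one = (\<lambda>n. \<one>\<^bsub>K\<^esub>),
      ring.zero = (\<lambda>n. \<zero>\<^bsub>K\<^esub>),
      ring.add = (\<lambda>x y n. x n \<oplus>\<^bsub>K\<^esub> y n)\<rparr>"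

definition null_sequences :: "('a, 'm) ring_scheme \<Rightarrow> ('a \<Rightarrow> real) \<Rightarrow> (nat \<Rightarrow> 'a) set" where
  "null_sequences K v = {x \<in> carrier (cauchy_ring K v). (\<lambda>n. v (x n)) \<longlonglongrightarrow> 0}"

definition place_completion :: "('a, 'm) ring_scheme \<Rightarrow> ('a \<Rightarrow> real) \<Rightarrow> (nat \<Rightarrow> 'a) set ring" where
  "place_completion K v = cauchy_ring K v Quot null_sequences K v"

text \<open>The continuous extension of \<open>v\<close>; elements of the completion are cosets of Cauchy sequences.\<close>

definition completion_absval :: "('a \<Rightarrow> real) \<Rightarrow> (nat \<Rightarrow> 'a) set \<Rightarrow> real" where
  "completion_absval v A = (THE r. \<forall>x\<in>A. (\<lambda>n. v (x n)) \<longlonglongrightarrow> r)"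

section \<open>Non-archimedean local fields\<close>

definition padic_absval :: "nat \<Rightarrow> rat \<Rightarrow> real" where
  "padic_absval p q =
     (if q = 0 then 0
      else real p powi (int (multiplicity (int p) (snd (quotient_of q)))
                        - int (multiplicity (int p) (fst (quotient_of q)))))"

definition Qp :: "nat \<Rightarrow> (nat \<Rightarrow> rat) set ring" where
  "Qp p = place_completion ring_of_type_algebra (padic_absval p)"

definition nonarch_local_field :: "('a, 'm) ring_scheme \<Rightarrow> bool" where
  "nonarch_local_field L \<longleftrightarrow> (\<exists>p h. Factorial_Ring.prime p \<and> finite_field_ext (Qp p) h L)"

text \<open>
  A local field carries a unique absolute value extending the normalised one of its subfield
  \<open>Qp p\<close>, where \<open>p\<close> and the embedding of \<open>Qp p\<close> are unique as well. So the choice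
  below is determined on the carrier.
\<close>

definition extends_padic_absval :: "('a, 'm) ring_scheme \<Rightarrow> ('a \<Rightarrow> real) \<Rightarrow> bool" where
  "extends_padic_absval L a \<longleftrightarrow>
     nonarch_absval L a \<and>
     (\<exists>p h. Factorial_Ring.prime p \<and> finite_field_ext (Qp p) h L \<and>
            (\<forall>x\<in>carrier (Qp p). a (h x) = completion_absval (padic_absval p) x))"

definition local_absval :: "('a, 'm) ring_scheme \<Rightarrow> 'a \<Rightarrow> real" where
  "local_absval L = (SOME a. extends_padic_absval L a)"

definition dense_embedding ::
  "('a, 'm) ring_scheme \<Rightarrow> ('a \<Rightarrow> 'b) \<Rightarrow> ('b, 'k) ring_scheme \<Rightarrow> bool" where
  "dense_embedding M \<sigma> L \<longleftrightarrow>
     number_field M \<and> nonarch_local_field L \<and> \<sigma> \<in> ring_hom M L \<and>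
     (\<forall>y\<in>carrier L. \<forall>\<epsilon>>0. \<exists>x\<in>carrier M. local_absval L (\<sigma> x \<ominus>\<^bsub>L\<^esub> y) < \<epsilon>)"

definition induced_absval :: "('a \<Rightarrow> 'b) \<Rightarrow> ('b, 'k) ring_scheme \<Rightarrow> 'a \<Rightarrow> real" where
  "induced_absval \<sigma> L = local_absval L \<circ> \<sigma>"

text \<open>The family \<open>L 1, \<dots>, L n\<close> is cohesive via the number field \<open>M\<close> and the embeddings \<open>\<sigma> i\<close>.\<close>

definition cohesive_via ::
  "nat \<Rightarrow> (nat \<Rightarrow> 'b ring) \<Rightarrow> ('a, 'm) ring_scheme \<Rightarrow> (nat \<Rightarrow> 'a \<Rightarrow> 'b) \<Rightarrow> bool" where
  "cohesive_via n L M \<sigma> \<longleftrightarrow>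
     number_field M \<and>
     (\<forall>i\<in>{1..n}. nonarch_local_field (L i) \<and> dense_embedding M (\<sigma> i) (L i)) \<and>
     pairwise (\<lambda>i j. \<not> equiv_absval M (induced_absval (\<sigma> i) (L i)) (induced_absval (\<sigma> j) (L j)))
       {1..n}"

section \<open>Absolute Galois groups and anabelomorphisms\<close>

text \<open>
  \<^const>\<open>field.alg_closure\<close> is the algebraic closure of a field \<open>F\<close>, and
  \<^const>\<open>ring.indexed_const\<close> the embedding of \<open>F\<close> into it. All fields below have
  characteristic 0, so that the algebraic closure is also the separable closure.
\<close>

definition base_image :: "('a, 'm) ring_scheme \<Rightarrow> (('a list \<times> nat) multiset \<Rightarrow> 'a) set" where
  "base_image F = ring.indexed_const F ` carrier F"

definition abs_galois_group ::
  "('a, 'm) ring_scheme \<Rightarrow>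
     ((('a list \<times> nat) multiset \<Rightarrow> 'a) \<Rightarrow> (('a list \<times> nat) multiset \<Rightarrow> 'a)) monoid" where
  "abs_galois_group F =
     BijGroup (carrier (field.alg_closure F))
       \<lparr>carrier := {\<sigma> \<in> Bij (carrier (field.alg_closure F)).
                     \<sigma> \<in> ring_iso (field.alg_closure F) (field.alg_closure F) \<and>
                     (\<forall>x\<in>base_image F. \<sigma> x = x)}\<rparr>"

text \<open>
  The basic open sets are the cosets \<open>\<sigma> Gal(F'/E)\<close>, where \<open>F'\<close> is the algebraic closure of \<open>F\<close>
  and \<open>E\<close> ranges over the finite extensions of \<open>F\<close> in \<open>F'\<close>.
\<close>

definition krull_topology ::
  "('a, 'm) ring_scheme \<Rightarrow>
     ((('a list \<times> nat) multiset \<Rightarrow> 'a) \<Rightarrow> (('a list \<times> nat) multiset \<Rightarrow> 'a)) topology" where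
  "krull_topology F =
     topology_generated_by
       {{\<tau> \<in> carrier (abs_galois_group F). \<forall>x\<in>E. \<tau> x = \<sigma> x} | \<sigma> E.
          \<sigma> \<in> carrier (abs_galois_group F) \<and>
          subfield E (field.alg_closure F) \<and> base_image F \<subseteq> E \<and>
          ring.finite_dimension (field.alg_closure F) (base_image F) E}"

definition anabelomorphism ::
  "('a, 'm) ring_scheme \<Rightarrow> ('b, 'k) ring_scheme \<Rightarrow>
     (((('a list \<times> nat) multiset \<Rightarrow> 'a) \<Rightarrow> (('a list \<times> nat) multiset \<Rightarrow> 'a)) \<Rightarrow>
      ((('b list \<times> nat) multiset \<Rightarrow> 'b) \<Rightarrow> (('b list \<times> nat) multiset \<Rightarrow> 'b))) \<Rightarrow> bool" where
  "anabelomorphism F E \<alpha> \<longleftrightarrow>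
     \<alpha> \<in> iso (abs_galois_group F) (abs_galois_group E) \<and>
     homeomorphic_map (krull_topology F) (krull_topology E) \<alpha>"

definition anabelomorphic :: "('a, 'm) ring_scheme \<Rightarrow> ('b, 'k) ring_scheme \<Rightarrow> bool" where
  "anabelomorphic F E \<longleftrightarrow> (\<exists>\<alpha>. anabelomorphism F E \<alpha>)"

definition anabelomorphically_connected ::
  "nat \<Rightarrow> ('a, 'm) ring_scheme \<Rightarrow> (nat \<Rightarrow> 'a \<Rightarrow> real) \<Rightarrow>
     ('b, 'k) ring_scheme \<Rightarrow> (nat \<Rightarrow> 'b \<Rightarrow> real) \<Rightarrow> bool" where
  "anabelomorphically_connected n K u M w \<longleftrightarrow>
     number_field K \<and> number_field M \<and>
     (\<forall>i\<in>{1..n}. nonarch_place K (u i) \<and> nonarch_place M (w i) \<and>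
                 anabelomorphic (place_completion K (u i)) (place_completion M (w i)))"

end

theory Submission
  imports Defs
begin

text \<open>
  The isomorphisms \<open>\<alpha> i\<close> already identify the absolute Galois group of the completion of \<open>K\<close>
  at \<open>v i\<close> with that of \<open>L i\<close>, so neither the local fields nor \<open>K\<close> need to be enlarged once
  the family \<open>L 1, \<dots>, L n\<close> itself is known to be cohesive: one takes \<open>L' = L\<close>, \<open>K' = K\<close> and
  \<open>u = v\<close>. The mathematical content is therefore that \<^emph>\<open>every\<close> finite family of local
  fields, with repetitions allowed, is cohesive (\<open>local_fields_cohesive\<close>), and that the
  completion of a number field \<open>M\<close> densely embedded in \<open>L\<close> has the same absolute Galois
  group as \<open>L\<close> (\<open>completion_anabelomorphic\<close>).

  For cohesiveness, write \<open>|.|\<close> for the absolute value of \<open>L i\<close>. By Krasner's lemma and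
  Newton's method, \<open>L i\<close> contains an element \<open>g i\<close> that is algebraic over the rationals,
  generates \<open>L i\<close> topologically and satisfies \<open>|g i - i| < 1 / n\<close> (\<open>generator_near_int\<close>).
  One integer polynomial \<open>H\<close> has all the \<open>g i\<close> as simple roots
  (\<open>common_relation_simple_roots\<close>). Let \<open>P\<close> be the product of the residue characteristics
  and \<open>q\<close> a prime not dividing \<open>P\<close>. The polynomial \<open>f = q\<^sup>2 H + P ^ k (x ^ (deg H + 1) + q)\<close>
  is Eisenstein at \<open>q\<close>, hence irreducible over the rationals, and for large \<open>k\<close> it is so
  close to \<open>q\<^sup>2 H\<close> in every \<open>L i\<close> that it has a root \<open>t i\<close> near \<open>g i\<close> which still generates
  \<open>L i\<close> (\<open>perturbed_root\<close>). Let \<open>z\<close> be a complex root of \<open>f\<close> and \<open>M\<close> the number field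
  generated by \<open>z\<close>; since \<open>f\<close> is irreducible, \<open>z \<mapsto> t i\<close> defines a dense embedding of \<open>M\<close> in
  \<open>L i\<close>. The induced absolute values are pairwise inequivalent: if those at \<open>i \<noteq> j\<close> were
  equivalent, they would have the same residue characteristic and hence agree, but \<open>z - i\<close>
  has absolute value less than \<open>1 / n\<close> at \<open>i\<close>, whereas at \<open>j\<close> it has the absolute value of
  the integer \<open>j - i\<close>, which is at least \<open>1 / |j - i| \<ge> 1 / n\<close>.

  Three facts on local fields are needed on the way. The \<open>p\<close>-adic absolute value extends to
  finite extensions of \<open>Qp p\<close> (\<open>absval_extension\<close>): a norm with respect to a basis is
  equivalent to a submultiplicative one, and a minimal submultiplicative seminorm below that
  one is multiplicative (\<open>exists_multiplicative_seminorm\<close>). Finite extensions are complete,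
  because coordinates with respect to a basis are bounded (\<open>bounded_coordinates\<close>). Finally,
  isomorphic fields have isomorphic absolute Galois groups, by uniqueness of the algebraic
  closure (\<open>algebraic_closure_unique\<close>).

  All analysis is done in a commutative ring \<^emph>\<open>type\<close> with a multiplicative seminorm, in
  which the relation \<open>N (x - y) = 0\<close> plays the role of equality. The type \<open>'b univ\<close> below
  maps onto every commutative ring that is given by a record with elements of type \<open>'b\<close>, so
  that results for types apply to such rings.
\<close>

section \<open>Non-archimedean seminorms and Newton's method\<close>

text \<open>The value of an integer polynomial at a point of a commutative ring.\<close>
definition iev :: "int poly \<Rightarrow> 'r::comm_ring_1 \<Rightarrow> 'r" where
  "iev G x = poly (map_poly of_int G) x"

lemma iev_0 [simp]: "iev 0 x = 0"
  by (simp add: iev_def)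

lemma iev_pCons [simp]: "iev (pCons a p) x = of_int a + x * iev p x"
  by (simp add: iev_def map_poly_pCons)

lemma iev_add [simp]: "iev (p + q) x = iev p x + iev q x"
  by (induction p q rule: poly_induct2) (simp_all add: algebra_simps)

lemma iev_smult [simp]: "iev (Polynomial.smult c p) x = of_int c * iev p x"
  by (induction p) (simp_all add: algebra_simps)

lemma iev_minus [simp]: "iev (- p) x = - iev p x"
  by (induction p) (simp_all add: algebra_simps)

lemma iev_diff [simp]: "iev (p - q) x = iev p x - iev q x"
  using iev_add[of p "- q" x] by simp

lemma iev_mult [simp]: "iev (p * q) x = iev p x * iev q x"
  by (induction p) (simp_all add: algebra_simps)

lemma iev_1 [simp]: "iev 1 x = 1"
  by (simp add: one_pCons)

lemma iev_monom [simp]: "iev (Polynomial.monom c k) x = of_int c * x ^ k"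
  by (induction k) (simp_all add: monom_Suc monom_0 algebra_simps)

lemma iev_sum: "iev (\<Sum>i\<in>A. p i) x = (\<Sum>i\<in>A. iev (p i) x)"
  by (induction A rule: infinite_finite_induct) simp_all

text \<open>
  A multiplicative ultrametric seminorm on a commutative ring. Elements other than \<open>0\<close> may
  have seminorm \<open>0\<close>; the elements that do form a prime ideal, and statements about the
  corresponding quotient are expressed by \<open>N (x - y) = 0\<close> in place of \<open>x = y\<close>.
\<close>
locale nonarch_ring =
  fixes N :: "'r::comm_ring_1 \<Rightarrow> real"
  assumes N_nonneg [simp]: "0 \<le> N x"
    and N_zero [simp]: "N 0 = 0"
    and N_one [simp]: "N 1 = 1"
    and N_mult: "N (x * y) = N x * N y"
    and N_add: "N (x + y) \<le> max (N x) (N y)"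
begin

lemma N_uminus [simp]: "N (- x) = N x"
proof -
  have "N (-1) * N (-1) = 1" using N_mult[of "-1" "-1"] by simp
  hence "N (-1) = 1" using N_nonneg[of "-1"] by (metis abs_of_nonneg real_sqrt_abs2 real_sqrt_one)
  thus ?thesis using N_mult[of "-1" x] by simp
qed

lemma N_diff: "N (x - y) \<le> max (N x) (N y)"
  using N_add[of x "-y"] by simp

lemma N_diff_commute: "N (x - y) = N (y - x)"
  using N_uminus[of "x - y"] by simp

lemma N_add_le: "N x \<le> e \<Longrightarrow> N y \<le> e \<Longrightarrow> N (x + y) \<le> e"
  using N_add[of x y] by linarith

lemma N_diff_le: "N x \<le> e \<Longrightarrow> N y \<le> e \<Longrightarrow> N (x - y) \<le> e"
  using N_diff[of x y] by linarith

lemma N_add_less: "N x < e \<Longrightarrow> N y < e \<Longrightarrow> N (x + y) < e"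
  using N_add[of x y] by linarith

lemma N_diff_less: "N x < e \<Longrightarrow> N y < e \<Longrightarrow> N (x - y) < e"
  using N_diff[of x y] by linarith

lemma N_diff_triangle: "N (x - z) \<le> max (N (x - y)) (N (y - z))"
  using N_add[of "x - y" "y - z"] by simp

lemma N_eq_of_close: "N (x - y) < N y \<Longrightarrow> N x = N y"
  using N_add[of "x - y" y] N_diff[of x "x - y"] by simp

lemma N_cong: "N (x - y) = 0 \<Longrightarrow> N x = N y"
  using N_add[of "x - y" y] N_diff[of x "x - y"] N_nonneg[of x] N_nonneg[of y] by simp

lemma N_power: "N (x ^ n) = N x ^ n"
  by (induction n) (simp_all add: N_mult)

lemma N_sum_le: "0 \<le> e \<Longrightarrow> (\<And>i. i \<in> A \<Longrightarrow> N (f i) \<le> e) \<Longrightarrow> N (sum f A) \<le> e"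
  by (induction A rule: infinite_finite_induct) (simp_all add: N_add_le)

lemma N_of_nat: "N (of_nat n) \<le> 1"
  by (induction n) (simp_all add: N_add_le)

lemma N_of_int: "N (of_int n) \<le> 1"
proof (cases "n \<ge> 0")
  case True
  then show ?thesis using N_of_nat[of "nat n"] by simp
next
  case False
  then show ?thesis using N_of_nat[of "nat (- n)"] by simp
qed

lemma N_mult_le_1: "N x \<le> 1 \<Longrightarrow> N (x * y) \<le> N y"
  by (simp add: N_mult mult_left_le_one_le)

lemma iev_le_1: "N x \<le> 1 \<Longrightarrow> N (iev G x) \<le> 1"
proof (induction G)
  case (pCons a p)
  then show ?case using N_of_int[of a] N_mult_le_1[of x "iev p x"] by (auto intro!: N_add_le)
qed auto

text \<open>
  Integers have seminorm at most \<open>1\<close>, so the coefficients play no role in these two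
  estimates.
\<close>
lemma iev_lipschitz:
  assumes "N x \<le> 1" "N h \<le> 1"
  shows "N (iev G (x + h) - iev G x) \<le> N h"
proof (induction G)
  case (pCons a p)
  have "iev (pCons a p) (x + h) - iev (pCons a p) x = (x + h) * (iev p (x + h) - iev p x) + h * iev p x"
    by (simp add: algebra_simps)
  moreover have "N ((x + h) * (iev p (x + h) - iev p x)) \<le> N h"
    using pCons(2) N_mult_le_1[of "x + h"] assms N_add_le[of x 1 h] order_trans by blast
  moreover have "N (h * iev p x) \<le> N h"
    using N_mult_le_1[of "iev p x" h] iev_le_1[OF assms(1)] by (simp add: mult.commute)
  ultimately show ?case using N_add_le by metis
qed auto

lemma iev_taylor:
  assumes "N x \<le> 1" "N h \<le> 1"
  shows "N (iev G (x + h) - iev G x - h * iev (pderiv G) x) \<le> N h ^ 2"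
proof (induction G)
  case (pCons a p)
  have "iev (pCons a p) (x + h) - iev (pCons a p) x - h * iev (pderiv (pCons a p)) x =
     x * (iev p (x + h) - iev p x - h * iev (pderiv p) x) + h * (iev p (x + h) - iev p x)"
    by (simp add: algebra_simps pderiv_pCons)
  moreover have "N (x * (iev p (x + h) - iev p x - h * iev (pderiv p) x)) \<le> N h ^ 2"
    using pCons(2) N_mult_le_1[OF assms(1)] order_trans by blast
  moreover have "N (h * (iev p (x + h) - iev p x)) \<le> N h ^ 2"
    using iev_lipschitz[OF assms, of p] by (simp add: N_mult power2_eq_square mult_left_mono)
  ultimately show ?case using N_add_le by metis
qed auto

end

text \<open>The quotient by the elements of seminorm \<open>0\<close> is a field.\<close>
locale nonarch_fld = nonarch_ring N for N :: "'r::comm_ring_1 \<Rightarrow> real" +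
  assumes N_inverse: "N x \<noteq> 0 \<Longrightarrow> \<exists>y. N (x * y - 1) = 0"

text \<open>The quotient is a field that is complete with respect to the induced absolute value.\<close>
locale complete_nonarch_fld = nonarch_fld N for N :: "'r::comm_ring_1 \<Rightarrow> real" +
  assumes N_complete: "\<And>W :: nat \<Rightarrow> 'r. \<forall>e>0. \<exists>M. \<forall>m\<ge>M. \<forall>n\<ge>M. N (W m - W n) < e
     \<Longrightarrow> \<exists>y. (\<lambda>n. N (W n - y)) \<longlonglongrightarrow> 0"
begin

text \<open>
  The preimage of a topologically closed subfield of the quotient. The last condition says
  that the set is closed; it also makes it a union of classes modulo the elements of
  seminorm \<open>0\<close>.
\<close>
definition closed_subfield :: "'r set \<Rightarrow> bool" where
  "closed_subfield E \<longleftrightarrow> 1 \<in> E \<and> (\<forall>x\<in>E. \<forall>y\<in>E. x - y \<in> E \<and> x * y \<in> E) \<and>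
     (\<forall>x\<in>E. N x \<noteq> 0 \<longrightarrow> (\<exists>y\<in>E. N (x * y - 1) = 0)) \<and>
     (\<forall>x. (\<forall>e>0. \<exists>y\<in>E. N (x - y) < e) \<longrightarrow> x \<in> E)"

lemma closed_subfieldD:
  assumes "closed_subfield E"
  shows "1 \<in> E" "x \<in> E \<Longrightarrow> y \<in> E \<Longrightarrow> x - y \<in> E" "x \<in> E \<Longrightarrow> y \<in> E \<Longrightarrow> x * y \<in> E"
    "x \<in> E \<Longrightarrow> N x \<noteq> 0 \<Longrightarrow> \<exists>y\<in>E. N (x * y - 1) = 0"
    "(\<And>e. e > 0 \<Longrightarrow> \<exists>y\<in>E. N (x - y) < e) \<Longrightarrow> x \<in> E"
  using assms unfolding closed_subfield_def by auto

lemma closed_subfield_0: "closed_subfield E \<Longrightarrow> 0 \<in> E"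
  using closed_subfieldD(1,2) by (metis diff_self)

lemma closed_subfield_uminus: "closed_subfield E \<Longrightarrow> x \<in> E \<Longrightarrow> - x \<in> E"
  using closed_subfieldD(2) closed_subfield_0 by (metis diff_0)

lemma closed_subfield_add: "closed_subfield E \<Longrightarrow> x \<in> E \<Longrightarrow> y \<in> E \<Longrightarrow> x + y \<in> E"
  using closed_subfieldD(2) closed_subfield_uminus by (metis diff_minus_eq_add)

lemma closed_subfield_cong: "closed_subfield E \<Longrightarrow> y \<in> E \<Longrightarrow> N (x - y) = 0 \<Longrightarrow> x \<in> E"
  by (rule closed_subfieldD(5)) (auto intro!: bexI[of _ y])

lemma closed_subfield_of_nat: "closed_subfield E \<Longrightarrow> of_nat n \<in> E"
  by (induction n) (simp_all add: closed_subfield_0 closed_subfield_add closed_subfieldD(1))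

lemma closed_subfield_of_int: "closed_subfield E \<Longrightarrow> of_int n \<in> E"
  by (cases n rule: int_cases2) (simp_all add: closed_subfield_of_nat closed_subfield_uminus)

lemma closed_subfield_iev: "closed_subfield E \<Longrightarrow> x \<in> E \<Longrightarrow> iev G x \<in> E"
  by (induction G) (simp_all add: closed_subfield_0 closed_subfield_add closed_subfieldD(3) closed_subfield_of_int)

lemma closed_subfield_sum: "closed_subfield E \<Longrightarrow> (\<And>i. i \<in> A \<Longrightarrow> f i \<in> E) \<Longrightarrow> sum f A \<in> E"
  by (induction A rule: infinite_finite_induct) (simp_all add: closed_subfield_0 closed_subfield_add)

lemma closed_subfield_power: "closed_subfield E \<Longrightarrow> x \<in> E \<Longrightarrow> x ^ n \<in> E"
  by (induction n) (simp_all add: closed_subfieldD(1,3))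

lemma closed_subfield_divide:
  assumes E: "closed_subfield E" and "x \<in> E" "y \<in> E" "N y \<noteq> 0"
  shows "\<exists>z\<in>E. N (z * y - x) = 0"
proof -
  obtain w where w: "w \<in> E" "N (y * w - 1) = 0"
    using closed_subfieldD(4)[OF E] assms by blast
  have "(x * w) * y - x = x * (y * w - 1)" by (simp add: algebra_simps)
  hence "N ((x * w) * y - x) = 0" using w by (simp add: N_mult)
  thus ?thesis using w assms closed_subfieldD(3)[OF E] by blast
qed

lemma closed_subfield_UNIV: "closed_subfield UNIV"
  unfolding closed_subfield_def using N_inverse by auto

lemma tendsto_N:
  assumes "(\<lambda>n. N (W n - y)) \<longlonglongrightarrow> 0" "e > 0"
  shows "\<exists>M. \<forall>n\<ge>M. N (W n - y) < e"
  using LIMSEQ_D[OF assms] by simp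

text \<open>
  Hensel's lemma for an approximate root \<open>x\<close> with \<open>|G x| < |G' x|\<^sup>2\<close>. As the Newton iterates
  stay in any closed subfield \<open>E\<close> that contains \<open>x\<close>, so does the root.
\<close>
theorem newton:
  assumes E: "closed_subfield E" and x: "x \<in> E" "N x \<le> 1"
    and small: "N (iev G x) < N (iev (pderiv G) x) ^ 2"
  shows "\<exists>y\<in>E. N (iev G y) = 0 \<and> N (y - x) * N (iev (pderiv G) x) \<le> N (iev G x)"
proof -
  define D where "D = N (iev (pderiv G) x)"
  define t where "t = N (iev G x) / D ^ 2"
  have Dpos: "D > 0"
    using small N_nonneg[of "iev G x"] unfolding D_def
    by (metis N_nonneg less_eq_real_def not_less power_zero_numeral)
  have D1: "D \<le> 1" unfolding D_def by (rule iev_le_1[OF x(2)])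
  have t: "0 \<le> t" "t < 1"
    using small Dpos unfolding t_def D_def by (simp_all add: field_simps)
  have tD: "N (iev G x) = t * D ^ 2" using Dpos by (simp add: t_def)
  \<comment> \<open>The invariant of the \<open>n\<close>-th iterate. Linear convergence of the values \<open>G z\<close> suffices, so the
    exponent of \<open>t\<close> grows by one in each step although it could be doubled.\<close>
  define P where "P n z \<longleftrightarrow> z \<in> E \<and> N z \<le> 1 \<and> N (iev (pderiv G) z) = D \<and> N (iev G z) \<le> D ^ 2 * t ^ Suc n" for n z
  have step: "\<exists>z'. P (Suc n) z' \<and> N (z' - z) \<le> D * t ^ Suc n" if P: "P n z" for n z
  proof -
    note Pz = P[unfolded P_def]
    obtain u where u: "u \<in> E" "N (u * iev (pderiv G) z - iev G z) = 0"
      using closed_subfield_divide[OF E, of "iev G z" "iev (pderiv G) z"] Pz Dpos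
        closed_subfield_iev[OF E] by auto
    have "N u * D = N (iev G z)"
      using N_cong[OF u(2)] Pz by (simp add: N_mult)
    hence "N u * D \<le> (D * t ^ Suc n) * D" using Pz by (simp add: power2_eq_square mult_ac)
    hence Nu: "N u \<le> D * t ^ Suc n" using Dpos mult_right_le_imp_le by blast
    have "t ^ Suc n < 1" using t by (metis power_Suc_less_one less_eq_real_def power_0_Suc zero_less_one)
    hence "D * t ^ Suc n < D" using Dpos by simp
    hence NuD: "N u < D" using Nu by simp
    hence Nu1: "N (- u) \<le> 1" using D1 by simp
    have "N (iev G (z + - u) - iev G z - (- u) * iev (pderiv G) z) \<le> N u ^ 2"
      using iev_taylor[of z "- u" G] Pz Nu1 by simp
    moreover have "iev G (z - u) = (iev G (z + - u) - iev G z - (- u) * iev (pderiv G) z) - (u * iev (pderiv G) z - iev G z)"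
      by (simp add: algebra_simps)
    ultimately have "N (iev G (z - u)) \<le> N u ^ 2"
      using u(2) by (metis N_diff_le zero_le_power2)
    also have "\<dots> \<le> (D * t ^ Suc n) ^ 2" using Nu by (intro power_mono) auto
    also have "\<dots> = D ^ 2 * t ^ (Suc n + Suc n)" by (simp add: power_mult_distrib power2_eq_square power_add)
    also have "\<dots> \<le> D ^ 2 * t ^ Suc (Suc n)" using t by (intro mult_left_mono power_decreasing) auto
    finally have 1: "N (iev G (z - u)) \<le> D ^ 2 * t ^ Suc (Suc n)" .
    have "N (iev (pderiv G) (z + - u) - iev (pderiv G) z) \<le> N u"
      using iev_lipschitz[of z "- u" "pderiv G"] Pz Nu1 by simp
    hence "N (iev (pderiv G) (z - u) - iev (pderiv G) z) < N (iev (pderiv G) z)"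
      using NuD Pz by simp
    hence 2: "N (iev (pderiv G) (z - u)) = D" using N_eq_of_close Pz by metis
    have "N (z - u) \<le> 1" using N_diff_le[of z 1 u] Pz Nu1 by simp
    hence "P (Suc n) (z - u)" unfolding P_def using 1 2 u Pz closed_subfieldD(2)[OF E] by auto
    moreover have "N ((z - u) - z) \<le> D * t ^ Suc n" using Nu by simp
    ultimately show ?thesis by blast
  qed
  have P0: "P 0 x" unfolding P_def using x tD by (auto simp: D_def)
  obtain W where X0: "W 0 = x" and XP: "\<And>n. P n (W n)" and XS: "\<And>n. N (W (Suc n) - W n) \<le> D * t ^ Suc n"
    using dependent_nat_choice[of P "\<lambda>n z z'. N (z' - z) \<le> D * t ^ Suc n"] step P0
  proof -
    assume a: "\<And>W. W 0 = x \<Longrightarrow> (\<And>n. P n (W n)) \<Longrightarrow> (\<And>n. N (W (Suc n) - W n) \<le> D * t ^ Suc n) \<Longrightarrow> thesis"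
    define Q where "Q n z \<longleftrightarrow> P n z \<and> (n = 0 \<longrightarrow> z = x)" for n z
    have "\<exists>f. \<forall>n. Q n (f n) \<and> N (f (Suc n) - f n) \<le> D * t ^ Suc n"
      by (rule dependent_nat_choice) (use P0 step in \<open>auto simp: Q_def\<close>)
    then obtain f where "\<forall>n. Q n (f n) \<and> N (f (Suc n) - f n) \<le> D * t ^ Suc n" by blast
    thus thesis using a[of f] by (simp add: Q_def)
  qed
  \<comment> \<open>In an ultrametric ring, bounding the single steps bounds the distance to all later iterates.\<close>
  have far: "N (W (n + k) - W n) \<le> D * t ^ Suc n" for n k
  proof (induction k)
    case 0 show ?case using Dpos t by simp
  next
    case (Suc k)
    have "N (W (Suc (n + k)) - W (n + k)) \<le> D * t ^ Suc n"
      using XS[of "n + k"] t Dpos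
      by (smt (verit) le_add1 mult_left_mono power_decreasing Suc_le_mono)
    thus ?case using Suc N_diff_triangle[of "W (n + Suc k)" "W n" "W (n + k)"] by simp
  qed
  have lim: "(\<lambda>n. D * t ^ Suc n) \<longlonglongrightarrow> 0"
    using t by (intro tendsto_mult_right_zero LIMSEQ_Suc LIMSEQ_power_zero) auto
  have "\<exists>y. (\<lambda>n. N (W n - y)) \<longlonglongrightarrow> 0"
  proof (rule N_complete, intro allI impI)
    fix e :: real assume "e > 0"
    then obtain M where M: "D * t ^ Suc M < e"
      using LIMSEQ_D[OF lim, of e] Dpos t by fastforce
    have near: "N (W m - W M) < e" if "m \<ge> M" for m
      using far[of M "m - M"] M that by simp
    have "N (W m - W n) < e" if "m \<ge> M" "n \<ge> M" for m n
      using N_diff_triangle[of "W m" "W n" "W M"] near[OF that(1)] near[OF that(2)]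
        N_diff_commute[of "W M" "W n"] by simp
    thus "\<exists>M. \<forall>m\<ge>M. \<forall>n\<ge>M. N (W m - W n) < e" by blast
  qed
  then obtain y where y: "(\<lambda>n. N (W n - y)) \<longlonglongrightarrow> 0" by blast
  have yE: "y \<in> E"
  proof (rule closed_subfieldD(5)[OF E])
    fix e :: real assume "e > 0"
    then obtain M where "N (W M - y) < e" using tendsto_N[OF y] by blast
    thus "\<exists>z\<in>E. N (y - z) < e" using XP[of M] N_diff_commute P_def by metis
  qed
  have "N (y - x) \<le> D * t"
  proof (rule field_le_epsilon)
    fix e :: real assume "e > 0"
    then obtain M where M: "N (W M - y) < e" using tendsto_N[OF y] by blast
    have "N (W M - x) \<le> D * t" using far[of 0 M] X0 by simp
    moreover have "0 \<le> D * t" using Dpos t by simp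
    ultimately show "N (y - x) \<le> D * t + e"
      using N_diff_triangle[of y x "W M"] M N_diff_commute[of y "W M"] \<open>e > 0\<close> by linarith
  qed
  hence "N (y - x) * D \<le> N (iev G x)"
    using mult_right_mono[of "N (y - x)" "D * t" D] tD Dpos by (simp add: power2_eq_square mult_ac)
  moreover have "N (iev G y) = 0"
  proof -
    have "N (iev G y) \<le> e" if "e > 0" for e
    proof -
      define e' where "e' = min e 1"
      have e': "e' > 0" "e' \<le> e" "e' \<le> 1" using that by (auto simp: e'_def)
      obtain M1 where M1: "\<forall>n\<ge>M1. N (W n - y) < e'" using tendsto_N[OF y e'(1)] by blast
      obtain M2 where M2: "\<forall>n\<ge>M2. D * t ^ Suc n < e'"
        using LIMSEQ_D[OF lim e'(1)] Dpos t by fastforce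
      define n where "n = max M1 M2"
      have yn: "N (y - W n) < e'" using M1 N_diff_commute[of y "W n"] by (simp add: n_def)
      have "N (iev G (W n + (y - W n)) - iev G (W n)) \<le> N (y - W n)"
        using yn e' XP[of n, unfolded P_def] by (intro iev_lipschitz) auto
      hence a: "N (iev G y - iev G (W n)) < e'"
        using yn by simp
      have "N (iev G (W n)) \<le> D * (D * t ^ Suc n)" using XP[of n, unfolded P_def] by (simp add: power2_eq_square mult_ac)
      also have "\<dots> \<le> D * t ^ Suc n" using D1 Dpos t by (intro mult_left_le_one_le) auto
      also have "\<dots> < e'" using M2 by (simp add: n_def)
      finally have "N (iev G y) < e'" using N_add_less[OF a, of "iev G (W n)"] by simp
      thus ?thesis using e' by simp
    qed
    thus ?thesis using N_nonneg[of "iev G y"] by (metis dense_ge order_antisym)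
  qed
  ultimately show ?thesis using yE unfolding D_def by blast
qed

text \<open>
  A substitute for being a separable algebraic element of the unit ball: some integer
  polynomials have arbitrarily small values at \<open>a\<close>, while their derivatives at \<open>a\<close> stay
  bounded away from \<open>0\<close>. An element that is algebraic over \<open>Qp p\<close> has this property, as one
  sees by approximating the coefficients of its minimal polynomial
  (\<open>approx_root_of_algebraic\<close>).
\<close>
definition approx_root :: "'r \<Rightarrow> bool" where
  "approx_root a \<longleftrightarrow> N a \<le> 1 \<and> (\<exists>d>0. \<forall>e>0. \<exists>G. N (iev G a) < e \<and> d \<le> N (iev (pderiv G) a))"

text \<open>
  Krasner's lemma: every \<open>b\<close> sufficiently close to \<open>a\<close> generates a closed subfield that
  contains \<open>a\<close>. Newton's method started at \<open>b\<close> yields, for each polynomial \<open>G\<close> that nearly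
  vanishes at \<open>a\<close>, a root of \<open>G\<close> in this subfield, and by Taylor's formula this root is as
  close to \<open>a\<close> as \<open>G a\<close> is to \<open>0\<close>.
\<close>
theorem krasner:
  assumes "approx_root a"
  shows "\<exists>e>0. \<forall>b E. N (b - a) < e \<longrightarrow> closed_subfield E \<longrightarrow> b \<in> E \<longrightarrow> a \<in> E"
proof -
  obtain d where d: "d > 0" "\<And>e. e > 0 \<Longrightarrow> \<exists>G. N (iev G a) < e \<and> d \<le> N (iev (pderiv G) a)" and a1: "N a \<le> 1"
    using assms unfolding approx_root_def by blast
  have d1: "d \<le> 1"
  proof -
    obtain G where "d \<le> N (iev (pderiv G) a)" using d(2)[of 1] by auto
    thus ?thesis using iev_le_1[OF a1, of "pderiv G"] by simp
  qed
  have dd: "d ^ 2 \<le> d" "d ^ 2 \<le> 1" "0 < d ^ 2" using d1 d(1) by (auto simp: power2_eq_square mult_le_one)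
  show ?thesis
  proof (intro exI[of _ "d ^ 2"] conjI allI impI)
    \<comment> \<open>With \<open>|b - a| < d\<^sup>2\<close> one gets \<open>|G b| < d\<^sup>2 \<le> |G' b|\<^sup>2\<close>, which is what Newton's method requires.\<close>
    show "0 < d ^ 2" using dd by simp
    fix b E assume ba: "N (b - a) < d ^ 2" and E: "closed_subfield E" and bE: "b \<in> E"
    have b1: "N b \<le> 1" using N_add_le[of "b - a" 1 a] ba dd a1 by simp
    show "a \<in> E"
    proof (rule closed_subfieldD(5)[OF E])
      fix e :: real assume e: "e > 0"
      \<comment> \<open>The bound \<open>d\<^sup>2\<close> is for Newton's method, the bound \<open>e * d\<close> makes the root \<open>e\<close>-close to \<open>a\<close>.\<close>
      define h where "h = min (d ^ 2) (e * d)"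
      have h: "h > 0" "h \<le> d ^ 2" "h \<le> e * d" using mult_pos_pos[OF e d(1)] dd unfolding h_def by linarith+
      obtain G where G: "N (iev G a) < h" "d \<le> N (iev (pderiv G) a)" using d(2)[OF h(1)] by blast
      have lip: "N (iev H b - iev H a) \<le> N (b - a)" for H
        using iev_lipschitz[of a "b - a" H] a1 ba dd by simp
      have Gb: "N (iev G b) < d ^ 2"
        using N_add_less[of "iev G b - iev G a" "d ^ 2" "iev G a"] lip[of G] ba G h by simp
      have "N (iev (pderiv G) b - iev (pderiv G) a) < N (iev (pderiv G) a)"
        using lip[of "pderiv G"] ba G dd by linarith
      hence D: "N (iev (pderiv G) b) = N (iev (pderiv G) a)" by (rule N_eq_of_close)
      define D where "D = N (iev (pderiv G) a)"
      have dD: "d \<le> D" "D > 0" using G d unfolding D_def by auto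
      have "d ^ 2 \<le> D ^ 2" using dD d by (intro power_mono) auto
      then obtain y where y: "y \<in> E" "N (iev G y) = 0" "N (y - b) * D \<le> N (iev G b)"
        using newton[OF E bE b1, of G] Gb D unfolding D_def by auto
      have "N (y - b) * D < d * D" using y(3) Gb dD d
        by (smt (verit) mult_left_mono power2_eq_square)
      hence "N (y - b) < D" using dD by (smt (verit) mult_right_less_imp_less)
      hence yaD: "N (y - a) < D"
        using N_add_less[of "y - b" D "b - a"] ba dd dD by simp
      define k where "k = y - a"
      have kD: "N k < D" using yaD by (simp add: k_def)
      have D1: "D \<le> 1" unfolding D_def by (rule iev_le_1[OF a1])
      have T: "N (iev G y - iev G a - k * iev (pderiv G) a) \<le> N k ^ 2"
        using iev_taylor[of a k G] a1 kD D1 by (simp add: k_def)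
      have "N (k * iev (pderiv G) a) \<le> max (N k ^ 2) (N (iev G a))"
      proof -
        have "k * iev (pderiv G) a = (iev G y - iev G a) - (iev G y - iev G a - k * iev (pderiv G) a)"
          by simp
        moreover have "N (iev G y - iev G a) \<le> max (N k ^ 2) (N (iev G a))"
          using y(2) N_diff[of "iev G y" "iev G a"] by auto
        ultimately show ?thesis using T by (metis N_diff_le max.coboundedI1)
      qed
      \<comment> \<open>As \<open>|k| < D\<close>, the first argument of the maximum cannot be the larger one, unless \<open>|k| = 0\<close>.\<close>
      hence *: "N k * D \<le> max (N k * N k) (N (iev G a))" by (simp add: N_mult D_def power2_eq_square)
      have "N k * D \<le> N (iev G a)"
      proof (cases "N k = 0")
        case False
        hence "N k * N k < N k * D" using kD N_nonneg[of k] by (simp add: less_le)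
        thus ?thesis using * by linarith
      qed simp
      hence "N k * d \<le> N (iev G a)" using dD N_nonneg[of k] by (smt (verit) mult_left_mono)
      hence "N k * d < e * d" using G h by linarith
      hence "N k < e" using d(1) by simp
      thus "\<exists>y\<in>E. N (a - y) < e" using y(1) N_diff_commute[of a y] unfolding k_def by metis
    qed
  qed
qed

lemma approx_rootI:
  assumes "N a \<le> 1" "N (iev G a) = 0" "N (iev (pderiv G) a) \<noteq> 0"
  shows "approx_root a"
  unfolding approx_root_def using assms by (auto intro!: exI[of _ "N (iev (pderiv G) a)"] exI[of _ G] simp: less_le)

end

section \<open>Topological generators\<close>
context complete_nonarch_fld
begin

text \<open>The closed subfield generated by \<open>b\<close> is everything.\<close>
definition generates :: "'r \<Rightarrow> bool" where
  "generates b \<longleftrightarrow> (\<forall>E. closed_subfield E \<longrightarrow> b \<in> E \<longrightarrow> E = UNIV)"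

lemma power_small:
  assumes "N p < 1" "e > 0"
  shows "\<exists>k. N (p ^ k) < e"
proof -
  obtain k where "N p ^ k < e" using real_arch_pow_inv[of e "N p"] assms by blast
  thus ?thesis by (auto simp: N_power)
qed

lemma closed_subfield_cancel:
  assumes E: "closed_subfield E" and "p \<in> E" "N p \<noteq> 0" "p * b \<in> E"
  shows "b \<in> E"
proof -
  obtain z where z: "z \<in> E" "N (z * p - p * b) = 0"
    using closed_subfield_divide[OF E assms(4,2,3)] by blast
  have "z * p - p * b = p * (z - b)" by (simp add: algebra_simps)
  hence "N (b - z) = 0" using z assms(3) by (simp add: N_mult N_diff_commute)
  thus ?thesis using closed_subfield_cong[OF E] z by blast
qed

text \<open>
  A primitive element theorem: \<open>a + p ^ k b\<close> is so close to \<open>a\<close> for large \<open>k\<close> that, by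
  Krasner's lemma, it generates \<open>a\<close>, and then also \<open>b\<close>.
\<close>
lemma primitive_element_finite:
  assumes p: "N (of_int p) < 1" "N (of_int p) \<noteq> 0"
  assumes "finite A" "\<And>a. a \<in> A \<Longrightarrow> approx_root a"
  shows "\<exists>b. \<forall>E. closed_subfield E \<longrightarrow> b \<in> E \<longrightarrow> A \<subseteq> E"
  using assms(3,4)
proof (induction A rule: finite_induct)
  case (insert a A)
  then obtain b where b: "\<And>E. closed_subfield E \<Longrightarrow> b \<in> E \<Longrightarrow> A \<subseteq> E" by blast
  obtain e where e: "e > 0" "\<And>c E. N (c - a) < e \<Longrightarrow> closed_subfield E \<Longrightarrow> c \<in> E \<Longrightarrow> a \<in> E"
    using krasner[of a] insert(4) by blast
  obtain k where k: "N (of_int p ^ k :: 'r) < e / (N b + 1)"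
    using power_small[OF p(1), of "e / (N b + 1)"] e(1) N_nonneg[of b] by (auto simp: add_nonneg_pos)
  define q where "q = (of_int p ^ k :: 'r)"
  have q: "N q \<noteq> 0" using p(2) by (simp add: q_def N_power)
  have "N q * (N b + 1) < e" using k N_nonneg[of b] by (simp add: q_def pos_less_divide_eq add_nonneg_pos)
  hence small: "N ((a + q * b) - a) < e"
    using N_nonneg[of q] unfolding N_mult distrib_left add_diff_cancel_left' by linarith
  show ?case
  proof (intro exI[of _ "a + q * b"] allI impI)
    fix E assume E: "closed_subfield E" and c: "a + q * b \<in> E"
    have a: "a \<in> E" using e(2)[OF small E c] .
    have "q * b \<in> E" using closed_subfieldD(2)[OF E c a] by simp
    moreover have "q \<in> E"
      unfolding q_def by (rule closed_subfield_power[OF E closed_subfield_of_int[OF E]])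
    ultimately have "b \<in> E" using closed_subfield_cancel[OF E _ q] by blast
    thus "insert a A \<subseteq> E" using a b[OF E] by auto
  qed
qed auto

text \<open>
  The generator is found in two steps. First, \<open>b' = c + p ^ k b\<close> is close to the integer \<open>c\<close>
  and generates everything if \<open>b\<close> does, but it need not be algebraic over the rationals.
  Then Newton's method replaces \<open>b'\<close> by a nearby simple root \<open>g\<close> of an integer polynomial,
  which generates \<open>b'\<close> by Krasner's lemma.
\<close>
lemma generator_near_int:
  assumes p: "N (of_int p) < 1" "N (of_int p) \<noteq> 0"
    and alg: "\<And>a. N a \<le> 1 \<Longrightarrow> approx_root a"
    and A: "finite A" "\<And>a. a \<in> A \<Longrightarrow> N a \<le> 1" "\<And>E. closed_subfield E \<Longrightarrow> A \<subseteq> E \<Longrightarrow> E = UNIV"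
    and e: "e > 0"
  shows "\<exists>g G. N (g - of_int c) < e \<and> N g \<le> 1 \<and> N (iev G g) = 0 \<and> N (iev (pderiv G) g) \<noteq> 0 \<and> generates g"
proof -
  obtain b where b: "\<And>E. closed_subfield E \<Longrightarrow> b \<in> E \<Longrightarrow> A \<subseteq> E"
    using primitive_element_finite[OF p A(1)] alg A(2) by blast
  define e1 where "e1 = min e 1"
  have e1: "e1 > 0" "e1 \<le> e" "e1 \<le> 1" using e by (auto simp: e1_def)
  obtain k where k: "N (of_int p ^ k :: 'r) < e1 / (N b + 1)"
    using power_small[OF p(1), of "e1 / (N b + 1)"] e1(1) N_nonneg[of b] by (auto simp: add_nonneg_pos)
  define q where "q = (of_int p ^ k :: 'r)"
  have q: "N q \<noteq> 0" using p(2) by (simp add: q_def N_power)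
  have "N q * (N b + 1) < e1" using k N_nonneg[of b] by (simp add: q_def pos_less_divide_eq add_nonneg_pos)
  hence qb: "N (q * b) < e1"
    using N_nonneg[of q] unfolding N_mult distrib_left add_diff_cancel_left' by linarith
  define b' where "b' = of_int c + q * b"
  have b'1: "N b' \<le> 1" unfolding b'_def using N_of_int[of c] qb e1 by (intro N_add_le) auto
  have gen: "E = UNIV" if E: "closed_subfield E" and c: "b' \<in> E" for E
  proof -
    have "b' - of_int c \<in> E" using closed_subfieldD(2)[OF E c closed_subfield_of_int[OF E]] .
    hence "q * b \<in> E" by (simp add: b'_def)
    moreover have "q \<in> E"
      unfolding q_def by (rule closed_subfield_power[OF E closed_subfield_of_int[OF E]])
    ultimately have "b \<in> E" using closed_subfield_cancel[OF E _ q] by blast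
    thus ?thesis using A(3)[OF E] b[OF E] by blast
  qed
  obtain d where d: "d > 0" "\<And>e. e > 0 \<Longrightarrow> \<exists>G. N (iev G b') < e \<and> d \<le> N (iev (pderiv G) b')"
    using alg[OF b'1] unfolding approx_root_def by blast
  obtain h where h: "h > 0" "\<And>c E. N (c - b') < h \<Longrightarrow> closed_subfield E \<Longrightarrow> c \<in> E \<Longrightarrow> b' \<in> E"
    using krasner[OF alg[OF b'1]] by blast
  define t where "t = min (min h e1) d"
  have t: "t > 0" "t \<le> h" "t \<le> e1" "t \<le> d" using h e1 d by (auto simp: t_def)
  obtain G where G: "N (iev G b') < d * t" "d \<le> N (iev (pderiv G) b')" using d(2)[of "d * t"] d(1) t(1) by auto
  have "d * t \<le> d ^ 2" using t d by (simp add: power2_eq_square)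
  also have "\<dots> \<le> N (iev (pderiv G) b') ^ 2" using G d by (intro power_mono) auto
  finally obtain g where g: "N (iev G g) = 0" "N (g - b') * N (iev (pderiv G) b') \<le> N (iev G b')"
    using newton[OF closed_subfield_UNIV _ b'1, of G] G by auto
  have "N (g - b') * d \<le> N (g - b') * N (iev (pderiv G) b')" using G by (intro mult_left_mono) auto
  hence "N (g - b') * d < t * d" using g G by (simp add: mult.commute)
  hence gb: "N (g - b') < t" using d(1) by simp
  have gc: "N (g - of_int c) < e"
    using N_add_less[of "g - b'" e1 "b' - of_int c"] gb t qb e1 by (simp add: b'_def)
  have g1: "N g \<le> 1" using N_add_le[of "g - b'" 1 b'] gb t e1 b'1 by simp
  have "N (iev (pderiv G) (b' + (g - b')) - iev (pderiv G) b') \<le> N (g - b')"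
    using iev_lipschitz[OF b'1, of "g - b'"] gb t e1 by simp
  hence "N (iev (pderiv G) g - iev (pderiv G) b') < N (iev (pderiv G) b')"
    using gb t G by simp
  hence "N (iev (pderiv G) g) = N (iev (pderiv G) b')" by (rule N_eq_of_close)
  hence "N (iev (pderiv G) g) \<noteq> 0" using G d by linarith
  moreover have "generates g" unfolding generates_def using gen h(2) gb t by (meson order.strict_trans2)
  ultimately show ?thesis using gc g1 g by blast
qed

text \<open>
  A polynomial whose value at \<open>g\<close> is small, and whose derivative there is not, has a root
  near \<open>g\<close> that is again a generator.
\<close>
lemma generating_root_stable:
  assumes g: "N g \<le> 1" "N (iev G g) = 0" "N (iev (pderiv G) g) \<noteq> 0" "generates g"
    and e: "e > 0" and d: "d > 0"
  shows "\<exists>t>0. \<forall>f. N (iev f g) < t \<longrightarrow> d \<le> N (iev (pderiv f) g) \<longrightarrow>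
           (\<exists>x. N (iev f x) = 0 \<and> N (x - g) < e \<and> generates x)"
proof -
  obtain h where h: "h > 0" "\<And>c E. N (c - g) < h \<Longrightarrow> closed_subfield E \<Longrightarrow> c \<in> E \<Longrightarrow> g \<in> E"
    using krasner[OF approx_rootI[OF g(1-3)]] by blast
  define t where "t = min (min h e) d"
  have t: "t > 0" "t \<le> h" "t \<le> e" "t \<le> d" using h e d by (auto simp: t_def)
  show ?thesis
  proof (intro exI[of _ "d * t"] conjI allI impI)
    show "0 < d * t" using d t by simp
    fix G assume G: "N (iev G g) < d * t" "d \<le> N (iev (pderiv G) g)"
    have "d * t \<le> d ^ 2" using t d by (simp add: power2_eq_square)
    also have "\<dots> \<le> N (iev (pderiv G) g) ^ 2" using G d by (intro power_mono) auto
    finally obtain x where x: "N (iev G x) = 0" "N (x - g) * N (iev (pderiv G) g) \<le> N (iev G g)"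
      using newton[OF closed_subfield_UNIV _ g(1), of G] G by auto
    have "N (x - g) * d \<le> N (x - g) * N (iev (pderiv G) g)" using G by (intro mult_left_mono) auto
    hence "N (x - g) * d < t * d" using x G by (simp add: mult.commute)
    hence xg: "N (x - g) < t" using d(1) by simp
    have "generates x" unfolding generates_def using g(4)[unfolded generates_def] h(2) xg t
      by (meson order.strict_trans2)
    thus "\<exists>x. N (iev G x) = 0 \<and> N (x - g) < e \<and> generates x" using x xg t by (meson order.strict_trans2)
  qed
qed

text \<open>
  The quotients of values at \<open>g\<close> of integer polynomials are dense: the set of limits of such
  quotients is a closed subfield containing \<open>g\<close>. Denominators are cleared to avoid inverses.
\<close>
lemma generates_dense:
  assumes "generates g" "e > 0"
  shows "\<exists>P Q. N (iev Q g) \<noteq> 0 \<and> N (x * iev Q g - iev P g) < e * N (iev Q g)"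
proof -
  define near where "near x e P Q \<longleftrightarrow> N (iev Q g) \<noteq> 0 \<and> N (x * iev Q g - iev P g) < e * N (iev Q g)" for x e P Q
  define E where "E = {x. \<forall>e>0. \<exists>P Q. near x e P Q}"
  have "closed_subfield E"
    unfolding closed_subfield_def
  proof (intro conjI ballI allI impI)
    show "1 \<in> E" unfolding E_def near_def by (auto intro!: exI[of _ 1])
  next
    fix x y assume xy: "x \<in> E" "y \<in> E"
    show "x - y \<in> E" unfolding E_def
    proof (intro CollectI allI impI)
      fix e :: real assume e: "e > 0"
      obtain P Q P' Q' where n: "near x e P Q" "near y e P' Q'" using xy e unfolding E_def by blast
      define a b a' b' where "a = iev P g" and "b = iev Q g" and "a' = iev P' g" and "b' = iev Q' g"
      note n' = n[unfolded near_def, folded a_def b_def a'_def b'_def]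
      have "N b > 0" "N b' > 0" using n' by (auto simp: less_le)
      have "N ((x * b - a) * b') < e * (N b * N b')"
        using n' \<open>N b' > 0\<close> by (simp add: N_mult mult.assoc[symmetric])
      moreover have "N ((y * b' - a') * b) < e * (N b * N b')"
        using mult_strict_right_mono[of "N (y * b' - a')" "e * N b'" "N b"] n' \<open>N b > 0\<close>
        by (simp add: N_mult mult_ac)
      moreover have "(x - y) * (b * b') - (a * b' - a' * b) = (x * b - a) * b' - (y * b' - a') * b"
        by (simp add: algebra_simps)
      ultimately have "N ((x - y) * (b * b') - (a * b' - a' * b)) < e * (N b * N b')"
        by (simp add: N_diff_less)
      thus "\<exists>P Q. near (x - y) e P Q" using n'
        by (intro exI[of _ "P * Q' - P' * Q"] exI[of _ "Q * Q'"])
           (simp add: near_def N_mult a_def b_def a'_def b'_def)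
    qed
    show "x * y \<in> E" unfolding E_def
    proof (intro CollectI allI impI)
      fix e :: real assume e: "e > 0"
      \<comment> \<open>The bound \<open>1\<close> keeps the approximation of \<open>x\<close> within \<open>max |x| 1\<close>; the other one absorbs the factors
        \<open>|y|\<close> and \<open>max |x| 1\<close> in the error of the product.\<close>
      define d where "d = min 1 (e / 2 / (1 + N x + N y))"
      have pos: "1 + N x + N y > 0" using N_nonneg[of x] N_nonneg[of y] by linarith
      have d: "d > 0" "d \<le> 1" using pos e by (auto simp: d_def)
      have "d \<le> e / 2 / (1 + N x + N y)" by (simp add: d_def)
      hence d3: "d * (1 + N x + N y) \<le> e / 2" using pos by (simp only: pos_le_divide_eq)
      have dx: "d * max (N x) 1 \<le> e / 2" "d * N y \<le> e / 2"
      proof -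
        have "d * max (N x) 1 \<le> d * (1 + N x + N y)" using d(1) by (intro mult_left_mono) auto
        thus "d * max (N x) 1 \<le> e / 2" using d3 by linarith
        have "d * N y \<le> d * (1 + N x + N y)" using d(1) by (intro mult_left_mono) auto
        thus "d * N y \<le> e / 2" using d3 by linarith
      qed
      obtain P Q P' Q' where n: "near x d P Q" "near y d P' Q'" using xy d(1) unfolding E_def by blast
      define a b a' b' where "a = iev P g" and "b = iev Q g" and "a' = iev P' g" and "b' = iev Q' g"
      note n' = n[unfolded near_def, folded a_def b_def a'_def b'_def]
      have bpos: "N b > 0" "N b' > 0" using n' by (auto simp: less_le)
      have Na: "N a \<le> max (N x) 1 * N b"
      proof -
        have "N (x * b) \<le> max (N x) 1 * N b" by (simp add: N_mult mult_right_mono)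
        moreover have "N (x * b - a) \<le> max (N x) 1 * N b"
          using n' d bpos by (smt (verit) max.cobounded2 mult_right_mono mult_le_cancel_right2 mult_cancel_right1)
        ultimately show ?thesis using N_diff_le[of "x * b" _ "x * b - a"] by simp
      qed
      have "N ((x * b - a) * y * b') \<le> (d * N y) * (N b * N b')"
      proof -
        have "N (x * b - a) * (N y * N b') \<le> (d * N b) * (N y * N b')" using n' by (intro mult_right_mono) auto
        thus ?thesis by (simp add: N_mult mult_ac)
      qed
      also have "\<dots> \<le> e / 2 * (N b * N b')" using dx by (intro mult_right_mono) auto
      finally have 1: "N ((x * b - a) * y * b') \<le> e / 2 * (N b * N b')" .
      have 2: "N (a * (y * b' - a')) \<le> e / 2 * (N b * N b')"
      proof -
        have "N a * N (y * b' - a') \<le> (max (N x) 1 * N b) * (d * N b')"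
          using Na n' by (intro mult_mono) auto
        also have "\<dots> = (d * max (N x) 1) * (N b * N b')" by (simp add: mult_ac)
        also have "\<dots> \<le> e / 2 * (N b * N b')" using dx by (intro mult_right_mono) auto
        finally show ?thesis by (simp add: N_mult)
      qed
      have "(x * y) * (b * b') - a * a' = (x * b - a) * y * b' + a * (y * b' - a')"
        by (simp add: algebra_simps)
      hence *: "N ((x * y) * (b * b') - a * a') \<le> e / 2 * (N b * N b')"
        using N_add_le[OF 1 2] by simp
      note *
      also have "\<dots> < e * (N b * N b')" using e bpos by (intro mult_strict_right_mono) auto
      finally show "\<exists>P Q. near (x * y) e P Q" using n'
        by (intro exI[of _ "P * P'"] exI[of _ "Q * Q'"])
           (simp add: near_def N_mult a_def b_def a'_def b'_def)
    qed
  next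
    fix x assume x: "x \<in> E" "N x \<noteq> 0"
    obtain y where y: "N (x * y - 1) = 0" using N_inverse[OF x(2)] by blast
    have Nxy: "N x * N y = 1" using N_cong[OF y] by (simp add: N_mult)
    have pos: "N x > 0" "N y > 0" using Nxy x(2) by (auto simp: less_le)
    have "y \<in> E" unfolding E_def
    proof (intro CollectI allI impI)
      fix e :: real assume e: "e > 0"
      \<comment> \<open>With an error less than \<open>|x|\<close>, the approximation of \<open>x\<close> has the same absolute value as \<open>x\<close>.\<close>
      define d where "d = min (N x) (e * N x * N x)"
      have d: "d > 0" "d \<le> N x" "d \<le> e * N x * N x" using pos e by (auto simp: d_def)
      obtain P Q where n: "near x d P Q" using x d(1) unfolding E_def by blast
      define a b where "a = iev P g" and "b = iev Q g"
      note n' = n[unfolded near_def, folded a_def b_def]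
      have bpos: "N b > 0" using n' by (auto simp: less_le)
      have "d * N b \<le> N x * N b" using d by (intro mult_right_mono) auto
      hence "N (a - x * b) < N (x * b)" using n' N_diff_commute[of a "x * b"] by (simp add: N_mult)
      hence Na: "N a = N x * N b" using N_eq_of_close N_mult by metis
      have "y * a - b = (x * y - 1) * b - y * (x * b - a)" by (simp add: algebra_simps)
      moreover have "N ((x * y - 1) * b) = 0" using y by (simp add: N_mult)
      ultimately have "N (y * a - b) \<le> N (y * (x * b - a))"
        by (metis N_diff max.absorb2 N_nonneg)
      also have "\<dots> < N y * (d * N b)" using n' pos by (simp add: N_mult)
      also have "\<dots> \<le> N y * ((e * N x * N x) * N b)" using d pos bpos by (intro mult_left_mono mult_right_mono) auto
      also have "\<dots> = e * N a" using Nxy Na by (simp add: mult_ac) 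
      finally have "N (y * a - b) < e * N a" .
      thus "\<exists>P Q. near y e P Q" using Na pos bpos unfolding near_def a_def b_def
        by (intro exI[of _ Q] exI[of _ P]) auto
    qed
    thus "\<exists>y\<in>E. N (x * y - 1) = 0" using y by blast
  next
    fix x assume x: "\<forall>e>0. \<exists>y\<in>E. N (x - y) < e"
    show "x \<in> E" unfolding E_def
    proof (intro CollectI allI impI)
      fix e :: real assume e: "e > 0"
      then obtain y where y: "y \<in> E" "N (x - y) < e" using x by blast
      then obtain P Q where n: "near y e P Q" using e unfolding E_def by blast
      have "x * iev Q g - iev P g = (x - y) * iev Q g + (y * iev Q g - iev P g)" by (simp add: algebra_simps)
      moreover have "N ((x - y) * iev Q g) < e * N (iev Q g)"
        using y(2) n by (simp add: N_mult near_def less_le)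
      ultimately have "N (x * iev Q g - iev P g) < e * N (iev Q g)" using n N_add_less unfolding near_def by metis
      thus "\<exists>P Q. near x e P Q" using n unfolding near_def by blast
    qed
  qed
  moreover have "near g e [:0, 1:] 1" if "e > 0" for e
    unfolding near_def using that by simp
  hence "g \<in> E" unfolding E_def by blast
  ultimately have "E = UNIV" using assms(1) unfolding generates_def by auto
  thus ?thesis using assms(2) unfolding E_def near_def by blast
qed

text \<open>
  The set \<open>F\<close> stands for \<open>Qp p\<close>. Take a relation of least degree for \<open>a\<close> and scale it into
  the unit ball. By minimality its derivative does not vanish at \<open>a\<close>, and replacing its
  coefficients by nearby rationals changes the values of the relation and of its derivative
  at \<open>a\<close> only slightly.
\<close>
lemma approx_root_of_algebraic:
  assumes a: "N a \<le> 1"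
    and p: "N (of_int p) < 1" "N (of_int p) \<noteq> 0"
    and char: "\<And>m. m \<noteq> 0 \<Longrightarrow> N (of_int m) \<noteq> 0"
    and F: "\<And>c m. c \<in> F \<Longrightarrow> of_int m * c \<in> F"
    and dense: "\<And>c e. c \<in> F \<Longrightarrow> N c \<le> 1 \<Longrightarrow> e > 0 \<Longrightarrow> \<exists>r m. N (of_int m) = 1 \<and> N (c * of_int m - of_int r) < e"
    and alg: "\<exists>n c. (\<forall>i\<le>n. c i \<in> F) \<and> N (c n) \<noteq> 0 \<and> N (\<Sum>i\<le>n. c i * a ^ i) = 0"
  shows "approx_root a"
proof -
  define rel where "rel n c \<longleftrightarrow> (\<forall>i\<le>n. c i \<in> F) \<and> N (c n) \<noteq> 0 \<and> N (\<Sum>i\<le>n. c i * a ^ i) = 0" for n c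
  define n where "n = (LEAST n. \<exists>c. rel n c)"
  have "\<exists>n. \<exists>c. rel n c" using alg unfolding rel_def by blast
  hence "\<exists>c. rel n c" unfolding n_def by (rule LeastI_ex)
  then obtain c where c: "rel n c" by blast
  have least: "n \<le> m" if "rel m c'" for m c' unfolding n_def using that by (auto intro: Least_le)
  have n0: "n \<noteq> 0"
  proof
    assume "n = 0"
    with c show False unfolding rel_def by simp
  qed
  define B where "B = Max ((\<lambda>i. N (c i)) ` {..n})"
  have B: "N (c i) \<le> B" if "i \<le> n" for i unfolding B_def using that by (intro Max_ge) auto
  have Bpos: "B > 0" using B[of n] c N_nonneg[of "c n"] unfolding rel_def by linarith
  obtain k where k: "N (of_int p ^ k :: 'r) < 1 / B" using power_small[OF p(1), of "1 / B"] Bpos by auto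
  define q :: int where "q = p ^ k"
  have q: "N (of_int q) \<noteq> 0" "N (of_int q) * B < 1"
    using k Bpos p(2) by (simp_all add: q_def N_power field_simps)
  define b where "b i = of_int q * c i" for i
  have b1: "N (b i) \<le> 1" if "i \<le> n" for i
  proof -
    have "N (of_int q) * N (c i) \<le> N (of_int q) * B" using B[OF that] by (intro mult_left_mono) auto
    thus ?thesis using q by (simp add: b_def N_mult)
  qed
  have bF: "b i \<in> F" if "i \<le> n" for i using c F that unfolding b_def rel_def by blast
  have bn: "N (b n) \<noteq> 0" using c q unfolding b_def rel_def by (simp add: N_mult)
  have "(\<Sum>i\<le>n. b i * a ^ i) = of_int q * (\<Sum>i\<le>n. c i * a ^ i)"
    by (simp add: b_def sum_distrib_left mult_ac)
  hence b0: "N (\<Sum>i\<le>n. b i * a ^ i) = 0" using c unfolding rel_def by (simp add: N_mult)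
  define s where "s = (\<Sum>i\<le>n. of_nat i * b i * a ^ (i - 1))"
  obtain m where m: "n = Suc m" using n0 by (cases n) auto
  have "s = (\<Sum>i\<le>m. (of_nat (Suc i) * b (Suc i)) * a ^ i)"
    unfolding s_def m by (subst sum.atMost_Suc_shift) simp
  moreover have "\<not> rel m (\<lambda>i. of_nat (Suc i) * b (Suc i))" using least[of m] m by fastforce
  moreover have "of_nat (Suc i) * b (Suc i) \<in> F" if "i \<le> m" for i
    using F[of "b (Suc i)" "int (Suc i)"] bF[of "Suc i"] that m by simp
  moreover have "N (of_nat (Suc m) * b (Suc m)) \<noteq> 0"
    using char[of "int (Suc m)"] bn m by (simp add: N_mult)
  ultimately have s0: "N s \<noteq> 0" unfolding rel_def by auto
  hence spos: "N s > 0" by (simp add: less_le)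
  have pow: "N (a ^ i) \<le> 1" for i using a by (simp add: N_power power_le_one)
  have "\<exists>G. N (iev G a) < e \<and> N s \<le> N (iev (pderiv G) a)" if e: "e > 0" for e
  proof -
    define h where "h = min (e / 2) (N s / 2)"
    have h: "h > 0" "h < e" "h < N s" using e spos by (auto simp: h_def)
    have "\<forall>i. \<exists>r m. i \<le> n \<longrightarrow> N (of_int m) = 1 \<and> N (b i * of_int m - of_int r) < h"
      using dense[OF bF b1 h(1)] by blast
    then obtain r m' where rm: "\<And>i. i \<le> n \<Longrightarrow> N (of_int (m' i)) = 1 \<and> N (b i * of_int (m' i) - of_int (r i)) < h"
      by metis
    \<comment> \<open>A common denominator of the approximating rationals; it is a unit of the valuation ring.\<close>
    define M where "M = (\<Prod>i\<le>n. m' i)"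
    define R where "R i = r i * (\<Prod>j\<in>{..n} - {i}. m' j)" for i
    have N_prod: "N (\<Prod>j\<in>J. of_int (m' j)) = 1" if "J \<subseteq> {..n}" for J
    proof -
      have "finite J" using that finite_subset by blast
      thus ?thesis using that by (induction J rule: finite_induct) (auto simp: N_mult rm)
    qed
    have Mi: "M = m' i * (\<Prod>j\<in>{..n} - {i}. m' j)" if "i \<le> n" for i
      unfolding M_def using that by (simp add: prod.remove)
    have NM: "N (of_int M) = 1" using N_prod[of "{..n}"] by (simp add: M_def)
    have close: "N (b i * of_int M - of_int (R i)) \<le> h" if "i \<le> n" for i
    proof -
      have "b i * of_int M - of_int (R i) = (b i * of_int (m' i) - of_int (r i)) * (\<Prod>j\<in>{..n} - {i}. of_int (m' j))"
        unfolding Mi[OF that] R_def by (simp add: algebra_simps)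
      thus ?thesis using rm[OF that] N_prod[of "{..n} - {i}"] by (simp add: N_mult)
    qed
    define G where "G = (\<Sum>i\<le>n. Polynomial.monom (R i) i)"
    have Ga: "iev G a = (\<Sum>i\<le>n. of_int (R i) * a ^ i)" by (simp add: G_def iev_sum)
    have G'a: "iev (pderiv G) a = (\<Sum>i\<le>n. of_nat i * of_int (R i) * a ^ (i - 1))"
      by (simp add: G_def iev_sum higher_pderiv_sum[where n = "Suc 0", simplified] pderiv_monom)
    have "of_int M * (\<Sum>i\<le>n. b i * a ^ i) - iev G a = (\<Sum>i\<le>n. (b i * of_int M - of_int (R i)) * a ^ i)"
      unfolding Ga by (simp add: sum_distrib_left sum_subtractf algebra_simps)
    also have "N \<dots> \<le> h"
    proof (rule N_sum_le)
      fix i assume "i \<in> {..n}"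
      thus "N ((b i * of_int M - of_int (R i)) * a ^ i) \<le> h"
        using close[of i] N_mult_le_1[OF pow, of i "b i * of_int M - of_int (R i)"] by (simp add: mult.commute)
    qed (use h in simp)
    finally have "N (iev G a) \<le> h"
      using N_diff_le[of "of_int M * (\<Sum>i\<le>n. b i * a ^ i)" h "of_int M * (\<Sum>i\<le>n. b i * a ^ i) - iev G a"] b0 h(1)
      by (simp add: N_mult)
    moreover have "N (iev (pderiv G) a) = N s"
    proof -
      have "iev (pderiv G) a - of_int M * s = (\<Sum>i\<le>n. - (of_nat i * a ^ (i - 1) * (b i * of_int M - of_int (R i))))"
        unfolding G'a s_def by (simp add: sum_distrib_left sum_subtractf algebra_simps)
      also have "N \<dots> \<le> h"
      proof (rule N_sum_le)
        fix i assume i: "i \<in> {..n}"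
        have "N (of_nat i * a ^ (i - 1)) \<le> 1" using N_of_nat[of i] pow[of "i - 1"] N_mult_le_1 order_trans by blast
        thus "N (- (of_nat i * a ^ (i - 1) * (b i * of_int M - of_int (R i)))) \<le> h"
          using close i N_mult_le_1 by (metis N_uminus atMost_iff order_trans)
      qed (use h in simp)
      finally have "N (iev (pderiv G) a - of_int M * s) < N (of_int M * s)"
        using h NM by (simp add: N_mult)
      from N_eq_of_close[OF this] show ?thesis using NM by (simp add: N_mult)
    qed
    ultimately show ?thesis using h by (intro exI[of _ G]) auto
  qed
  thus ?thesis unfolding approx_root_def using a spos by blast
qed

end

section \<open>Integer polynomials: common roots and Eisenstein perturbation\<close>

text \<open>
  A prime ideal of the ring of integer polynomials that contains no nonzero constant, given
  as a predicate. Examples are the polynomials vanishing at a point of a field of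
  characteristic \<open>0\<close>; treating these ideals abstractly covers points of \<open>L i\<close> and complex
  numbers at once.
\<close>
definition prime_relations :: "(int poly \<Rightarrow> bool) \<Rightarrow> bool" where
  "prime_relations Z \<longleftrightarrow> (\<forall>P Q. Z P \<longrightarrow> Z Q \<longrightarrow> Z (P - Q)) \<and> (\<forall>P Q. Z (P * Q) \<longleftrightarrow> Z P \<or> Z Q) \<and>
     (\<forall>c. Z [:c:] \<longleftrightarrow> c = 0)"

lemma prime_relationsD:
  assumes "prime_relations Z"
  shows "Z P \<Longrightarrow> Z Q \<Longrightarrow> Z (P - Q)" "Z (P * Q) \<longleftrightarrow> Z P \<or> Z Q" "Z [:c:] \<longleftrightarrow> c = 0"
    "Z (Polynomial.smult c P) \<longleftrightarrow> c = 0 \<or> Z P" "Z 0" "\<not> Z 1"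
proof -
  show "Z P \<Longrightarrow> Z Q \<Longrightarrow> Z (P - Q)" and *: "Z (P * Q) \<longleftrightarrow> Z P \<or> Z Q" "Z [:c:] \<longleftrightarrow> c = 0"
    for P Q c using assms unfolding prime_relations_def by blast+
  show "Z (Polynomial.smult c P) \<longleftrightarrow> c = 0 \<or> Z P" using *(1)[of "[:c:]" P] *(2)[of c] by simp
  show "Z 0" using *(2)[of 0] by simp
  show "\<not> Z 1" using *(2)[of 1] by (simp add: one_pCons)
qed

lemma (in nonarch_ring) prime_relations_at:
  assumes "\<And>m. m \<noteq> 0 \<Longrightarrow> N (of_int m) \<noteq> 0"
  shows "prime_relations (\<lambda>P. N (iev P x) = 0)"
  unfolding prime_relations_def
proof (intro conjI allI impI)
  fix P Q assume "N (iev P x) = 0" "N (iev Q x) = 0"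
  thus "N (iev (P - Q) x) = 0" using N_diff_le[of "iev P x" 0 "iev Q x"] by (simp add: order_antisym)
qed (use assms in \<open>auto simp: N_mult\<close>)

lemma prime_relations_complex: "prime_relations (\<lambda>P. iev P (z :: complex) = 0)"
  unfolding prime_relations_def by auto

lemma int_poly_division:
  fixes f g :: "int poly"
  assumes "g \<noteq> 0"
  shows "\<exists>c q r. c \<noteq> 0 \<and> Polynomial.smult c f = g * q + r \<and> (r = 0 \<or> Polynomial.degree r < Polynomial.degree g)"
proof -
  obtain q r where qr: "pseudo_divmod f g = (q, r)" by (cases "pseudo_divmod f g")
  show ?thesis using pseudo_divmod[OF assms qr] assms
    by (intro exI[of _ "Polynomial.coeff g (Polynomial.degree g) ^ (Suc (Polynomial.degree f) - Polynomial.degree g)"] exI[of _ q] exI[of _ r])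
      auto
qed

text \<open>
  A nonzero element \<open>H\<close> of least degree divides all others up to integer factors. It is
  separable, because its derivative has smaller degree.
\<close>
lemma minimal_relation:
  assumes Z: "prime_relations Z" and P0: "Z P0" "P0 \<noteq> 0"
  shows "\<exists>H. H \<noteq> 0 \<and> Z H \<and> \<not> Z (pderiv H) \<and> (\<forall>P. Z P \<longrightarrow> (\<exists>c q. c \<noteq> 0 \<and> Polynomial.smult c P = H * q))"
proof -
  note ZD = prime_relationsD[OF Z]
  obtain H where H: "Z H" "H \<noteq> 0" and least: "\<And>P. Z P \<Longrightarrow> P \<noteq> 0 \<Longrightarrow> Polynomial.degree H \<le> Polynomial.degree P"
    using ex_has_least_nat[of "\<lambda>P. Z P \<and> P \<noteq> 0" P0 Polynomial.degree] P0 by auto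
  have "Polynomial.degree H \<noteq> 0"
  proof
    assume "Polynomial.degree H = 0"
    then obtain c where "H = [:c:]" by (auto elim: degree_eq_zeroE)
    thus False using H ZD(3) by auto
  qed
  hence "pderiv H \<noteq> 0" "Polynomial.degree (pderiv H) < Polynomial.degree H"
    by (auto simp: pderiv_eq_0_iff degree_pderiv)
  hence "\<not> Z (pderiv H)" using least by fastforce
  moreover have "\<exists>c q. c \<noteq> 0 \<and> Polynomial.smult c P = H * q" if "Z P" for P
  proof -
    obtain c q r where c: "c \<noteq> 0" and eq: "Polynomial.smult c P = H * q + r"
      and r: "r = 0 \<or> Polynomial.degree r < Polynomial.degree H"
      using int_poly_division[OF H(2), of P] by blast
    have "r = Polynomial.smult c P - H * q" using eq by simp
    hence "Z r" using ZD(1,2,4) that H by metis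
    hence "r = 0" using r least by fastforce
    thus ?thesis using c eq by auto
  qed
  ultimately show ?thesis using H by blast
qed

text \<open>
  A nonzero polynomial of least degree that lies in all the ideals is squarefree, so that it
  has simple roots: if both \<open>G\<close> and \<open>G'\<close> lay in \<open>Z i\<close>, the minimal polynomial \<open>H\<close> of \<open>Z i\<close>
  would divide \<open>G\<close> twice, and omitting one factor \<open>H\<close> would leave a common relation of
  smaller degree.
\<close>
lemma common_relation_simple_roots:
  assumes I: "finite I" and Z: "\<And>i. i \<in> I \<Longrightarrow> prime_relations (Z i)"
    and P: "\<And>i. i \<in> I \<Longrightarrow> \<exists>P. P \<noteq> 0 \<and> Z i P"
  shows "\<exists>G. G \<noteq> 0 \<and> (\<forall>i\<in>I. Z i G \<and> \<not> Z i (pderiv G))"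
proof -
  obtain Q where Q: "\<And>i. i \<in> I \<Longrightarrow> Q i \<noteq> 0 \<and> Z i (Q i)" using P by metis
  have "Z i (\<Prod>i\<in>I. Q i)" if "i \<in> I" for i
    using that I Q prime_relationsD(2)[OF Z[OF that]] by (simp add: prod.remove)
  moreover have "(\<Prod>i\<in>I. Q i) \<noteq> 0" using I Q by simp
  ultimately have "\<exists>G. G \<noteq> 0 \<and> (\<forall>i\<in>I. Z i G)" by blast
  then obtain G where G: "G \<noteq> 0" "\<And>i. i \<in> I \<Longrightarrow> Z i G"
    and least: "\<And>P. P \<noteq> 0 \<Longrightarrow> (\<forall>i\<in>I. Z i P) \<Longrightarrow> Polynomial.degree G \<le> Polynomial.degree P"
    using ex_has_least_nat[of "\<lambda>G. G \<noteq> 0 \<and> (\<forall>i\<in>I. Z i G)" _ Polynomial.degree] by metis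
  have "\<not> Z i (pderiv G)" if i: "i \<in> I" for i
  proof
    assume der: "Z i (pderiv G)"
    note ZD = prime_relationsD[OF Z[OF i]]
    obtain H where H: "H \<noteq> 0" "Z i H" "\<not> Z i (pderiv H)"
      and Hdiv: "\<And>P. Z i P \<Longrightarrow> \<exists>c q. c \<noteq> 0 \<and> Polynomial.smult c P = H * q"
      using minimal_relation[OF Z[OF i] G(2)[OF i] G(1)] by blast
    obtain c S where c: "c \<noteq> 0" "Polynomial.smult c G = H * S" using Hdiv[OF G(2)[OF i]] by blast
    have "S \<noteq> 0" using c G by auto
    have Hdeg: "Polynomial.degree H > 0"
    proof (rule ccontr)
      assume "\<not> ?thesis"
      then obtain a where "H = [:a:]" by (auto elim: degree_eq_zeroE)
      thus False using H ZD(3) by auto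
    qed
    have "Polynomial.degree G = Polynomial.degree H + Polynomial.degree S"
      using c G H \<open>S \<noteq> 0\<close> by (metis degree_mult_eq degree_smult_eq)
    hence deg: "Polynomial.degree S < Polynomial.degree G" using Hdeg by simp
    have "Polynomial.smult c (pderiv G) = H * pderiv S + S * pderiv H"
      using arg_cong[OF c(2), of pderiv] by (simp add: pderiv_smult pderiv_mult)
    hence "S * pderiv H = Polynomial.smult c (pderiv G) - H * pderiv S" by simp
    hence "Z i (S * pderiv H)" using ZD(1)[of "Polynomial.smult c (pderiv G)" "H * pderiv S"] ZD(2,4) der H by metis
    hence "Z i S" using ZD(2) H by blast
    then obtain c' T where c': "c' \<noteq> 0" "Polynomial.smult c' S = H * T" using Hdiv by blast
    have "Z j S" if j: "j \<in> I" for j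
    proof -
      note ZDj = prime_relationsD[OF Z[OF j]]
      have "Z j (H * S)" using G(2)[OF j] ZDj(4) c by metis
      moreover have "Z j H \<Longrightarrow> Z j S" using c' ZDj(2,4) by metis
      ultimately show ?thesis using ZDj(2) by blast
    qed
    thus False using least[OF \<open>S \<noteq> 0\<close>] deg by fastforce
  qed
  thus ?thesis using G by blast
qed

lemma eisenstein_factor:
  fixes A B :: "int poly"
  assumes q: "Factorial_Ring.prime (q :: int)" and "A * B = f"
    and lead: "\<not> q dvd Polynomial.coeff f (Polynomial.degree f)"
    and mid: "\<And>i. i < Polynomial.degree f \<Longrightarrow> q dvd Polynomial.coeff f i"
    and const: "\<not> q dvd Polynomial.coeff B 0"
    and deg: "Polynomial.degree A < Polynomial.degree f"
  shows False
proof -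
  have "\<exists>i\<le>Polynomial.degree A. \<not> q dvd Polynomial.coeff A i"
  proof (rule ccontr)
    assume "\<not> ?thesis"
    hence "q dvd Polynomial.coeff A (Polynomial.degree A)" by blast
    hence "q dvd Polynomial.coeff (A * B) (Polynomial.degree (A * B))" by (simp add: lead_coeff_mult)
    thus False using lead assms(2) by simp
  qed
  define i where "i = (LEAST i. \<not> q dvd Polynomial.coeff A i)"
  obtain i0 where i0: "i0 \<le> Polynomial.degree A" "\<not> q dvd Polynomial.coeff A i0"
    using \<open>\<exists>i\<le>_. _\<close> by blast
  have i: "\<not> q dvd Polynomial.coeff A i" unfolding i_def using i0(2) by (rule LeastI)
  have ile: "i \<le> i0" unfolding i_def using i0(2) by (rule Least_le)
  have below: "q dvd Polynomial.coeff A j" if "j < i" for j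
    using that not_less_Least unfolding i_def by blast
  have "Polynomial.coeff f i = (\<Sum>j\<le>i. Polynomial.coeff A j * Polynomial.coeff B (i - j))"
    using assms(2) coeff_mult by metis
  also have "\<dots> = Polynomial.coeff A i * Polynomial.coeff B 0 + (\<Sum>j<i. Polynomial.coeff A j * Polynomial.coeff B (i - j))"
    by (simp add: lessThan_Suc_atMost[symmetric])
  finally have "Polynomial.coeff A i * Polynomial.coeff B 0 =
     Polynomial.coeff f i - (\<Sum>j<i. Polynomial.coeff A j * Polynomial.coeff B (i - j))" by simp
  moreover have "q dvd (\<Sum>j<i. Polynomial.coeff A j * Polynomial.coeff B (i - j))"
    using below by (intro dvd_sum) auto
  moreover have "q dvd Polynomial.coeff f i" using mid[of i] ile i0(1) deg by simp
  ultimately have "q dvd Polynomial.coeff A i * Polynomial.coeff B 0" by simp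
  thus False using q i const by (simp add: prime_dvd_mult_iff)
qed

text \<open>Eisenstein's criterion holds at the prime \<open>q\<close>.\<close>
definition eisenstein_at :: "int \<Rightarrow> int poly \<Rightarrow> bool" where
  "eisenstein_at q f \<longleftrightarrow> Factorial_Ring.prime q \<and> Polynomial.degree f > 0 \<and>
     \<not> q dvd Polynomial.coeff f (Polynomial.degree f) \<and>
     (\<forall>i<Polynomial.degree f. q dvd Polynomial.coeff f i) \<and> \<not> q\<^sup>2 dvd Polynomial.coeff f 0"

text \<open>
  Irreducibility over the rationals; the content of an Eisenstein polynomial need not be
  \<open>1\<close>.
\<close>
lemma eisenstein_no_factor:
  assumes f: "eisenstein_at q f" and AB: "A * B = f"
  shows "Polynomial.degree A = 0 \<or> Polynomial.degree B = 0"
proof (rule ccontr)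
  assume n: "\<not> ?thesis"
  note f' = f[unfolded eisenstein_at_def]
  have "f \<noteq> 0" using f' by auto
  hence "Polynomial.degree f = Polynomial.degree A + Polynomial.degree B" using AB degree_mult_eq by fastforce
  hence deg: "Polynomial.degree A < Polynomial.degree f" "Polynomial.degree B < Polynomial.degree f" using n by auto
  have const: "Polynomial.coeff f 0 = Polynomial.coeff A 0 * Polynomial.coeff B 0" using AB by (auto simp: coeff_mult)
  have "\<not> (q dvd Polynomial.coeff A 0 \<and> q dvd Polynomial.coeff B 0)"
    using f' const mult_dvd_mono[of q _ q] by (auto simp: power2_eq_square)
  thus False
    using eisenstein_factor[of q A B f] eisenstein_factor[of q B A f] f' AB deg by (auto simp: mult.commute)
qed

text \<open>
  An Eisenstein polynomial that lies in a prime ideal of relations is, up to a rational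
  factor, its minimal polynomial.
\<close>
lemma eisenstein_generates_relations:
  assumes Z: "prime_relations Z" and f: "eisenstein_at q f" "Z f" and P: "Z P"
  shows "\<exists>c h. c \<noteq> 0 \<and> Polynomial.smult c P = f * h"
proof -
  note ZD = prime_relationsD[OF Z]
  note f' = f(1)[unfolded eisenstein_at_def]
  have f0: "f \<noteq> 0" using f' by auto
  obtain H where H: "H \<noteq> 0" "Z H" and Hdiv: "\<And>P. Z P \<Longrightarrow> \<exists>c q. c \<noteq> 0 \<and> Polynomial.smult c P = H * q"
    using minimal_relation[OF Z f(2) f0] by blast
  obtain c S where c: "c \<noteq> 0" "Polynomial.smult c f = H * S" using Hdiv[OF f(2)] by blast
  have S0: "S \<noteq> 0" using c f0 by auto
  have Hdeg: "Polynomial.degree H > 0"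
  proof (rule ccontr)
    assume "\<not> ?thesis"
    then obtain a where "H = [:a:]" by (auto elim: degree_eq_zeroE)
    thus False using H ZD(3) by auto
  qed
  have "primitive_part (Polynomial.smult c f) = primitive_part H * primitive_part S"
    using c(2) by (simp add: primitive_part_mult)
  hence pp: "Polynomial.smult (unit_factor c) (primitive_part f) = primitive_part H * primitive_part S"
    by (simp add: primitive_part_smult)
  have "f = Polynomial.smult (content f * unit_factor c * unit_factor c) (primitive_part f)"
    using c(1) by (simp add: mult.assoc)
  also have "\<dots> = Polynomial.smult (content f * unit_factor c) (primitive_part H * primitive_part S)"
    unfolding pp[symmetric] by simp
  finally have fac: "Polynomial.smult (content f * unit_factor c) (primitive_part H) * primitive_part S = f" by simp
  have "content f * unit_factor c \<noteq> 0" using f0 c by (simp add: sgn_if)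
  hence "Polynomial.degree (Polynomial.smult (content f * unit_factor c) (primitive_part H)) > 0"
    using Hdeg by simp
  hence "Polynomial.degree (primitive_part S) = 0" using eisenstein_no_factor[OF f(1) fac] by simp
  hence "Polynomial.degree S = 0" by simp
  then obtain s where s: "S = [:s:]" by (auto elim: degree_eq_zeroE)
  have s0: "s \<noteq> 0" using s S0 by auto
  obtain e h where e: "e \<noteq> 0" "Polynomial.smult e P = H * h" using Hdiv[OF P] by blast
  have "Polynomial.smult (e * s) P = f * Polynomial.smult c h"
  proof -
    have "Polynomial.smult (e * s) P = Polynomial.smult s (H * h)" using e(2) by (metis mult.commute smult_smult)
    also have "\<dots> = (H * S) * h" using s by simp
    also have "\<dots> = Polynomial.smult c f * h" using c by simp
    finally show ?thesis by simp
  qed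
  thus ?thesis using e s0 by (intro exI[of _ "e * s"] exI[of _ "Polynomial.smult c h"]) auto
qed

text \<open>
  If \<open>q\<close> is a prime not dividing \<open>m\<close>, this is an Eisenstein polynomial at \<open>q\<close>, for every
  \<open>G\<close>. For \<open>m\<close> close to \<open>0\<close> in a local field, it is close to \<open>q\<^sup>2 G\<close>, which has the same
  roots as \<open>G\<close>.
\<close>
definition eisenstein_perturbation :: "int \<Rightarrow> int \<Rightarrow> int poly \<Rightarrow> int poly" where
  "eisenstein_perturbation q m G =
     Polynomial.smult (q\<^sup>2) G + Polynomial.smult m (Polynomial.monom 1 (Suc (Polynomial.degree G)) + [:q:])"

lemma eisenstein_perturbation:
  assumes "Factorial_Ring.prime q" "\<not> q dvd m"
  shows "eisenstein_at q (eisenstein_perturbation q m G)"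
proof -
  define f where "f = eisenstein_perturbation q m G"
  define d where "d = Suc (Polynomial.degree G)"
  have co: "Polynomial.coeff f i = q\<^sup>2 * Polynomial.coeff G i + m * ((if i = d then 1 else 0) + (if i = 0 then q else 0))" for i
    unfolding f_def eisenstein_perturbation_def d_def by (cases i) (auto simp: coeff_monom)
  have G0: "Polynomial.coeff G i = 0" if "i \<ge> d" for i using that unfolding d_def by (simp add: coeff_eq_0)
  have m0: "m \<noteq> 0" using assms by auto
  have "d > 0" by (simp add: d_def)
  hence lc: "Polynomial.coeff f d = m" using co[of d] G0[of d] by simp
  have "Polynomial.degree f \<le> d"
    using co G0 by (intro degree_le) (auto simp: d_def)
  hence deg: "Polynomial.degree f = d" using lc m0 le_degree[of f d] by simp
  have "\<not> q\<^sup>2 dvd Polynomial.coeff f 0"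
  proof
    assume "q\<^sup>2 dvd Polynomial.coeff f 0"
    hence "q\<^sup>2 dvd q\<^sup>2 * Polynomial.coeff G 0 + m * q" using co[of 0] \<open>d > 0\<close> by simp
    hence "q\<^sup>2 dvd m * q" by (simp add: dvd_add_right_iff)
    hence "q dvd m" using assms(1) by (auto simp: power2_eq_square)
    thus False using assms by simp
  qed
  thus ?thesis unfolding f_def[symmetric] eisenstein_at_def using assms deg lc co \<open>d > 0\<close>
    by (auto simp: power2_eq_square)
qed

lemma iev_complex_root:
  assumes "Polynomial.degree f > 0"
  shows "\<exists>z :: complex. iev f z = 0"
proof -
  have "\<not> Fundamental_Theorem_Algebra.constant (poly (map_poly complex_of_int f))"
    using assms by (simp add: constant_degree degree_map_poly)
  thus ?thesis using fundamental_theorem_of_algebra unfolding iev_def by blast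
qed

section \<open>Minimal submultiplicative seminorms are multiplicative\<close>

text \<open>Submultiplicative ultrametric seminorms \<open>s\<close> on a ring, with \<open>s 1 \<ge> 1\<close>.\<close>
definition submult_seminorm :: "('r::comm_ring_1 \<Rightarrow> real) \<Rightarrow> bool" where
  "submult_seminorm s \<longleftrightarrow> (\<forall>x. 0 \<le> s x) \<and> s 0 = 0 \<and> (\<forall>x y. s (x + y) \<le> max (s x) (s y)) \<and>
     (\<forall>x y. s (x * y) \<le> s x * s y) \<and> 1 \<le> s 1"

lemma submult_seminormD:
  assumes "submult_seminorm s"
  shows "0 \<le> s x" "s 0 = 0" "s (x + y) \<le> max (s x) (s y)" "s (x * y) \<le> s x * s y" "1 \<le> s 1"
  using assms unfolding submult_seminorm_def by blast+

lemma submult_seminorm_sum_le: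
  assumes "submult_seminorm s" "0 \<le> e" "\<And>i. i \<in> A \<Longrightarrow> s (f i) \<le> e"
  shows "s (sum f A) \<le> e"
  using assms(3)
proof (induction A rule: infinite_finite_induct)
  case (insert a A)
  then show ?case using submult_seminormD(3)[OF assms(1), of "f a" "sum f A"] by fastforce
qed (use submult_seminormD[OF assms(1)] assms(2) in auto)

lemma submult_seminorm_of_nat_mult:
  assumes "submult_seminorm s" shows "s (of_nat n * x) \<le> s x"
proof (induction n)
  case (Suc n)
  then show ?case using submult_seminormD(3)[OF assms, of x "of_nat n * x"] by (simp add: distrib_right)
qed (use submult_seminormD[OF assms] in auto)

lemma decreasing_limit:
  fixes a :: "nat \<Rightarrow> real"
  assumes "\<And>n. a (Suc n) \<le> a n" "\<And>n. 0 \<le> a n"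
  shows "a \<longlonglongrightarrow> lim a" "lim a \<le> a n" "0 \<le> lim a"
proof -
  have "decseq a" using assms(1) by (simp add: decseq_Suc_iff)
  then obtain L where L: "a \<longlonglongrightarrow> L" "\<And>i. L \<le> a i"
    using decseq_convergent[of a 0] assms(2) by blast
  have "lim a = L" using L(1) by (rule limI)
  thus "a \<longlonglongrightarrow> lim a" "lim a \<le> a n" "0 \<le> lim a"
    using L assms(2) LIMSEQ_le_const[OF L(1), of 0] by auto
qed

text \<open>
  The sequence whose limit is the spectral seminorm of \<open>x\<close>. It only uses the exponents
  \<open>2 ^ k\<close>, for which submultiplicativity directly makes it decreasing.
\<close>
definition spectral :: "('r::comm_ring_1 \<Rightarrow> real) \<Rightarrow> 'r \<Rightarrow> nat \<Rightarrow> real" where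
  "spectral s x k = root (2 ^ k) (s (x ^ (2 ^ k)))"

lemma spectral_limit:
  assumes s: "submult_seminorm s"
  shows "spectral s x \<longlonglongrightarrow> lim (spectral s x)" "lim (spectral s x) \<le> spectral s x k" "0 \<le> lim (spectral s x)"
proof -
  have "spectral s x (Suc n) \<le> spectral s x n" for n
  proof -
    have "s (x ^ 2 ^ Suc n) \<le> s (x ^ 2 ^ n) ^ 2"
      using submult_seminormD(4)[OF s, of "x ^ 2 ^ n" "x ^ 2 ^ n"] by (simp add: power2_eq_square power_add[symmetric] mult_2)
    hence "spectral s x (Suc n) \<le> root (2 ^ n * 2) (s (x ^ 2 ^ n) ^ 2)"
      unfolding spectral_def by (simp add: mult.commute)
    also have "\<dots> = root (2 ^ n) (s (x ^ 2 ^ n))"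
      using submult_seminormD(1)[OF s] by (simp add: real_root_mult_exp real_root_power_cancel)
    finally show ?thesis by (simp add: spectral_def)
  qed
  moreover have "0 \<le> spectral s x n" for n using submult_seminormD(1)[OF s] by (simp add: spectral_def)
  ultimately show "spectral s x \<longlonglongrightarrow> lim (spectral s x)" "lim (spectral s x) \<le> spectral s x k" "0 \<le> lim (spectral s x)"
    by (rule decreasing_limit)+
qed

lemma submult_growth:
  assumes s: "submult_seminorm s" and M: "M > 0" "s (x ^ M) \<le> \<rho> ^ M" and \<rho>: "\<rho> > 0"
  shows "\<exists>C\<ge>0. \<forall>i. s (x ^ i) \<le> C * \<rho> ^ i"
proof -
  define C where "C = Max ((\<lambda>r. s (x ^ r) / \<rho> ^ r) ` {..<M})"
  have C: "s (x ^ r) \<le> C * \<rho> ^ r" if "r < M" for r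
  proof -
    have "s (x ^ r) / \<rho> ^ r \<le> C" unfolding C_def using that by (intro Max_ge) auto
    thus ?thesis using \<rho> by (simp add: pos_divide_le_eq)
  qed
  have C0: "0 \<le> C" using C[of 0] M submult_seminormD(5)[OF s] by simp
  have "s (x ^ (q * M + r)) \<le> C * \<rho> ^ (q * M + r)" if "r < M" for q r
  proof (induction q)
    case (Suc q)
    have "s (x ^ (Suc q * M + r)) \<le> s (x ^ M) * s (x ^ (q * M + r))"
      using submult_seminormD(4)[OF s, of "x ^ M" "x ^ (q * M + r)"] by (simp add: power_add mult_ac)
    also have "\<dots> \<le> \<rho> ^ M * (C * \<rho> ^ (q * M + r))"
      using Suc M submult_seminormD(1)[OF s] \<rho> by (intro mult_mono) auto
    finally show ?case by (simp add: power_add mult_ac)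
  qed (use C that in simp)
  hence "s (x ^ i) \<le> C * \<rho> ^ i" for i
    using M(1) by (metis div_mult_mod_eq mod_less_divisor)
  thus ?thesis using C0 by blast
qed

lemma root_const_pow2:
  assumes "c > 0" shows "(\<lambda>k. root (2 ^ k) c) \<longlonglongrightarrow> 1"
proof -
  have "strict_mono (\<lambda>k. 2 ^ k :: nat)" by (simp add: strict_mono_def)
  from LIMSEQ_subseq_LIMSEQ[OF LIMSEQ_root_const[OF assms] this] show ?thesis by (simp add: o_def)
qed

text \<open>
  The ultrametric inequality comes from the binomial formula: if both limits are less than
  \<open>\<rho>\<close>, then all \<open>x ^ i\<close> and \<open>y ^ i\<close> are bounded by a constant multiple of \<open>\<rho> ^ i\<close>, hence so
  is \<open>(x + y) ^ i\<close>, and the constant disappears when roots are taken.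
\<close>
lemma spectral_seminorm:
  assumes s: "submult_seminorm s"
  shows "submult_seminorm (\<lambda>x. lim (spectral s x))"
  unfolding submult_seminorm_def
proof (intro conjI allI)
  note sD = submult_seminormD[OF s]
  note L = spectral_limit[OF s]
  show "0 \<le> lim (spectral s x)" for x by (rule L(3))
  have "spectral s 0 0 = 0" using sD(2) by (simp add: spectral_def)
  thus "lim (spectral s 0) = 0" using L(2)[of 0 0] L(3)[of 0] by simp
  show "lim (spectral s (x * y)) \<le> lim (spectral s x) * lim (spectral s y)" for x y
  proof (rule LIMSEQ_le[OF L(1) tendsto_mult[OF L(1) L(1)]])
    have "spectral s (x * y) n \<le> spectral s x n * spectral s y n" for n
      unfolding spectral_def by (simp add: power_mult_distrib real_root_mult[symmetric] sD(4))
    thus "\<exists>N. \<forall>n\<ge>N. spectral s (x * y) n \<le> spectral s x n * spectral s y n" by blast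
  qed
  show "1 \<le> lim (spectral s 1)"
  proof (rule LIMSEQ_le_const[OF L(1)])
    show "\<exists>N. \<forall>n\<ge>N. 1 \<le> spectral s 1 n" using sD(5) by (simp add: spectral_def)
  qed
  show "lim (spectral s (x + y)) \<le> max (lim (spectral s x)) (lim (spectral s y))" for x y
  proof (rule dense_ge)
    fix \<rho> assume \<rho>: "max (lim (spectral s x)) (lim (spectral s y)) < \<rho>"
    have \<rho>0: "\<rho> > 0" using \<rho> L(3)[of x] by linarith
    have "\<exists>C\<ge>0. \<forall>i. s (z ^ i) \<le> C * \<rho> ^ i" if z: "lim (spectral s z) < \<rho>" for z
    proof -
      have "\<forall>\<^sub>F k in sequentially. spectral s z k < \<rho>" using order_tendstoD(2)[OF L(1) z] .
      then obtain k where k: "root (2 ^ k) (s (z ^ 2 ^ k)) < \<rho>" unfolding spectral_def eventually_sequentially by blast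
      have "s (z ^ 2 ^ k) = root (2 ^ k) (s (z ^ 2 ^ k)) ^ (2 ^ k)" using sD(1) by simp
      also have "\<dots> \<le> \<rho> ^ (2 ^ k)" using k sD(1) by (intro power_mono) auto
      finally show ?thesis using submult_growth[OF s, of "2 ^ k"] \<rho>0 by simp
    qed
    then obtain C D where C: "C \<ge> 0" "\<And>i. s (x ^ i) \<le> C * \<rho> ^ i" and D: "D \<ge> 0" "\<And>i. s (y ^ i) \<le> D * \<rho> ^ i"
      using \<rho> by (metis max_less_iff_conj)
    define B where "B = C * D + 1"
    have B: "B > 0" using C D by (simp add: B_def add_nonneg_pos)
    have pow: "s ((x + y) ^ n) \<le> B * \<rho> ^ n" for n
    proof -
      have "s (\<Sum>i\<le>n. of_nat (n choose i) * x ^ i * y ^ (n - i)) \<le> B * \<rho> ^ n"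
      proof (rule submult_seminorm_sum_le[OF s])
        fix i assume i: "i \<in> {..n}"
        have "s (of_nat (n choose i) * x ^ i * y ^ (n - i)) \<le> s (x ^ i * y ^ (n - i))"
          using submult_seminorm_of_nat_mult[OF s] by (simp add: mult.assoc)
        also have "\<dots> \<le> s (x ^ i) * s (y ^ (n - i))" by (rule sD(4))
        also have "\<dots> \<le> (C * \<rho> ^ i) * (D * \<rho> ^ (n - i))" using C D sD(1) \<rho>0 by (intro mult_mono) auto
        also have "\<dots> = C * D * \<rho> ^ n" using i by (simp add: power_add[symmetric])
        also have "\<dots> \<le> B * \<rho> ^ n" using \<rho>0 by (simp add: B_def)
        finally show "s (of_nat (n choose i) * x ^ i * y ^ (n - i)) \<le> B * \<rho> ^ n" .
      qed (use B \<rho>0 in simp)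
      thus ?thesis by (simp add: binomial_ring)
    qed
    have "(\<lambda>k. root (2 ^ k) B * \<rho>) \<longlonglongrightarrow> 1 * \<rho>" by (intro tendsto_intros root_const_pow2 B)
    moreover have "spectral s (x + y) k \<le> root (2 ^ k) B * \<rho>" for k
    proof -
      have "spectral s (x + y) k \<le> root (2 ^ k) (B * \<rho> ^ 2 ^ k)" unfolding spectral_def using pow by simp
      also have "\<dots> = root (2 ^ k) B * \<rho>" using \<rho>0 by (simp add: real_root_mult real_root_power_cancel)
      finally show ?thesis .
    qed
    ultimately show "lim (spectral s (x + y)) \<le> \<rho>" using LIMSEQ_le[OF L(1)] by fastforce
  qed
qed

text \<open>By Zorn's lemma, as the pointwise infimum of a nonempty chain of seminorms is a seminorm.\<close>
lemma minimal_seminorm: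
  assumes s0: "submult_seminorm s0"
  shows "\<exists>s. submult_seminorm s \<and> s \<le> s0 \<and> (\<forall>t. submult_seminorm t \<longrightarrow> t \<le> s \<longrightarrow> t = s)"
proof -
  define A where "A = {s. submult_seminorm s \<and> s \<le> s0}"
  define P where "P s t \<longleftrightarrow> t \<le> s" for s t :: "'a \<Rightarrow> real"
  have "\<exists>m\<in>A. \<forall>a\<in>A. P m a \<longrightarrow> a = m"
  proof (rule predicate_Zorn)
    show "partial_order_on A (relation_of P A)"
      by (rule partial_order_on_relation_ofI) (auto simp: P_def)
    fix C assume C: "C \<in> Chains (relation_of P A)"
    have CA: "C \<subseteq> A" using C unfolding Chains_def relation_of_def by auto
    have ch: "t \<le> s \<or> s \<le> t" if "s \<in> C" "t \<in> C" for s t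
      using C that unfolding Chains_def relation_of_def P_def by auto
    show "\<exists>u\<in>A. \<forall>a\<in>C. P a u"
    proof (cases "C = {}")
      case True thus ?thesis using s0 by (auto simp: A_def)
    next
      case False
      have CD: "submult_seminorm s" "s \<le> s0" if "s \<in> C" for s using CA that by (auto simp: A_def)
      define u where "u x = (INF s\<in>C. s x)" for x
      have bdd: "bdd_below ((\<lambda>s. s x) ` C)" for x
        using submult_seminormD(1)[OF CD(1)] by (auto intro!: bdd_belowI[of _ 0])
      have le: "u x \<le> s x" if "s \<in> C" for s x unfolding u_def using bdd that by (intro cINF_lower) auto
      have ge: "b \<le> u x" if "\<And>s. s \<in> C \<Longrightarrow> b \<le> s x" for b x unfolding u_def using False that by (intro cINF_greatest) auto
      have approx: "\<exists>s\<in>C. s x < b" if "u x < b" for x b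
        using that False bdd unfolding u_def by (simp add: cINF_less_iff)
      have approx2: "\<exists>s\<in>C. s x < a \<and> s y < b" if h: "u x < a" "u y < b" for x y a b
      proof -
        obtain s t where st: "s \<in> C" "s x < a" "t \<in> C" "t y < b" using approx[OF h(1)] approx[OF h(2)] by blast
        show ?thesis
        proof (cases "t \<le> s")
          case True thus ?thesis using st le_funD[OF True, of x] by (intro bexI[of _ t]) auto
        next
          case False hence "s \<le> t" using ch st by blast
          thus ?thesis using st le_funD[of s t y] by (intro bexI[of _ s]) auto
        qed
      qed
      have u0: "0 \<le> u x" for x using submult_seminormD(1)[OF CD(1)] by (intro ge) auto
      have "submult_seminorm u" unfolding submult_seminorm_def
      proof (intro conjI allI)
        show "0 \<le> u x" for x by (rule u0)
        obtain s where s: "s \<in> C" using False by blast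
        show "u 0 = 0" using le[OF s, of 0] submult_seminormD(2)[OF CD(1)[OF s]] u0[of 0] by simp
        show "1 \<le> u 1" using submult_seminormD(5)[OF CD(1)] by (intro ge) auto
        show "u (x + y) \<le> max (u x) (u y)" for x y
        proof (rule dense_ge)
          fix r assume "max (u x) (u y) < r"
          then obtain s where "s \<in> C" "s x < r" "s y < r" using approx2[of x r y r] by auto
          thus "u (x + y) \<le> r" using le[of s "x + y"] submult_seminormD(3)[OF CD(1), of s x y] by simp
        qed
        show "u (x * y) \<le> u x * u y" for x y
        proof -
          have lim: "(\<lambda>n. (u x + inverse (real (Suc n))) * (u y + inverse (real (Suc n)))) \<longlonglongrightarrow> (u x + 0) * (u y + 0)"
            by (intro tendsto_intros LIMSEQ_inverse_real_of_nat)
          have "u (x * y) \<le> (u x + inverse (real (Suc n))) * (u y + inverse (real (Suc n)))" for n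
          proof -
            obtain s where s: "s \<in> C" "s x < u x + inverse (real (Suc n))" "s y < u y + inverse (real (Suc n))"
              using approx2[of x "u x + inverse (real (Suc n))" y "u y + inverse (real (Suc n))"] by auto
            have "u (x * y) \<le> s x * s y" using le[OF s(1), of "x * y"] submult_seminormD(4)[OF CD(1)[OF s(1)], of x y] by linarith
            also have "\<dots> \<le> (u x + inverse (real (Suc n))) * (u y + inverse (real (Suc n)))"
              using s submult_seminormD(1)[OF CD(1)[OF s(1)]] u0 by (intro mult_mono) (auto intro: add_nonneg_nonneg)
            finally show ?thesis .
          qed
          thus ?thesis using LIMSEQ_le_const[OF lim] by simp
        qed
      qed
      moreover obtain s where "s \<in> C" using False by blast
      ultimately have "u \<in> A" using le CD(2) unfolding A_def le_fun_def by (blast intro: order_trans)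
      thus ?thesis using le unfolding P_def le_fun_def by blast
    qed
  qed
  thus ?thesis unfolding A_def P_def by (blast intro: order_trans)
qed

text \<open>
  A minimal seminorm \<open>s\<close> equals its spectral seminorm, and is therefore multiplicative on
  powers. For \<open>s x > 0\<close>, the limit of \<open>s (y x ^ n) / s x ^ n\<close> is, as a function of \<open>y\<close>, a
  seminorm bounded by \<open>s\<close>, hence equal to \<open>s\<close>. As the sequence decreases, its first term is
  at least \<open>s y\<close>, which says that \<open>s y * s x \<le> s (y * x)\<close>.
\<close>
theorem exists_multiplicative_seminorm:
  fixes s0 :: "'r::comm_ring_1 \<Rightarrow> real"
  assumes "submult_seminorm s0"
  shows "\<exists>N. nonarch_ring N \<and> N \<le> s0"
proof -
  obtain s where s: "submult_seminorm s" and le: "s \<le> s0" and min: "\<And>t. submult_seminorm t \<Longrightarrow> t \<le> s \<Longrightarrow> t = s"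
    using minimal_seminorm[OF assms] by blast
  note sD = submult_seminormD[OF s]
  note L = spectral_limit[OF s]
  have "(\<lambda>x. lim (spectral s x)) \<le> s"
    unfolding le_fun_def using L(2)[of _ 0] by (simp add: spectral_def)
  hence eq: "s x = lim (spectral s x)" for x using min[OF spectral_seminorm[OF s]] by metis
  have sq: "s (x ^ 2) = s x ^ 2" for x
  proof (rule order_antisym)
    have "s x \<le> root 2 (s (x ^ 2))" using L(2)[of x 1] eq[of x] by (simp add: spectral_def)
    hence "s x ^ 2 \<le> root 2 (s (x ^ 2)) ^ 2" using sD(1) by (intro power_mono) auto
    thus "s x ^ 2 \<le> s (x ^ 2)" using sD(1) by simp
    show "s (x ^ 2) \<le> s x ^ 2" using sD(4)[of x x] by (simp add: power2_eq_square)
  qed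
  have s1: "s 1 = 1" using sq[of 1] sD(5) by (simp add: power2_eq_square)
  have pow2: "s (x ^ (2 ^ k)) = s x ^ (2 ^ k)" for x k
    by (induction k) (simp_all add: power_mult sq mult.commute[of 2])
  have powle: "s (x ^ n) \<le> s x ^ n" for x n
  proof (induction n)
    case (Suc n)
    have "s (x ^ Suc n) \<le> s x * s (x ^ n)" using sD(4)[of x "x ^ n"] by simp
    also have "\<dots> \<le> s x * s x ^ n" using Suc sD(1) by (intro mult_left_mono) auto
    finally show ?case by simp
  qed (use s1 in simp)
  \<comment> \<open>Compare \<open>x ^ n\<close> with a larger power whose exponent is a power of two.\<close>
  have pow: "s (x ^ n) = s x ^ n" if x: "s x > 0" for x n
  proof (rule order_antisym[OF powle])
    define m where "m = (2 :: nat) ^ n"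
    have nm: "n \<le> m" unfolding m_def by (simp add: less_imp_le)
    have "s x ^ n * s x ^ (m - n) = s (x ^ m)" using pow2[of x n] nm by (simp add: m_def power_add[symmetric])
    also have "\<dots> \<le> s (x ^ n) * s (x ^ (m - n))" using sD(4)[of "x ^ n" "x ^ (m - n)"] nm by (simp add: power_add[symmetric])
    also have "\<dots> \<le> s (x ^ n) * s x ^ (m - n)" using powle sD(1) by (intro mult_left_mono) auto
    finally show "s x ^ n \<le> s (x ^ n)" using x by simp
  qed
  have mult: "s (y * x) = s y * s x" for x y
  proof (cases "s x = 0")
    case True thus ?thesis using sD(4)[of y x] sD(1)[of "y * x"] by simp
  next
    case False
    hence x: "s x > 0" using sD(1)[of x] by simp
    define a where "a y n = s (y * x ^ n) / s x ^ n" for y n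
    have dec: "a y (Suc n) \<le> a y n" for y n
    proof -
      have "s (y * x ^ Suc n) \<le> s (y * x ^ n) * s x" using sD(4)[of "y * x ^ n" x] by (simp add: mult_ac)
      thus ?thesis using x by (simp add: a_def field_simps)
    qed
    have nn: "0 \<le> a y n" for y n using x sD(1) by (simp add: a_def)
    note A = decreasing_limit[of "a _", OF dec nn]
    have "submult_seminorm (\<lambda>y. lim (a y))" unfolding submult_seminorm_def
    proof (intro conjI allI)
      show "0 \<le> lim (a y)" for y by (rule A(3))
      have "a 0 0 = 0" by (simp add: a_def sD(2))
      thus "lim (a 0) = 0" using A(2)[of 0 0] A(3)[of 0] by simp
      have "a 1 n = 1" for n using pow[OF x] x by (simp add: a_def)
      hence "a 1 = (\<lambda>_. 1)" by blast
      thus "1 \<le> lim (a 1)" by simp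
      show "lim (a (y + z)) \<le> max (lim (a y)) (lim (a z))" for y z
      proof (rule LIMSEQ_le[OF A(1) tendsto_max[OF A(1) A(1)]])
        have "a (y + z) n \<le> max (a y n) (a z n)" for n
          using divide_right_mono[OF sD(3)[of "y * x ^ n" "z * x ^ n"], of "s x ^ n"] x
          by (simp add: a_def distrib_right max_divide_distrib_right)
        thus "\<exists>N. \<forall>n\<ge>N. a (y + z) n \<le> max (a y n) (a z n)" by blast
      qed
      show "lim (a (y * z)) \<le> lim (a y) * lim (a z)" for y z
      proof (rule LIMSEQ_le)
        have "strict_mono (\<lambda>n. 2 * n :: nat)" by (simp add: strict_mono_def)
        from LIMSEQ_subseq_LIMSEQ[OF A(1) this]
        show "(\<lambda>n. a (y * z) (2 * n)) \<longlonglongrightarrow> lim (a (y * z))" by (simp add: o_def)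
        show "(\<lambda>n. a y n * a z n) \<longlonglongrightarrow> lim (a y) * lim (a z)" by (rule tendsto_mult[OF A(1) A(1)])
        have "a (y * z) (2 * n) \<le> a y n * a z n" for n
        proof -
          have "s (y * z * x ^ (2 * n)) \<le> s (y * x ^ n) * s (z * x ^ n)"
            using sD(4)[of "y * x ^ n" "z * x ^ n"] by (simp add: mult_ac mult_2_right power_add)
          thus ?thesis using x by (simp add: a_def mult_2 power_add divide_right_mono)
        qed
        thus "\<exists>N. \<forall>n\<ge>N. a (y * z) (2 * n) \<le> a y n * a z n" by blast
      qed
    qed
    moreover have "(\<lambda>y. lim (a y)) \<le> s" unfolding le_fun_def using A(2)[of _ 0] by (simp add: a_def)
    ultimately have "s y = lim (a y)" using min by metis
    also have "\<dots> \<le> a y 1" by (rule A(2))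
    finally have "s y * s x \<le> s (y * x)" using x by (simp add: a_def pos_le_divide_eq)
    thus ?thesis using sD(4)[of y x] by simp
  qed
  have "nonarch_ring s" by unfold_locales (use sD s1 mult in auto)
  thus ?thesis using le by blast
qed

section \<open>Absolute values on finite extensions\<close>

text \<open>
  A finite extension of a valued field, presented in a commutative ring: \<open>Z\<close> is a maximal
  ideal, the classes of elements of \<open>F\<close> form a subfield of the quotient by \<open>Z\<close>, with
  absolute value \<open>\<phi>\<close>, and \<open>e 0, \<dots>, e (d - 1)\<close> represent a basis of the quotient over this
  subfield.
\<close>
locale finite_extension_data =
  fixes Z F :: "'r::comm_ring_1 set" and \<phi> :: "'r \<Rightarrow> real" and e :: "nat \<Rightarrow> 'r" and d :: nat
  assumes Z_0: "0 \<in> Z" and Z_diff: "x \<in> Z \<Longrightarrow> y \<in> Z \<Longrightarrow> x - y \<in> Z" and Z_mult: "x \<in> Z \<Longrightarrow> x * y \<in> Z"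
    and Z_1: "1 \<notin> Z" and Z_inverse: "x \<notin> Z \<Longrightarrow> \<exists>y. x * y - 1 \<in> Z"
    and F_1: "1 \<in> F" and F_diff: "x \<in> F \<Longrightarrow> y \<in> F \<Longrightarrow> x - y \<in> F" and F_mult: "x \<in> F \<Longrightarrow> y \<in> F \<Longrightarrow> x * y \<in> F"
    and F_inverse: "x \<in> F \<Longrightarrow> x \<notin> Z \<Longrightarrow> \<exists>y\<in>F. x * y - 1 \<in> Z"
    and Z_F: "Z \<subseteq> F"
    and \<phi>_nonneg: "x \<in> F \<Longrightarrow> 0 \<le> \<phi> x" and \<phi>_zero: "x \<in> F \<Longrightarrow> \<phi> x = 0 \<longleftrightarrow> x \<in> Z"
    and \<phi>_mult: "x \<in> F \<Longrightarrow> y \<in> F \<Longrightarrow> \<phi> (x * y) = \<phi> x * \<phi> y"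
    and \<phi>_add: "x \<in> F \<Longrightarrow> y \<in> F \<Longrightarrow> \<phi> (x + y) \<le> max (\<phi> x) (\<phi> y)"
    and span: "\<exists>c. (\<forall>k<d. c k \<in> F) \<and> x - (\<Sum>k<d. c k * e k) \<in> Z"
    and indep: "(\<forall>k<d. c k \<in> F) \<Longrightarrow> (\<Sum>k<d. c k * e k) \<in> Z \<Longrightarrow> k < d \<Longrightarrow> c k \<in> Z"
begin

lemma Z_uminus: "x \<in> Z \<Longrightarrow> - x \<in> Z" using Z_diff[OF Z_0] by simp
lemma Z_add: "x \<in> Z \<Longrightarrow> y \<in> Z \<Longrightarrow> x + y \<in> Z" using Z_diff[of x "- y"] Z_uminus by simp
lemma Z_mult2: "y \<in> Z \<Longrightarrow> x * y \<in> Z" using Z_mult[of y x] by (simp add: mult.commute)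
lemma F_0: "0 \<in> F" using F_diff[OF F_1 F_1] by simp
lemma F_uminus: "x \<in> F \<Longrightarrow> - x \<in> F" using F_diff[OF F_0] by simp
lemma F_add: "x \<in> F \<Longrightarrow> y \<in> F \<Longrightarrow> x + y \<in> F" using F_diff[of x "- y"] F_uminus by simp
lemma F_power: "x \<in> F \<Longrightarrow> x ^ n \<in> F" by (induction n) (simp_all add: F_1 F_mult)
lemma Z_sum: "(\<And>i. i \<in> A \<Longrightarrow> f i \<in> Z) \<Longrightarrow> sum f A \<in> Z"
  by (induction A rule: infinite_finite_induct) (simp_all add: Z_0 Z_add)

lemma \<phi>_one: "\<phi> 1 = 1"
proof -
  have "\<phi> 1 = \<phi> 1 * \<phi> 1" using \<phi>_mult[OF F_1 F_1] by simp
  moreover have "\<phi> 1 \<noteq> 0" using \<phi>_zero[OF F_1] Z_1 by simp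
  ultimately show ?thesis by simp
qed

lemma \<phi>_cong: "x \<in> F \<Longrightarrow> y \<in> F \<Longrightarrow> x - y \<in> Z \<Longrightarrow> \<phi> x = \<phi> y"
proof -
  have le: "\<phi> x \<le> \<phi> y" if "x \<in> F" "y \<in> F" "x - y \<in> Z" for x y
    using \<phi>_add[of "x - y" y] that \<phi>_zero[of "x - y"] F_diff \<phi>_nonneg[of y] by simp
  show "x \<in> F \<Longrightarrow> y \<in> F \<Longrightarrow> x - y \<in> Z \<Longrightarrow> \<phi> x = \<phi> y"
    using le[of x y] le[of y x] Z_uminus[of "x - y"] by simp
qed

text \<open>Coordinates with respect to the basis; they are determined modulo \<open>Z\<close>.\<close>
definition coord :: "'r \<Rightarrow> nat \<Rightarrow> 'r" where
  "coord x = (SOME c. (\<forall>k<d. c k \<in> F) \<and> x - (\<Sum>k<d. c k * e k) \<in> Z)"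

lemma coord: "k < d \<Longrightarrow> coord x k \<in> F" "x - (\<Sum>k<d. coord x k * e k) \<in> Z"
  using someI_ex[OF span[of x]] unfolding coord_def by blast+

lemma coord_unique:
  assumes "\<And>k. k < d \<Longrightarrow> c k \<in> F" "x - (\<Sum>k<d. c k * e k) \<in> Z" "k < d"
  shows "coord x k - c k \<in> Z"
proof -
  have "(\<Sum>k<d. (coord x k - c k) * e k) = (x - (\<Sum>k<d. c k * e k)) - (x - (\<Sum>k<d. coord x k * e k))"
    by (simp add: sum_subtractf left_diff_distrib)
  also have "\<dots> \<in> Z" using assms(2) coord(2) by (rule Z_diff)
  finally show ?thesis using indep[of "\<lambda>k. coord x k - c k" k] assms coord(1) F_diff by blast
qed

lemma d_pos: "d > 0"
proof (rule ccontr)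
  assume "\<not> ?thesis"
  thus False using coord(2)[of 1] Z_1 by simp
qed

text \<open>The maximum norm of the coordinates.\<close>
definition gauge :: "'r \<Rightarrow> real" where
  "gauge x = Max ((\<lambda>k. \<phi> (coord x k)) ` {..<d})"

lemma gauge_ge: "k < d \<Longrightarrow> \<phi> (coord x k) \<le> gauge x"
  unfolding gauge_def by (intro Max_ge) auto

lemma gauge_nonneg: "0 \<le> gauge x"
  using gauge_ge[OF d_pos, of x] \<phi>_nonneg[OF coord(1)[OF d_pos], of x] by linarith

lemma gauge_le:
  assumes "\<And>k. k < d \<Longrightarrow> c k \<in> F" "x - (\<Sum>k<d. c k * e k) \<in> Z" "\<And>k. k < d \<Longrightarrow> \<phi> (c k) \<le> B"
  shows "gauge x \<le> B"
proof -
  have "\<phi> (coord x k) \<le> B" if "k < d" for k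
    using \<phi>_cong[OF coord(1)[OF that] assms(1)[OF that] coord_unique[OF assms(1,2) that]] assms(3)[OF that] by simp
  thus ?thesis unfolding gauge_def using d_pos by (intro Max.boundedI) auto
qed

lemma gauge_zero: "gauge x = 0 \<longleftrightarrow> x \<in> Z"
proof
  assume "gauge x = 0"
  hence "\<phi> (coord x k) = 0" if "k < d" for k
    using gauge_ge[OF that, of x] \<phi>_nonneg[OF coord(1)[OF that], of x] by simp
  hence "(\<Sum>k<d. coord x k * e k) \<in> Z" using \<phi>_zero coord(1) Z_mult by (intro Z_sum) auto
  thus "x \<in> Z" using Z_add[OF coord(2)[of x]] by fastforce
next
  assume "x \<in> Z"
  moreover have "\<phi> 0 = 0" using \<phi>_zero[OF F_0] Z_0 by simp
  ultimately have "gauge x \<le> 0" using F_0 by (intro gauge_le[of "\<lambda>_. 0"]) auto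
  thus "gauge x = 0" using gauge_nonneg[of x] by simp
qed

lemma gauge_add: "gauge (x + y) \<le> max (gauge x) (gauge y)"
proof (rule gauge_le[of "\<lambda>k. coord x k + coord y k"])
  have "x + y - (\<Sum>k<d. (coord x k + coord y k) * e k) =
     (x - (\<Sum>k<d. coord x k * e k)) + (y - (\<Sum>k<d. coord y k * e k))"
    by (simp add: distrib_right sum.distrib)
  thus "x + y - (\<Sum>k<d. (coord x k + coord y k) * e k) \<in> Z" using Z_add[OF coord(2) coord(2)] by metis
  show "\<phi> (coord x k + coord y k) \<le> max (gauge x) (gauge y)" if "k < d" for k
    using \<phi>_add[OF coord(1)[OF that] coord(1)[OF that], of x y] gauge_ge[OF that, of x] gauge_ge[OF that, of y] by linarith
qed (use coord F_add in auto)

lemma gauge_sum: "0 \<le> B \<Longrightarrow> (\<And>i. i \<in> A \<Longrightarrow> gauge (f i) \<le> B) \<Longrightarrow> gauge (sum f A) \<le> B"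
proof (induction A rule: infinite_finite_induct)
  case (insert a A)
  thus ?case using gauge_add[of "f a" "sum f A"] by fastforce
qed (use gauge_zero[of 0] Z_0 in simp_all)

lemma gauge_scale: "a \<in> F \<Longrightarrow> gauge (a * x) \<le> \<phi> a * gauge x"
proof (rule gauge_le[of "\<lambda>k. a * coord x k"])
  have "a * x - (\<Sum>k<d. a * coord x k * e k) = a * (x - (\<Sum>k<d. coord x k * e k))"
    by (simp add: right_diff_distrib sum_distrib_left mult_ac)
  thus "a * x - (\<Sum>k<d. a * coord x k * e k) \<in> Z" using Z_mult2[OF coord(2)] by simp
qed (use coord F_mult \<phi>_mult gauge_ge \<phi>_nonneg in \<open>auto intro!: mult_left_mono\<close>)

lemma gauge_cong: "x - y \<in> Z \<Longrightarrow> gauge x \<le> gauge y"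
  using gauge_add[of "x - y" y] gauge_zero[of "x - y"] gauge_nonneg[of y] by simp

text \<open>The constant \<open>C\<close> bounds the structure constants of the multiplication.\<close>
lemma gauge_mult: "\<exists>C\<ge>1. \<forall>x y. gauge (x * y) \<le> C * gauge x * gauge y"
proof -
  define C where "C = Max (insert 1 ((\<lambda>(i, j). gauge (e i * e j)) ` ({..<d} \<times> {..<d})))"
  have C: "gauge (e i * e j) \<le> C" if "i < d" "j < d" for i j
    unfolding C_def using that by (intro Max_ge) auto
  have C1: "1 \<le> C" unfolding C_def by (intro Max_ge) auto
  have "gauge (x * y) \<le> C * gauge x * gauge y" for x y
  proof -
    define x' y' where "x' = (\<Sum>k<d. coord x k * e k)" and "y' = (\<Sum>k<d. coord y k * e k)"
    have "x * y - x' * y' = (x - x') * y + x' * (y - y')" by (simp add: algebra_simps)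
    also have "\<dots> \<in> Z" unfolding x'_def y'_def using coord(2) Z_mult Z_mult2 Z_add by blast
    finally have "gauge (x * y) \<le> gauge (x' * y')" by (rule gauge_cong)
    also have "x' * y' = (\<Sum>i<d. \<Sum>j<d. coord x i * (coord y j * (e i * e j)))"
      unfolding x'_def y'_def sum_product by (simp add: mult_ac)
    also have "gauge \<dots> \<le> gauge x * (gauge y * C)"
    proof (intro gauge_sum)
      fix i j assume ij: "i \<in> {..<d}" "j \<in> {..<d}"
      have "gauge (coord x i * (coord y j * (e i * e j))) \<le> \<phi> (coord x i) * gauge (coord y j * (e i * e j))"
        using ij coord gauge_scale by blast
      also have "\<dots> \<le> \<phi> (coord x i) * (\<phi> (coord y j) * gauge (e i * e j))"
        using ij coord gauge_scale \<phi>_nonneg by (intro mult_left_mono) auto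
      also have "\<dots> \<le> gauge x * (gauge y * C)"
        using ij coord gauge_ge C \<phi>_nonneg gauge_nonneg by (intro mult_mono) auto
      finally show "gauge (coord x i * (coord y j * (e i * e j))) \<le> gauge x * (gauge y * C)" .
    qed (use gauge_nonneg C1 in auto)
    finally show ?thesis by (simp add: mult_ac)
  qed
  thus ?thesis using C1 by blast
qed

lemma le_if_powers_le:
  fixes a b K :: real
  assumes "0 \<le> a" "0 \<le> b" "\<And>n. a ^ n \<le> K * b ^ n"
  shows "a \<le> b"
proof (rule ccontr)
  assume "\<not> ?thesis"
  hence ab: "a > b" by simp
  show False
  proof (cases "b = 0")
    case True thus False using assms(3)[of 1] ab by simp
  next
    case False
    hence b: "b > 0" using assms by simp
    have "(a / b) ^ n \<le> K" for n using assms(3)[of n] b by (simp add: power_divide pos_divide_le_eq)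
    moreover obtain n where "K < (a / b) ^ n" using real_arch_pow[of "a / b" K] ab b by auto
    ultimately show False by (metis not_less)
  qed
qed

text \<open>
  A suitable multiple of the gauge is submultiplicative; let \<open>N\<close> be a multiplicative
  seminorm below it. Comparing \<open>N (c ^ n)\<close> with the gauge of \<open>c ^ n\<close> gives \<open>N c \<le> \<phi> c\<close> on
  \<open>F\<close>, and the same inequality for the inverse of \<open>c\<close> gives equality.
\<close>
theorem absval_extension:
  "\<exists>N. nonarch_fld N \<and> (\<forall>c\<in>F. N c = \<phi> c) \<and> (\<forall>x. N x = 0 \<longleftrightarrow> x \<in> Z)"
proof -
  obtain C where C: "C \<ge> 1" "\<And>x y. gauge (x * y) \<le> C * gauge x * gauge y" using gauge_mult by blast
  define s where "s x = C * gauge x" for x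
  have "s (x * y) \<le> s x * s y" for x y
    using mult_left_mono[OF C(2)[of x y], of C] C(1) by (simp add: s_def mult_ac)
  moreover have "1 \<le> s 1"
  proof -
    have "gauge 1 \<noteq> 0" using gauge_zero Z_1 by simp
    hence "gauge 1 > 0" using gauge_nonneg[of 1] by simp
    moreover have "gauge 1 \<le> C * gauge 1 * gauge 1" using C(2)[of 1 1] by simp
    ultimately show ?thesis unfolding s_def by simp
  qed
  moreover have "s (x + y) \<le> max (s x) (s y)" for x y
    using mult_left_mono[OF gauge_add[of x y], of C] C(1) by (simp add: s_def max_mult_distrib_left)
  ultimately have "submult_seminorm s"
    unfolding submult_seminorm_def using C gauge_nonneg gauge_zero Z_0 by (auto simp: s_def)
  then obtain N where N: "nonarch_ring N" "N \<le> s" using exists_multiplicative_seminorm by blast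
  interpret nonarch_ring N by (rule N(1))
  have Ns: "N x \<le> C * gauge x" for x using N(2) by (simp add: le_fun_def s_def)
  have NZ: "N x = 0" if "x \<in> Z" for x using Ns[of x] gauge_zero[of x] that by (simp add: order_antisym)
  have N1: "N x * N y = 1" if "x * y - 1 \<in> Z" for x y using N_cong[OF NZ[OF that]] by (simp add: N_mult)
  have le: "N c \<le> \<phi> c" if c: "c \<in> F" for c
  proof (rule le_if_powers_le)
    show "N c ^ n \<le> (C * gauge 1) * \<phi> c ^ n" for n
    proof -
      have "\<phi> (c ^ n) = \<phi> c ^ n" by (induction n) (use c F_power \<phi>_mult \<phi>_one in auto)
      hence "gauge (c ^ n * 1) \<le> \<phi> c ^ n * gauge 1" using gauge_scale[OF F_power[OF c], of n 1] by simp
      hence "C * gauge (c ^ n) \<le> C * (\<phi> c ^ n * gauge 1)" using C(1) by simp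
      thus ?thesis using Ns[of "c ^ n"] by (simp add: N_power mult_ac)
    qed
  qed (use c \<phi>_nonneg in auto)
  have "N c = \<phi> c" if c: "c \<in> F" for c
  proof (cases "c \<in> Z")
    case True thus ?thesis using NZ \<phi>_zero c by simp
  next
    case False
    then obtain c' where c': "c' \<in> F" "c * c' - 1 \<in> Z" using F_inverse c by blast
    have 1: "N c * N c' = 1" by (rule N1[OF c'(2)])
    have 2: "\<phi> c * \<phi> c' = 1" using \<phi>_cong[OF F_mult[OF c c'(1)] F_1 c'(2)] \<phi>_mult[OF c c'(1)] \<phi>_one by simp
    have "\<phi> c * N c' \<le> \<phi> c * \<phi> c'" using le[OF c'(1)] \<phi>_nonneg[OF c] by (intro mult_left_mono)
    hence "\<phi> c * N c' \<le> N c * N c'" using 1 2 by simp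
    moreover have "N c' > 0" using 1 N_nonneg[of c'] by (metis less_eq_real_def mult_zero_right zero_neq_one)
    ultimately show ?thesis using le[OF c] by simp
  qed
  moreover have "N x = 0 \<longleftrightarrow> x \<in> Z" for x
    using NZ Z_inverse[of x] N1 by (metis mult_zero_left zero_neq_one)
  moreover have "nonarch_fld N"
    by unfold_locales (use calculation(2) Z_inverse in blast)
  ultimately show ?thesis by blast
qed

end

text \<open>Cauchy sequences with respect to a seminorm.\<close>
definition seq_cauchy :: "('r::comm_ring_1 \<Rightarrow> real) \<Rightarrow> (nat \<Rightarrow> 'r) \<Rightarrow> bool" where
  "seq_cauchy N S \<longleftrightarrow> (\<forall>e>0. \<exists>M. \<forall>m\<ge>M. \<forall>n\<ge>M. N (S m - S n) < e)"

text \<open>A finite extension of a complete field, with an absolute value \<open>N\<close> on the extension.\<close>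
locale complete_finite_extension = finite_extension_data Z F \<phi> e d + nonarch_fld N
  for Z F :: "'r::comm_ring_1 set" and \<phi> :: "'r \<Rightarrow> real" and e :: "nat \<Rightarrow> 'r" and d :: nat
    and N :: "'r \<Rightarrow> real" +
  assumes N_Z: "N x = 0 \<longleftrightarrow> x \<in> Z"
    and F_complete: "(\<And>n. S n \<in> F) \<Longrightarrow> seq_cauchy N S \<Longrightarrow> \<exists>y\<in>F. (\<lambda>n. N (S n - y)) \<longlonglongrightarrow> 0"
begin

lemma sum_close:
  assumes "\<And>k. k < m \<Longrightarrow> (\<lambda>n. N (c n k - l k)) \<longlonglongrightarrow> 0"
  shows "(\<lambda>n. N ((\<Sum>k<m. c n k * e k) - (\<Sum>k<m. l k * e k))) \<longlonglongrightarrow> 0"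
proof (rule tendsto_sandwich[OF _ _ tendsto_const])
  show "(\<lambda>n. \<Sum>k<m. N (c n k - l k) * N (e k)) \<longlonglongrightarrow> 0"
    using assms by (intro tendsto_null_sum tendsto_mult_left_zero) auto
  have "N ((\<Sum>k<m. c n k * e k) - (\<Sum>k<m. l k * e k)) \<le> (\<Sum>k<m. N (c n k - l k) * N (e k))" for n
  proof -
    have "(\<Sum>k<m. c n k * e k) - (\<Sum>k<m. l k * e k) = (\<Sum>k<m. (c n k - l k) * e k)"
      by (simp add: sum_subtractf left_diff_distrib)
    also have "N \<dots> \<le> (\<Sum>k<m. N (c n k - l k) * N (e k))"
    proof (rule N_sum_le)
      fix i assume "i \<in> {..<m}"
      hence "N (c n i - l i) * N (e i) \<le> (\<Sum>k<m. N (c n k - l k) * N (e k))"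
        by (intro member_le_sum) auto
      thus "N ((c n i - l i) * e i) \<le> (\<Sum>k<m. N (c n k - l k) * N (e k))" by (simp add: N_mult)
    qed (auto intro: sum_nonneg)
    finally show ?thesis .
  qed
  thus "\<forall>\<^sub>F n in sequentially. N ((\<Sum>k<m. c n k * e k) - (\<Sum>k<m. l k * e k)) \<le> (\<Sum>k<m. N (c n k - l k) * N (e k))"
    by simp
qed auto

text \<open>
  If coordinates on the span of \<open>e 0, \<dots>, e (m - 1)\<close> are bounded, this span is complete: the
  coordinates of a Cauchy sequence are Cauchy sequences in \<open>F\<close>.
\<close>
lemma coordinatewise_limit:
  assumes C: "C > 0" "\<And>c k. (\<And>k. k < m \<Longrightarrow> c k \<in> F) \<Longrightarrow> k < m \<Longrightarrow> N (c k) \<le> C * N (\<Sum>k<m. c k * e k)"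
    and c: "\<And>n k. k < m \<Longrightarrow> c n k \<in> F"
    and S: "seq_cauchy N (\<lambda>n. \<Sum>k<m. c n k * e k)"
  shows "\<exists>l. (\<forall>k<m. l k \<in> F) \<and> (\<lambda>n. N ((\<Sum>k<m. c n k * e k) - (\<Sum>k<m. l k * e k))) \<longlonglongrightarrow> 0"
proof -
  have "\<exists>y\<in>F. (\<lambda>n. N (c n k - y)) \<longlonglongrightarrow> 0" if k: "k < m" for k
  proof (rule F_complete)
    show "seq_cauchy N (\<lambda>n. c n k)" unfolding seq_cauchy_def
    proof (intro allI impI)
      fix r :: real assume r: "r > 0"
      hence "r / C > 0" using C by simp
      then obtain M where M: "\<forall>i\<ge>M. \<forall>j\<ge>M. N ((\<Sum>k<m. c i k * e k) - (\<Sum>k<m. c j k * e k)) < r / C"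
        using S unfolding seq_cauchy_def by blast
      have "N (c i k - c j k) < r" if ij: "i \<ge> M" "j \<ge> M" for i j
      proof -
        have "N (c i k - c j k) \<le> C * N (\<Sum>k<m. (c i k - c j k) * e k)"
          using C(2)[of "\<lambda>k. c i k - c j k" k] c k F_diff by simp
        also have "(\<Sum>k<m. (c i k - c j k) * e k) = (\<Sum>k<m. c i k * e k) - (\<Sum>k<m. c j k * e k)"
          by (simp add: sum_subtractf left_diff_distrib)
        also have "C * N \<dots> < C * (r / C)" using M ij C(1) by (intro mult_strict_left_mono) auto
        finally show ?thesis using C(1) by simp
      qed
      thus "\<exists>M. \<forall>i\<ge>M. \<forall>j\<ge>M. N (c i k - c j k) < r" by blast
    qed
  qed (use c k in auto)
  then obtain l where "\<And>k. k < m \<Longrightarrow> l k \<in> F \<and> (\<lambda>n. N (c n k - l k)) \<longlonglongrightarrow> 0" by metis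
  thus ?thesis using sum_close[of m c l] by blast
qed

text \<open>
  By induction, the span of the first \<open>m\<close> basis vectors is complete, hence closed. So \<open>e m\<close>
  has positive distance \<open>\<delta>\<close> from it, which bounds the last coordinate of a vector in the
  next span.
\<close>
lemma bounded_coordinates:
  "m \<le> d \<Longrightarrow> \<exists>C>0. \<forall>c. (\<forall>k<m. c k \<in> F) \<longrightarrow> (\<forall>k<m. N (c k) \<le> C * N (\<Sum>k<m. c k * e k))"
proof (induction m)
  case 0
  show ?case by (intro exI[of _ 1]) auto
next
  case (Suc m)
  then obtain C where C: "C > 0" "\<And>c k. (\<And>k. k < m \<Longrightarrow> c k \<in> F) \<Longrightarrow> k < m \<Longrightarrow> N (c k) \<le> C * N (\<Sum>k<m. c k * e k)"
    by (metis Suc_leD)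
  have "\<exists>\<delta>>0. \<forall>c. (\<forall>k<m. c k \<in> F) \<longrightarrow> \<delta> \<le> N (e m - (\<Sum>k<m. c k * e k))"
  proof (rule ccontr)
    assume "\<not> ?thesis"
    hence *: "\<exists>c. (\<forall>k<m. c k \<in> F) \<and> N (e m - (\<Sum>k<m. c k * e k)) < \<delta>" if "\<delta> > 0" for \<delta>
      using that by (meson not_le)
    have "\<forall>n. \<exists>c. (\<forall>k<m. c k \<in> F) \<and> N (e m - (\<Sum>k<m. c k * e k)) < inverse (real (Suc n))"
      using * by simp
    then obtain c where c: "\<And>n k. k < m \<Longrightarrow> c n k \<in> F"
      and close: "\<And>n. N (e m - (\<Sum>k<m. c n k * e k)) < inverse (real (Suc n))" by metis
    have lim: "(\<lambda>n. N (e m - (\<Sum>k<m. c n k * e k))) \<longlonglongrightarrow> 0"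
      by (rule tendsto_sandwich[OF _ _ tendsto_const LIMSEQ_inverse_real_of_nat])
         (use close in \<open>auto simp del: of_nat_Suc intro!: less_imp_le always_eventually\<close>)
    have "seq_cauchy N (\<lambda>n. \<Sum>k<m. c n k * e k)" unfolding seq_cauchy_def
    proof (intro allI impI)
      fix r :: real assume "r > 0"
      then obtain M where M: "\<forall>n\<ge>M. N (e m - (\<Sum>k<m. c n k * e k)) < r"
        using LIMSEQ_D[OF lim] by fastforce
      have "N ((\<Sum>k<m. c i k * e k) - (\<Sum>k<m. c j k * e k)) < r" if "i \<ge> M" "j \<ge> M" for i j
        using N_diff_less[of "e m - (\<Sum>k<m. c j k * e k)" r "e m - (\<Sum>k<m. c i k * e k)"] M that by simp
      thus "\<exists>M. \<forall>i\<ge>M. \<forall>j\<ge>M. N ((\<Sum>k<m. c i k * e k) - (\<Sum>k<m. c j k * e k)) < r" by blast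
    qed
    from coordinatewise_limit[OF C c this] obtain l where l: "\<forall>k<m. l k \<in> F"
      and liml: "(\<lambda>n. N ((\<Sum>k<m. c n k * e k) - (\<Sum>k<m. l k * e k))) \<longlonglongrightarrow> 0" by blast
    have "(\<lambda>n. max (N (e m - (\<Sum>k<m. c n k * e k))) (N ((\<Sum>k<m. c n k * e k) - (\<Sum>k<m. l k * e k)))) \<longlonglongrightarrow> max 0 0"
      by (intro tendsto_max lim liml)
    hence "N (e m - (\<Sum>k<m. l k * e k)) \<le> max 0 0"
      by (rule LIMSEQ_le_const) (use N_diff_triangle in blast)
    hence zero: "e m - (\<Sum>k<m. l k * e k) \<in> Z" using N_Z N_nonneg[of "e m - (\<Sum>k<m. l k * e k)"] by simp
    \<comment> \<open>A limit of vectors in the span that is equal to \<open>e m\<close> would be a linear relation.\<close>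
    define c' where "c' k = (if k < m then - l k else if k = m then 1 else 0)" for k
    have "(\<Sum>k<d. c' k * e k) = (\<Sum>k<Suc m. c' k * e k)"
      using Suc.prems by (intro sum.mono_neutral_right) (auto simp: c'_def)
    also have "\<dots> = e m - (\<Sum>k<m. l k * e k)" by (simp add: c'_def sum_negf)
    finally have "(\<Sum>k<d. c' k * e k) \<in> Z" using zero by simp
    moreover have "\<forall>k<d. c' k \<in> F" using l F_0 F_1 F_uminus by (auto simp: c'_def)
    ultimately have "c' m \<in> Z" using indep Suc.prems by auto
    thus False using Z_1 by (simp add: c'_def)
  qed
  then obtain \<delta> where \<delta>: "\<delta> > 0" "\<And>c. (\<And>k. k < m \<Longrightarrow> c k \<in> F) \<Longrightarrow> \<delta> \<le> N (e m - (\<Sum>k<m. c k * e k))" by blast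
  define K where "K = 1 + N (e m) / \<delta>"
  have K: "K \<ge> 1" using \<delta> by (simp add: K_def)
  define D where "D = max (1 / \<delta>) (C * K)"
  have "N (c k) \<le> D * N (\<Sum>k<Suc m. c k * e k)" if c: "\<forall>k<Suc m. c k \<in> F" and k: "k < Suc m" for c k
  proof -
    define x where "x = (\<Sum>k<Suc m. c k * e k)"
    have last: "N (c m) * \<delta> \<le> N x"
    proof (cases "c m \<in> Z")
      case True
      hence "N (c m) = 0" using N_Z by blast
      thus ?thesis by simp
    next
      case False
      then obtain b where b: "b \<in> F" "c m * b - 1 \<in> Z" using F_inverse c by blast
      define r where "r = (\<Sum>k<m. (- (b * c k)) * e k)"
      have "\<delta> \<le> N (e m - r)" unfolding r_def using b c F_uminus F_mult by (intro \<delta>(2)) auto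
      hence "N (c m) * \<delta> \<le> N (c m * (e m - r))" by (simp add: N_mult mult_left_mono)
      also have "N (c m * (e m - r)) = N x"
      proof (rule N_cong)
        have "r = - (b * (\<Sum>k<m. c k * e k))"
          unfolding r_def by (simp add: sum_distrib_left sum_negf mult_ac)
        hence "c m * (e m - r) - x = (c m * b - 1) * (\<Sum>k<m. c k * e k)"
          unfolding x_def by (simp add: algebra_simps)
        thus "N (c m * (e m - r) - x) = 0" using b N_Z Z_mult by simp
      qed
      finally show ?thesis .
    qed
    hence lastle: "N (c m) \<le> 1 / \<delta> * N x" using \<delta>(1) by (simp add: field_simps)
    have "N (c m * e m) \<le> N (e m) / \<delta> * N x"
      using mult_right_mono[OF lastle, of "N (e m)"] by (simp add: N_mult mult_ac)
    moreover have "K * N x = N x + N (e m) / \<delta> * N x" by (simp add: K_def distrib_right)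
    moreover have "0 \<le> N (e m) / \<delta> * N x" using \<delta>(1) by simp
    ultimately have "N (c m * e m) \<le> K * N x" "N x \<le> K * N x"
      using N_nonneg[of x] by linarith+
    hence "N (x - c m * e m) \<le> K * N x" by (rule N_diff_le[rotated])
    moreover have "x - c m * e m = (\<Sum>k<m. c k * e k)" by (simp add: x_def)
    ultimately have rest: "N (\<Sum>k<m. c k * e k) \<le> K * N x" by simp
    show ?thesis
    proof (cases "k = m")
      case True
      have "1 / \<delta> * N x \<le> D * N x" by (intro mult_right_mono) (auto simp: D_def)
      thus ?thesis using lastle True by (simp add: x_def)
    next
      case False
      hence "N (c k) \<le> C * N (\<Sum>k<m. c k * e k)" using C(2)[of c k] c k by simp
      also have "\<dots> \<le> C * (K * N x)" using rest C(1) by (intro mult_left_mono) auto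
      also have "\<dots> = (C * K) * N x" by simp
      also have "\<dots> \<le> D * N x" by (intro mult_right_mono) (auto simp: D_def)
      finally show ?thesis by (simp add: x_def)
    qed
  qed
  moreover have "D > 0" using \<delta>(1) by (simp add: D_def less_max_iff_disj)
  ultimately show ?case by blast
qed

sublocale complete_nonarch_fld N
proof unfold_locales
  fix S :: "nat \<Rightarrow> 'r" assume "\<forall>r>0. \<exists>M. \<forall>m\<ge>M. \<forall>n\<ge>M. N (S m - S n) < r"
  hence S: "seq_cauchy N S" by (simp add: seq_cauchy_def)
  obtain C where C: "C > 0" "\<And>c k. (\<And>k. k < d \<Longrightarrow> c k \<in> F) \<Longrightarrow> k < d \<Longrightarrow> N (c k) \<le> C * N (\<Sum>k<d. c k * e k)"
    using bounded_coordinates[of d] by blast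
  define T where "T n = (\<Sum>k<d. coord (S n) k * e k)" for n
  have ST: "N (S n - T n) = 0" for n using coord(2) N_Z by (simp add: T_def)
  have "N (T i - T j) \<le> N (S i - S j)" for i j
  proof -
    have "T i - T j = (S i - S j) - ((S i - T i) - (S j - T j))" by simp
    moreover have "N ((S i - T i) - (S j - T j)) \<le> N (S i - S j)" by (rule N_diff_le) (simp_all add: ST)
    ultimately show ?thesis
      using N_diff_le[OF order_refl, of "(S i - T i) - (S j - T j)" "S i - S j"] by metis
  qed
  hence "seq_cauchy N T" using S unfolding seq_cauchy_def by (meson le_less_trans)
  then obtain l where l: "(\<lambda>n. N (T n - (\<Sum>k<d. l k * e k))) \<longlonglongrightarrow> 0"
    using coordinatewise_limit[OF C, of "\<lambda>n. coord (S n)"] coord(1) unfolding T_def by blast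
  have "N (S n - (\<Sum>k<d. l k * e k)) = N (T n - (\<Sum>k<d. l k * e k))" for n
    using ST by (intro N_cong) simp
  hence "(\<lambda>n. N (S n - (\<Sum>k<d. l k * e k))) \<longlonglongrightarrow> 0" using l by presburger
  thus "\<exists>y. (\<lambda>n. N (S n - y)) \<longlonglongrightarrow> 0" by blast
qed

end

section \<open>A type that maps onto all commutative rings on a given type\<close>
lemma cring_zero_closed: "cring R \<Longrightarrow> \<zero>\<^bsub>R\<^esub> \<in> carrier R"
proof -
  assume "cring R"
  then interpret cring R .
  show ?thesis by simp
qed

text \<open>
  The product of all commutative rings whose carrier consists of elements of \<open>'b\<close>, and of
  the ring of integers. The factor of integers ensures \<open>0 \<noteq> 1\<close> even if \<open>'b\<close> has only one
  element. The value \<open>undefined\<close> at records that are not commutative rings makes the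
  elements extensional.
\<close>
typedef 'b univ = "{f :: 'b ring \<Rightarrow> 'b. \<forall>R. (cring R \<longrightarrow> f R \<in> carrier R) \<and> (\<not> cring R \<longrightarrow> f R = undefined)} \<times> (UNIV :: int set)"
proof -
  define f where "f R = (if cring R then \<zero>\<^bsub>R\<^esub> else undefined)" for R :: "'b ring"
  have "\<forall>R. (cring R \<longrightarrow> f R \<in> carrier R) \<and> (\<not> cring R \<longrightarrow> f R = undefined)"
    unfolding f_def using cring_zero_closed by metis
  thus ?thesis by blast
qed

text \<open>The projection to the factor \<open>R\<close>; it is a surjective ring homomorphism.\<close>
definition dn :: "'b ring \<Rightarrow> 'b univ \<Rightarrow> 'b" where
  "dn R x = fst (Rep_univ x) R"

text \<open>The element with given components.\<close>
definition mk_univ :: "('b ring \<Rightarrow> 'b) \<Rightarrow> int \<Rightarrow> 'b univ" where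
  "mk_univ f k = Abs_univ (\<lambda>R. if cring R then f R else undefined, k)"

lemma Rep_mk_univ:
  assumes "\<And>R. cring R \<Longrightarrow> f R \<in> carrier R"
  shows "Rep_univ (mk_univ f k) = (\<lambda>R. if cring R then f R else undefined, k)"
  unfolding mk_univ_def by (rule Abs_univ_inverse) (use assms in auto)

lemma dn_carrier: "cring R \<Longrightarrow> dn R x \<in> carrier R"
  using Rep_univ[of x] unfolding dn_def by (auto simp: mem_Times_iff)

lemma dn_mk: "(\<And>R. cring R \<Longrightarrow> f R \<in> carrier R) \<Longrightarrow> cring R \<Longrightarrow> dn R (mk_univ f k) = f R"
  by (simp add: dn_def Rep_mk_univ)

lemma snd_mk: "(\<And>R. cring R \<Longrightarrow> f R \<in> carrier R) \<Longrightarrow> snd (Rep_univ (mk_univ f k)) = k"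
  by (simp add: Rep_mk_univ)

lemma univ_eqI:
  assumes "\<And>R. cring R \<Longrightarrow> dn R x = dn R y" "snd (Rep_univ x) = snd (Rep_univ y)"
  shows "x = y"
proof -
  have "fst (Rep_univ x) = fst (Rep_univ y)"
  proof
    fix R :: "'a ring"
    show "fst (Rep_univ x) R = fst (Rep_univ y) R"
      using assms(1)[of R] Rep_univ[of x] Rep_univ[of y]
      by (cases "cring R"; cases "Rep_univ x"; cases "Rep_univ y") (auto simp: dn_def)
  qed
  hence "Rep_univ x = Rep_univ y" using assms(2) by (simp add: prod_eq_iff)
  thus ?thesis by (simp add: Rep_univ_inject)
qed

instantiation univ :: (type) comm_ring_1
begin

definition "0 = mk_univ (\<lambda>R. \<zero>\<^bsub>R\<^esub>) 0"
definition "1 = mk_univ (\<lambda>R. \<one>\<^bsub>R\<^esub>) 1"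
definition "x + y = mk_univ (\<lambda>R. dn R x \<oplus>\<^bsub>R\<^esub> dn R y) (snd (Rep_univ x) + snd (Rep_univ y))"
definition "x * y = mk_univ (\<lambda>R. dn R x \<otimes>\<^bsub>R\<^esub> dn R y) (snd (Rep_univ x) * snd (Rep_univ y))"
definition "x - y = mk_univ (\<lambda>R. dn R x \<ominus>\<^bsub>R\<^esub> dn R y) (snd (Rep_univ x) - snd (Rep_univ y))"
definition "- x = mk_univ (\<lambda>R. \<ominus>\<^bsub>R\<^esub> dn R x) (- snd (Rep_univ x))"

lemma dn_ops:
  assumes "cring R"
  shows "dn R 0 = \<zero>\<^bsub>R\<^esub>" "dn R 1 = \<one>\<^bsub>R\<^esub>" "dn R (x + y) = dn R x \<oplus>\<^bsub>R\<^esub> dn R y"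
    "dn R (x * y) = dn R x \<otimes>\<^bsub>R\<^esub> dn R y" "dn R (x - y) = dn R x \<ominus>\<^bsub>R\<^esub> dn R y" "dn R (- x) = \<ominus>\<^bsub>R\<^esub> dn R x"
  using assms unfolding zero_univ_def one_univ_def plus_univ_def times_univ_def minus_univ_def uminus_univ_def
  by (subst dn_mk; auto intro: cring.cring_simprules dn_carrier)+

lemma snd_ops:
  "snd (Rep_univ (0 :: 'a univ)) = 0" "snd (Rep_univ (1 :: 'a univ)) = 1"
  "snd (Rep_univ (x + y)) = snd (Rep_univ x) + snd (Rep_univ y)"
  "snd (Rep_univ (x * y)) = snd (Rep_univ x) * snd (Rep_univ y)"
  "snd (Rep_univ (x - y)) = snd (Rep_univ x) - snd (Rep_univ y)" "snd (Rep_univ (- x)) = - snd (Rep_univ x)"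
  for x y :: "'a univ"
  unfolding zero_univ_def one_univ_def plus_univ_def times_univ_def minus_univ_def uminus_univ_def
  by (subst snd_mk; auto intro: cring.cring_simprules dn_carrier)+

instance
proof
  fix x y z :: "'a univ"
  show "x + y + z = x + (y + z)" by (rule univ_eqI) (simp_all add: dn_ops snd_ops dn_carrier cring.cring_simprules)
  show "x + y = y + x" by (rule univ_eqI) (simp_all add: dn_ops snd_ops dn_carrier cring.cring_simprules)
  show "0 + x = x" by (rule univ_eqI) (simp_all add: dn_ops snd_ops dn_carrier cring.cring_simprules)
  show "- x + x = 0" by (rule univ_eqI) (simp_all add: dn_ops snd_ops dn_carrier cring.cring_simprules)
  show "x - y = x + - y" by (rule univ_eqI) (simp_all add: dn_ops snd_ops dn_carrier cring.cring_simprules)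
  show "x * y * z = x * (y * z)" by (rule univ_eqI) (simp_all add: dn_ops snd_ops dn_carrier cring.cring_simprules)
  show "x * y = y * x" by (rule univ_eqI) (simp_all add: dn_ops snd_ops dn_carrier cring.cring_simprules)
  show "1 * x = x" by (rule univ_eqI) (simp_all add: dn_ops snd_ops dn_carrier cring.cring_simprules)
  show "(x + y) * z = x * z + y * z"
    by (rule univ_eqI) (simp_all add: dn_ops snd_ops dn_carrier cring.cring_simprules distrib_right)
  have "snd (Rep_univ (0 :: 'a univ)) \<noteq> snd (Rep_univ 1)" by (simp add: snd_ops)
  thus "(0 :: 'a univ) \<noteq> 1" by metis
qed

end

text \<open>A lift of \<open>a\<close>, with all other components \<open>0\<close>.\<close>
definition up :: "'b ring \<Rightarrow> 'b \<Rightarrow> 'b univ" where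
  "up R a = mk_univ (\<lambda>S. if S = R then a else \<zero>\<^bsub>S\<^esub>) 0"

lemma dn_up: "cring R \<Longrightarrow> a \<in> carrier R \<Longrightarrow> dn R (up R a) = a"
  unfolding up_def by (subst dn_mk) (auto intro: cring.cring_simprules)

lemma dn_power: "cring R \<Longrightarrow> dn R (x ^ n) = dn R x [^]\<^bsub>R\<^esub> n"
proof (induction n)
  case (Suc n)
  interpret cring R by fact
  show ?case using Suc dn_carrier[OF Suc.prems] by (simp add: dn_ops m_comm)
next
  case 0
  interpret cring R by fact
  show ?case using 0 by (simp add: dn_ops)
qed

lemma dn_minus_zero_iff: "cring R \<Longrightarrow> dn R (x - y) = \<zero>\<^bsub>R\<^esub> \<longleftrightarrow> dn R x = dn R y"
proof -
  assume R: "cring R"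
  then interpret cring R .
  show ?thesis using dn_carrier[OF R] by (simp add: dn_ops[OF R] r_right_minus_eq)
qed

lemma dn_hom_of_int:
  assumes "cring R" "cring S" "h \<in> ring_hom R S"
  shows "h (dn R (of_int m)) = dn S (of_int m)"
proof -
  interpret ring_hom_cring R S h using assms by (simp add: ring_hom_cring_def ring_hom_cring_axioms_def)
  have nat: "h (dn R (of_nat k)) = dn S (of_nat k)" for k
    by (induction k) (simp_all add: dn_ops assms dn_carrier)
  show ?thesis
    using nat by (cases m rule: int_cases2) (simp_all add: dn_ops assms dn_carrier)
qed

text \<open>
  An absolute value on a field given by a record becomes a multiplicative seminorm on the
  type; its kernel is that of the projection.
\<close>
lemma nonarch_absval_dn:
  assumes K: "field K" and v: "nonarch_absval K v"
  shows "nonarch_fld (\<lambda>x. v (dn K x))" "v (dn K x) = 0 \<longleftrightarrow> dn K x = \<zero>\<^bsub>K\<^esub>"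
proof -
  interpret field K by (rule K)
  have cr: "cring K" by (rule is_cring)
  note ops = dn_ops[OF cr] and car = dn_carrier[OF cr]
  have v0: "v \<zero>\<^bsub>K\<^esub> = 0" and vpos: "\<And>x. x \<in> carrier K \<Longrightarrow> x \<noteq> \<zero>\<^bsub>K\<^esub> \<Longrightarrow> v x > 0"
    and vmult: "\<And>x y. x \<in> carrier K \<Longrightarrow> y \<in> carrier K \<Longrightarrow> v (x \<otimes>\<^bsub>K\<^esub> y) = v x * v y"
    and vadd: "\<And>x y. x \<in> carrier K \<Longrightarrow> y \<in> carrier K \<Longrightarrow> v (x \<oplus>\<^bsub>K\<^esub> y) \<le> max (v x) (v y)"
    using v unfolding nonarch_absval_def by auto
  show zero: "v (dn K x) = 0 \<longleftrightarrow> dn K x = \<zero>\<^bsub>K\<^esub>" for x using v0 vpos[OF car[of x]] by fastforce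
  have "v \<one>\<^bsub>K\<^esub> * v \<one>\<^bsub>K\<^esub> = v \<one>\<^bsub>K\<^esub>" "v \<one>\<^bsub>K\<^esub> > 0" using vmult[of "\<one>\<^bsub>K\<^esub>" "\<one>\<^bsub>K\<^esub>"] vpos[of "\<one>\<^bsub>K\<^esub>"] by auto
  hence v1: "v \<one>\<^bsub>K\<^esub> = 1" by simp
  show "nonarch_fld (\<lambda>x. v (dn K x))"
  proof unfold_locales
    fix x y
    show "0 \<le> v (dn K x)" using v0 vpos[OF car[of x]] by (cases "dn K x = \<zero>\<^bsub>K\<^esub>") auto
    show "v (dn K 0) = 0" "v (dn K 1) = 1" using v0 v1 by (simp_all add: ops)
    show "v (dn K (x * y)) = v (dn K x) * v (dn K y)" by (simp add: ops vmult car)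
    show "v (dn K (x + y)) \<le> max (v (dn K x)) (v (dn K y))" by (simp add: ops vadd car)
    assume "v (dn K x) \<noteq> 0"
    hence "dn K x \<noteq> \<zero>\<^bsub>K\<^esub>" using zero by simp
    hence "dn K x \<in> Units K" using field_Units car by simp
    then obtain b where b: "b \<in> carrier K" "dn K x \<otimes>\<^bsub>K\<^esub> b = \<one>\<^bsub>K\<^esub>" using Units_r_inv_ex by blast
    have "dn K (x * up K b - 1) = \<zero>\<^bsub>K\<^esub>" using b by (simp add: ops dn_up[OF cr] car)
    thus "\<exists>y. v (dn K (x * y - 1)) = 0" using v0 by metis
  qed
qed

context nonarch_ring
begin

section \<open>Completions\<close>
lemma N_abs_diff: "\<bar>N x - N y\<bar> \<le> N (x - y)"
proof -
  have "N x \<le> max (N (x - y)) (N y)" "N y \<le> max (N (x - y)) (N x)"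
    using N_add[of "x - y" y] N_add[of "y - x" x] N_diff_commute[of x y] by simp_all
  thus ?thesis using N_nonneg[of x] N_nonneg[of y] N_nonneg[of "x - y"] by linarith
qed

lemma seq_cauchy_const: "seq_cauchy N (\<lambda>_. a)"
  by (simp add: seq_cauchy_def)

lemma seq_cauchy_diff:
  assumes "seq_cauchy N S" "seq_cauchy N T"
  shows "seq_cauchy N (\<lambda>n. S n - T n)"
  unfolding seq_cauchy_def
proof (intro allI impI)
  fix e :: real assume "e > 0"
  then obtain M1 M2 where M: "\<forall>m\<ge>M1. \<forall>n\<ge>M1. N (S m - S n) < e" "\<forall>m\<ge>M2. \<forall>n\<ge>M2. N (T m - T n) < e"
    using assms unfolding seq_cauchy_def by meson
  have "N ((S m - T m) - (S n - T n)) < e" if "m \<ge> max M1 M2" "n \<ge> max M1 M2" for m n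
  proof -
    have "(S m - T m) - (S n - T n) = (S m - S n) - (T m - T n)" by simp
    thus ?thesis using M that by (metis N_diff_less max.bounded_iff)
  qed
  thus "\<exists>M. \<forall>m\<ge>M. \<forall>n\<ge>M. N ((S m - T m) - (S n - T n)) < e" by blast
qed

lemma seq_cauchy_bounded:
  assumes "seq_cauchy N S" shows "\<exists>B>0. \<forall>n. N (S n) \<le> B"
proof -
  obtain M where M: "\<forall>m\<ge>M. \<forall>n\<ge>M. N (S m - S n) < 1" using assms unfolding seq_cauchy_def by (meson zero_less_one)
  define B where "B = Max (insert 1 ((\<lambda>n. N (S n)) ` {..M}))"
  have B: "1 \<le> B" "\<And>n. n \<le> M \<Longrightarrow> N (S n) \<le> B" unfolding B_def by (intro Max_ge; simp)+
  have "N (S n) \<le> B" for n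
  proof (cases "n \<le> M")
    case False
    hence "N (S n - S M) \<le> B" using M B(1) by (meson less_imp_le nle_le order_trans less_le_trans)
    thus ?thesis using N_add_le[of "S n - S M" B "S M"] B(2)[of M] by simp
  qed (use B in auto)
  thus ?thesis using B by (intro exI[of _ B]) auto
qed

lemma seq_cauchy_mult:
  assumes "seq_cauchy N S" "seq_cauchy N T"
  shows "seq_cauchy N (\<lambda>n. S n * T n)"
  unfolding seq_cauchy_def
proof (intro allI impI)
  fix e :: real assume e: "e > 0"
  obtain A B where AB: "A > 0" "\<And>n. N (S n) \<le> A" "B > 0" "\<And>n. N (T n) \<le> B"
    using seq_cauchy_bounded assms by meson
  obtain M1 M2 where M: "\<forall>m\<ge>M1. \<forall>n\<ge>M1. N (S m - S n) < e / B" "\<forall>m\<ge>M2. \<forall>n\<ge>M2. N (T m - T n) < e / A"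
    using assms e AB unfolding seq_cauchy_def by (meson divide_pos_pos)
  have "N (S m * T m - S n * T n) < e" if mn: "m \<ge> max M1 M2" "n \<ge> max M1 M2" for m n
  proof -
    have "N (S m - S n) * N (T m) \<le> N (S m - S n) * B" using AB by (intro mult_left_mono) auto
    also have "\<dots> < e" using M mn AB by (auto simp: pos_less_divide_eq)
    finally have 1: "N ((S m - S n) * T m) < e" by (simp add: N_mult)
    have "N (S n) * N (T m - T n) \<le> A * N (T m - T n)" using AB by (intro mult_right_mono) auto
    also have "\<dots> < e" using M mn AB by (auto simp: pos_less_divide_eq mult.commute)
    finally have 2: "N (S n * (T m - T n)) < e" by (simp add: N_mult)
    have "S m * T m - S n * T n = (S m - S n) * T m + S n * (T m - T n)" by (simp add: algebra_simps)
    thus ?thesis using N_add_less[OF 1 2] by simp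
  qed
  thus "\<exists>M. \<forall>m\<ge>M. \<forall>n\<ge>M. N (S m * T m - S n * T n) < e" by blast
qed

lemma seq_cauchy_norm_convergent:
  assumes "seq_cauchy N S" shows "\<exists>L. (\<lambda>n. N (S n)) \<longlonglongrightarrow> L"
proof -
  have "Cauchy (\<lambda>n. N (S n))" unfolding Cauchy_def dist_real_def
    using assms N_abs_diff unfolding seq_cauchy_def by (meson le_less_trans)
  thus ?thesis using real_Cauchy_convergent convergent_def by blast
qed

lemma N_limit:
  assumes "(\<lambda>n. N (S n - y)) \<longlonglongrightarrow> 0"
  shows "(\<lambda>n. N (S n)) \<longlonglongrightarrow> N y"
proof -
  have "(\<lambda>n. N (S n) - N y) \<longlonglongrightarrow> 0"
    by (rule Lim_null_comparison[OF _ assms]) (use N_abs_diff in auto)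
  thus ?thesis by (simp add: LIM_zero_iff)
qed

end

text \<open>
  Elements of the completion of a valued field are handled through Cauchy sequences in the
  type \<open>'k univ\<close>, where ring arithmetic is available pointwise.
\<close>
locale valued_field =
  fixes K :: "'k ring" and v :: "'k \<Rightarrow> real"
  assumes K: "field K" and absval: "nonarch_absval K v"
begin

lemma cr: "cring K"
proof -
  interpret field K by (rule K)
  show ?thesis by (rule is_cring)
qed

abbreviation V :: "'k univ \<Rightarrow> real" where "V x \<equiv> v (dn K x)"

sublocale V: nonarch_fld V by (rule nonarch_absval_dn[OF K absval])

abbreviation "CR \<equiv> cauchy_ring K v"
abbreviation "NS \<equiv> null_sequences K v"
abbreviation "CQ \<equiv> place_completion K v"

text \<open>The sequence in \<open>K\<close> that a sequence of lifts represents.\<close>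
definition sq :: "(nat \<Rightarrow> 'k univ) \<Rightarrow> nat \<Rightarrow> 'k" where "sq S n = dn K (S n)"

lemma carrier_CR: "x \<in> carrier CR \<longleftrightarrow> (\<exists>S. x = sq S \<and> seq_cauchy V S)"
proof
  assume x: "x \<in> carrier CR"
  hence xK: "x n \<in> carrier K" for n by (simp add: cauchy_ring_def)
  have "x = sq (\<lambda>n. up K (x n))" using xK by (auto simp: sq_def dn_up[OF cr])
  moreover have "seq_cauchy V (\<lambda>n. up K (x n))"
    using x xK by (simp add: seq_cauchy_def cauchy_ring_def dn_ops[OF cr] dn_up[OF cr])
  ultimately show "\<exists>S. x = sq S \<and> seq_cauchy V S" by blast
next
  assume "\<exists>S. x = sq S \<and> seq_cauchy V S"
  then obtain S where "x = sq S" "seq_cauchy V S" by blast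
  thus "x \<in> carrier CR"
    unfolding seq_cauchy_def by (simp add: cauchy_ring_def sq_def dn_carrier[OF cr] dn_ops[OF cr, symmetric])
qed

lemma sq_in_CR: "seq_cauchy V S \<Longrightarrow> sq S \<in> carrier CR"
  using carrier_CR by blast

lemma CR_in: "x \<in> carrier CR \<Longrightarrow> x n \<in> carrier K"
  by (simp add: cauchy_ring_def)

lemma CR_ops: "sq S \<otimes>\<^bsub>CR\<^esub> sq T = sq (\<lambda>n. S n * T n)" "sq S \<oplus>\<^bsub>CR\<^esub> sq T = sq (\<lambda>n. S n + T n)"
  "\<one>\<^bsub>CR\<^esub> = sq (\<lambda>_. 1)" "\<zero>\<^bsub>CR\<^esub> = sq (\<lambda>_. 0)"
  by (auto simp: cauchy_ring_def sq_def dn_ops[OF cr])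

lemma V_add: "seq_cauchy V S \<Longrightarrow> seq_cauchy V T \<Longrightarrow> seq_cauchy V (\<lambda>n. S n + T n)"
  using V.seq_cauchy_diff[of S "\<lambda>n. 0 - T n"] V.seq_cauchy_diff[OF V.seq_cauchy_const[of 0], of T] by simp

lemma CR_cring: "cring CR"
proof (rule cringI)
  show "abelian_group CR"
  proof (rule abelian_groupI)
    fix x y z assume "x \<in> carrier CR" "y \<in> carrier CR" "z \<in> carrier CR"
    then obtain S T U where "x = sq S" "y = sq T" "z = sq U" and c: "seq_cauchy V S" "seq_cauchy V T"
      unfolding carrier_CR by blast
    thus "x \<oplus>\<^bsub>CR\<^esub> y \<in> carrier CR" "x \<oplus>\<^bsub>CR\<^esub> y \<oplus>\<^bsub>CR\<^esub> z = x \<oplus>\<^bsub>CR\<^esub> (y \<oplus>\<^bsub>CR\<^esub> z)"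
      "x \<oplus>\<^bsub>CR\<^esub> y = y \<oplus>\<^bsub>CR\<^esub> x" "\<zero>\<^bsub>CR\<^esub> \<oplus>\<^bsub>CR\<^esub> x = x"
      by (auto simp: CR_ops add_ac intro: sq_in_CR V_add)
    have "sq (\<lambda>n. 0 - S n) \<oplus>\<^bsub>CR\<^esub> x = \<zero>\<^bsub>CR\<^esub>" using \<open>x = sq S\<close> by (simp add: CR_ops)
    moreover have "sq (\<lambda>n. 0 - S n) \<in> carrier CR"
      using c by (intro sq_in_CR V.seq_cauchy_diff V.seq_cauchy_const)
    ultimately show "\<exists>y\<in>carrier CR. y \<oplus>\<^bsub>CR\<^esub> x = \<zero>\<^bsub>CR\<^esub>" by blast
  next
    show "\<zero>\<^bsub>CR\<^esub> \<in> carrier CR" by (simp add: CR_ops sq_in_CR V.seq_cauchy_const)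
  qed
  show "comm_monoid CR"
  proof (rule comm_monoidI)
    fix x y z assume "x \<in> carrier CR" "y \<in> carrier CR" "z \<in> carrier CR"
    then obtain S T U where "x = sq S" "y = sq T" "z = sq U" and c: "seq_cauchy V S" "seq_cauchy V T"
      unfolding carrier_CR by blast
    thus "x \<otimes>\<^bsub>CR\<^esub> y \<in> carrier CR" "x \<otimes>\<^bsub>CR\<^esub> y \<otimes>\<^bsub>CR\<^esub> z = x \<otimes>\<^bsub>CR\<^esub> (y \<otimes>\<^bsub>CR\<^esub> z)"
      "x \<otimes>\<^bsub>CR\<^esub> y = y \<otimes>\<^bsub>CR\<^esub> x" "\<one>\<^bsub>CR\<^esub> \<otimes>\<^bsub>CR\<^esub> x = x"
      by (auto simp: CR_ops mult_ac intro: sq_in_CR V.seq_cauchy_mult)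
  next
    show "\<one>\<^bsub>CR\<^esub> \<in> carrier CR" by (simp add: CR_ops sq_in_CR V.seq_cauchy_const)
  qed
  fix x y z assume "x \<in> carrier CR" "y \<in> carrier CR" "z \<in> carrier CR"
  then obtain S T U where "x = sq S" "y = sq T" "z = sq U" unfolding carrier_CR by blast
  thus "(x \<oplus>\<^bsub>CR\<^esub> y) \<otimes>\<^bsub>CR\<^esub> z = x \<otimes>\<^bsub>CR\<^esub> z \<oplus>\<^bsub>CR\<^esub> y \<otimes>\<^bsub>CR\<^esub> z" by (simp add: CR_ops distrib_right)
qed

sublocale CR: cring CR by (rule CR_cring)

lemma CR_uminus: "seq_cauchy V S \<Longrightarrow> \<ominus>\<^bsub>CR\<^esub> sq S = sq (\<lambda>n. - S n)"
proof (rule CR.minus_equality)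
  assume S: "seq_cauchy V S"
  show "sq (\<lambda>n. - S n) \<in> carrier CR"
    using sq_in_CR[OF V.seq_cauchy_diff[OF V.seq_cauchy_const[of 0] S]] by simp
qed (auto simp: CR_ops sq_in_CR)

lemma CR_minus: "seq_cauchy V S \<Longrightarrow> seq_cauchy V T \<Longrightarrow> sq S \<ominus>\<^bsub>CR\<^esub> sq T = sq (\<lambda>n. S n - T n)"
  by (simp add: a_minus_def CR_uminus CR_ops)

lemma NS_iff: "seq_cauchy V S \<Longrightarrow> sq S \<in> NS \<longleftrightarrow> (\<lambda>n. V (S n)) \<longlonglongrightarrow> 0"
  by (simp add: null_sequences_def sq_in_CR) (simp add: sq_def)

lemma NS_CR: "x \<in> NS \<Longrightarrow> x \<in> carrier CR"
  by (simp add: null_sequences_def)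

lemma NS_ideal: "ideal NS CR"
proof (rule idealI[OF CR.ring_axioms])
  have lim: "(\<lambda>n. V (S n - T n)) \<longlonglongrightarrow> 0" if "(\<lambda>n. V (S n)) \<longlonglongrightarrow> 0" "(\<lambda>n. V (T n)) \<longlonglongrightarrow> 0" for S T
    by (rule tendsto_sandwich[OF _ _ tendsto_const])
       (use V.N_diff tendsto_max[OF that] in auto)
  have diff: "x \<ominus>\<^bsub>CR\<^esub> y \<in> NS" if h: "x \<in> NS" "y \<in> NS" for x y
  proof -
    obtain S T where S: "x = sq S" "seq_cauchy V S" and T: "y = sq T" "seq_cauchy V T"
      using NS_CR[OF h(1)] NS_CR[OF h(2)] unfolding carrier_CR by blast
    show ?thesis using h lim[of S T] V.seq_cauchy_diff[OF S(2) T(2)] by (simp add: S T CR_minus NS_iff)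
  qed
  have zero: "\<zero>\<^bsub>CR\<^esub> \<in> NS" by (simp add: CR_ops NS_iff V.seq_cauchy_const)
  show "subgroup NS (add_monoid CR)"
  proof (rule group.subgroupI)
    show "group (add_monoid CR)" by (rule CR.a_group)
    show "NS \<subseteq> carrier (add_monoid CR)" using NS_CR by auto
    show "NS \<noteq> {}" using zero by blast
    have neg: "\<ominus>\<^bsub>CR\<^esub> x \<in> NS" if "x \<in> NS" for x using diff[OF zero that] NS_CR[OF that] by (simp add: a_minus_def)
    show "inv\<^bsub>add_monoid CR\<^esub> x \<in> NS" if "x \<in> NS" for x using neg[OF that] by (simp add: a_inv_def)
    show "x \<otimes>\<^bsub>add_monoid CR\<^esub> y \<in> NS" if "x \<in> NS" "y \<in> NS" for x y
      using diff[OF that(1) neg[OF that(2)]] NS_CR that by (simp add: a_minus_def)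
  qed
  fix a x assume ax: "a \<in> NS" "x \<in> carrier CR"
  obtain S T where S: "a = sq S" "seq_cauchy V S" and T: "x = sq T" "seq_cauchy V T"
    using ax NS_CR carrier_CR by meson
  obtain B where B: "B > 0" "\<And>n. V (T n) \<le> B" using V.seq_cauchy_bounded[OF T(2)] by blast
  have "(\<lambda>n. V (S n)) \<longlonglongrightarrow> 0" using ax(1) S by (simp add: NS_iff)
  hence "(\<lambda>n. V (S n) * B) \<longlonglongrightarrow> 0" by (rule tendsto_mult_left_zero)
  hence "(\<lambda>n. V (S n * T n)) \<longlonglongrightarrow> 0"
    by (rule tendsto_sandwich[OF _ _ tendsto_const, rotated 2])
       (auto simp: V.N_mult intro!: mult_left_mono B always_eventually)
  hence aT: "a \<otimes>\<^bsub>CR\<^esub> x \<in> NS" using V.seq_cauchy_mult[OF S(2) T(2)] by (simp add: S T CR_ops NS_iff)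
  thus "a \<otimes>\<^bsub>CR\<^esub> x \<in> NS" .
  show "x \<otimes>\<^bsub>CR\<^esub> a \<in> NS" using aT ax NS_CR CR.m_comm by metis
qed

sublocale NS: ideal NS CR by (rule NS_ideal)

lemma CQ_ring: "ring CQ" unfolding place_completion_def by (rule NS.quotient_is_ring)
lemma CQ_cring: "cring CQ" unfolding place_completion_def by (rule NS.quotient_is_cring[OF CR_cring])

text \<open>The element of the completion that a Cauchy sequence of lifts represents.\<close>
definition cls :: "(nat \<Rightarrow> 'k univ) \<Rightarrow> (nat \<Rightarrow> 'k) set" where "cls S = NS +>\<^bsub>CR\<^esub> sq S"

lemma rcos_hom: "(+>\<^bsub>CR\<^esub>) NS \<in> ring_hom CR CQ"
  using NS.rcos_ring_hom unfolding place_completion_def .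

lemma carrier_CQ: "A \<in> carrier CQ \<longleftrightarrow> (\<exists>S. seq_cauchy V S \<and> A = cls S)"
  unfolding place_completion_def FactRing_def A_RCOSETS_def' cls_def using carrier_CR by auto

lemma cls_ops:
  assumes "seq_cauchy V S" "seq_cauchy V T"
  shows "cls S \<oplus>\<^bsub>CQ\<^esub> cls T = cls (\<lambda>n. S n + T n)" "cls S \<otimes>\<^bsub>CQ\<^esub> cls T = cls (\<lambda>n. S n * T n)"
  using ring_hom_add[OF rcos_hom, of "sq S" "sq T"] ring_hom_mult[OF rcos_hom, of "sq S" "sq T"] assms
  by (simp_all add: sq_in_CR cls_def CR_ops)

lemma cls_one: "\<one>\<^bsub>CQ\<^esub> = cls (\<lambda>_. 1)"
  using ring_hom_one[OF rcos_hom] by (simp add: cls_def CR_ops)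

lemma cls_zero: "\<zero>\<^bsub>CQ\<^esub> = cls (\<lambda>_. 0)"
  using ring_hom_zero[OF rcos_hom CR.ring_axioms CQ_ring] by (simp add: cls_def CR_ops)

lemma cls_in: "seq_cauchy V S \<Longrightarrow> cls S \<in> carrier CQ"
  using carrier_CQ by blast

lemma cls_eq:
  assumes "seq_cauchy V S" "seq_cauchy V T"
  shows "cls S = cls T \<longleftrightarrow> (\<lambda>n. V (S n - T n)) \<longlonglongrightarrow> 0"
proof -
  have "cls S = cls T \<longleftrightarrow> sq S \<ominus>\<^bsub>CR\<^esub> sq T \<in> NS"
    unfolding cls_def using CR.quotient_eq_iff_same_a_r_cos[OF NS_ideal sq_in_CR[OF assms(1)] sq_in_CR[OF assms(2)]] by blast
  thus ?thesis using assms by (simp add: CR_minus NS_iff V.seq_cauchy_diff)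
qed

lemma cls_uminus: "seq_cauchy V S \<Longrightarrow> \<ominus>\<^bsub>CQ\<^esub> cls S = cls (\<lambda>n. - S n)"
proof -
  interpret Q: cring CQ by (rule CQ_cring)
  assume S: "seq_cauchy V S"
  have S': "seq_cauchy V (\<lambda>n. - S n)" using V.seq_cauchy_diff[OF V.seq_cauchy_const[of 0] S] by simp
  show ?thesis by (rule Q.minus_equality) (auto simp: cls_ops S S' cls_zero cls_in)
qed

lemma cls_minus: "seq_cauchy V S \<Longrightarrow> seq_cauchy V T \<Longrightarrow> cls S \<ominus>\<^bsub>CQ\<^esub> cls T = cls (\<lambda>n. S n - T n)"
  using V.seq_cauchy_diff[OF V.seq_cauchy_const[of 0], of T] by (simp add: a_minus_def cls_uminus cls_ops)

abbreviation "absQ \<equiv> completion_absval v"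

lemma absQ_cls:
  assumes S: "seq_cauchy V S"
  shows "(\<lambda>n. V (S n)) \<longlonglongrightarrow> absQ (cls S)"
proof -
  obtain L where L: "(\<lambda>n. V (S n)) \<longlonglongrightarrow> L" using V.seq_cauchy_norm_convergent[OF S] by blast
  have mem: "sq S \<in> cls S" unfolding cls_def using NS.a_rcos_self[OF sq_in_CR[OF S]] .
  have "absQ (cls S) = L" unfolding completion_absval_def
  proof (rule the_equality)
    show "\<forall>x\<in>cls S. (\<lambda>n. v (x n)) \<longlonglongrightarrow> L"
    proof
      fix x assume "x \<in> cls S"
      then obtain i where i: "i \<in> NS" "x = i \<oplus>\<^bsub>CR\<^esub> sq S" unfolding cls_def a_r_coset_def' by blast
      obtain T where T: "i = sq T" "seq_cauchy V T" using i NS_CR carrier_CR by meson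
      have "(\<lambda>n. V ((T n + S n) - S n)) \<longlonglongrightarrow> 0" using i T by (simp add: NS_iff)
      hence "(\<lambda>n. V (T n + S n) - V (S n)) \<longlonglongrightarrow> 0"
        by (rule Lim_null_comparison[rotated])
           (auto intro!: always_eventually simp: V.N_abs_diff[of "T n + S n" "S n" for n, simplified])
      from tendsto_add[OF this L] have "(\<lambda>n. V (T n + S n)) \<longlonglongrightarrow> L" by simp
      thus "(\<lambda>n. v (x n)) \<longlonglongrightarrow> L" using i T by (simp add: CR_ops sq_def)
    qed
    fix r assume "\<forall>x\<in>cls S. (\<lambda>n. v (x n)) \<longlonglongrightarrow> r"
    hence "(\<lambda>n. V (S n)) \<longlonglongrightarrow> r" using mem by (force simp: sq_def)
    thus "r = L" using L LIMSEQ_unique by blast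
  qed
  thus ?thesis using L by simp
qed

lemma absQ_nonarch: "nonarch_absval CQ absQ"
  unfolding nonarch_absval_def
proof (intro conjI ballI impI)
  have nonneg: "0 \<le> absQ (cls S)" if "seq_cauchy V S" for S
    using LIMSEQ_le_const[OF absQ_cls[OF that]] by auto
  have z: "absQ (cls (\<lambda>_. 0)) = 0"
    using LIMSEQ_unique[OF absQ_cls[OF V.seq_cauchy_const, of 0]] by simp
  thus "absQ \<zero>\<^bsub>CQ\<^esub> = 0" by (simp add: cls_zero)
  fix A assume "A \<in> carrier CQ"
  then obtain S where S: "seq_cauchy V S" "A = cls S" using carrier_CQ by blast
  show "0 < absQ A" if "A \<noteq> \<zero>\<^bsub>CQ\<^esub>"
  proof (rule ccontr)
    assume "\<not> ?thesis"
    hence "absQ A = 0" using nonneg[OF S(1)] S(2) by simp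
    hence "(\<lambda>n. V (S n - 0)) \<longlonglongrightarrow> 0" using absQ_cls[OF S(1)] S(2) by simp
    hence "A = \<zero>\<^bsub>CQ\<^esub>" using cls_eq[OF S(1) V.seq_cauchy_const[of 0]] by (simp add: cls_zero S)
    thus False using that by simp
  qed
  fix B assume "B \<in> carrier CQ"
  then obtain T where T: "seq_cauchy V T" "B = cls T" using carrier_CQ by blast
  have "(\<lambda>n. V (S n * T n)) \<longlonglongrightarrow> absQ A * absQ B"
    unfolding V.N_mult S T by (intro tendsto_mult absQ_cls S T)
  thus "absQ (A \<otimes>\<^bsub>CQ\<^esub> B) = absQ A * absQ B"
    using LIMSEQ_unique[OF absQ_cls[OF V.seq_cauchy_mult[OF S(1) T(1)]]] by (simp add: S T cls_ops)
  have "(\<lambda>n. max (V (S n)) (V (T n))) \<longlonglongrightarrow> max (absQ A) (absQ B)"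
    unfolding S T by (intro tendsto_max absQ_cls S T)
  thus "absQ (A \<oplus>\<^bsub>CQ\<^esub> B) \<le> max (absQ A) (absQ B)"
    using LIMSEQ_le[OF absQ_cls[OF V_add[OF S(1) T(1)]]] V.N_add by (fastforce simp: S T cls_ops)
qed

lemma absQ_const: "absQ (cls (\<lambda>_. a)) = V a"
  using LIMSEQ_unique[OF absQ_cls[OF V.seq_cauchy_const, of a]] by simp

lemma absQ_tail:
  assumes S: "seq_cauchy V S" and e: "e > 0"
  shows "\<exists>M. \<forall>m\<ge>M. absQ (cls S \<ominus>\<^bsub>CQ\<^esub> cls (\<lambda>_. S m)) < e"
proof -
  obtain M where M: "\<forall>m\<ge>M. \<forall>n\<ge>M. V (S m - S n) < e / 2"
    using S e unfolding seq_cauchy_def by (meson half_gt_zero)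
  have "absQ (cls S \<ominus>\<^bsub>CQ\<^esub> cls (\<lambda>_. S m)) \<le> e / 2" if "m \<ge> M" for m
  proof -
    have c: "seq_cauchy V (\<lambda>n. S n - S m)" by (intro V.seq_cauchy_diff S V.seq_cauchy_const)
    have "absQ (cls (\<lambda>n. S n - S m)) \<le> e / 2"
      by (rule LIMSEQ_le_const2[OF absQ_cls[OF c]]) (use M that in \<open>auto intro!: exI[of _ M] less_imp_le\<close>)
    thus ?thesis using S by (simp add: cls_minus V.seq_cauchy_const)
  qed
  thus ?thesis using e by (intro exI[of _ M]) fastforce
qed

text \<open>
  The limit is the class of a sequence \<open>a\<close> in \<open>K\<close> whose \<open>n\<close>-th term is within \<open>1 / (n + 1)\<close>
  of \<open>A n\<close>.
\<close>
lemma CQ_complete: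
  assumes A: "\<And>n. A n \<in> carrier CQ"
    and cau: "\<And>e. e > 0 \<Longrightarrow> \<exists>M. \<forall>m\<ge>M. \<forall>n\<ge>M. absQ (A m \<ominus>\<^bsub>CQ\<^esub> A n) < e"
  shows "\<exists>B\<in>carrier CQ. (\<lambda>n. absQ (A n \<ominus>\<^bsub>CQ\<^esub> B)) \<longlonglongrightarrow> 0"
proof -
  interpret Q: cring CQ by (rule CQ_cring)
  note aQ = absQ_nonarch[unfolded nonarch_absval_def]
  have m1: "absQ (\<ominus>\<^bsub>CQ\<^esub> x) = absQ x" if h: "x \<in> carrier CQ" for x
  proof -
    obtain S where S: "seq_cauchy V S" "x = cls S" using h carrier_CQ by blast
    have "(\<lambda>n. V (- S n)) \<longlonglongrightarrow> absQ (cls (\<lambda>n. - S n))"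
      using absQ_cls[of "\<lambda>n. - S n"] V.seq_cauchy_diff[OF V.seq_cauchy_const[of 0] S(1)] by simp
    thus ?thesis using LIMSEQ_unique[OF absQ_cls[OF S(1)]] S by (simp add: cls_uminus)
  qed
  have tri: "absQ (x \<ominus>\<^bsub>CQ\<^esub> z) \<le> max (absQ (x \<ominus>\<^bsub>CQ\<^esub> y)) (absQ (y \<ominus>\<^bsub>CQ\<^esub> z))"
    if h: "x \<in> carrier CQ" "y \<in> carrier CQ" "z \<in> carrier CQ" for x y z
  proof -
    obtain S T U where "seq_cauchy V S" "x = cls S" "seq_cauchy V T" "y = cls T" "seq_cauchy V U" "z = cls U"
      using h unfolding carrier_CQ by blast
    hence "x \<ominus>\<^bsub>CQ\<^esub> z = (x \<ominus>\<^bsub>CQ\<^esub> y) \<oplus>\<^bsub>CQ\<^esub> (y \<ominus>\<^bsub>CQ\<^esub> z)"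
      by (simp add: cls_minus cls_ops V.seq_cauchy_diff)
    thus ?thesis using aQ h by simp
  qed
  have comm: "absQ (x \<ominus>\<^bsub>CQ\<^esub> y) = absQ (y \<ominus>\<^bsub>CQ\<^esub> x)" if "x \<in> carrier CQ" "y \<in> carrier CQ" for x y
  proof -
    have "x \<ominus>\<^bsub>CQ\<^esub> y = \<ominus>\<^bsub>CQ\<^esub> (y \<ominus>\<^bsub>CQ\<^esub> x)"
      using that by (simp add: a_minus_def Q.minus_add Q.a_comm)
    thus ?thesis using m1[of "y \<ominus>\<^bsub>CQ\<^esub> x"] that by simp
  qed
  have "\<exists>a. absQ (A n \<ominus>\<^bsub>CQ\<^esub> cls (\<lambda>_. a)) < inverse (real (Suc n))" for n
  proof -
    obtain S where S: "seq_cauchy V S" "A n = cls S" using A carrier_CQ by blast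
    show ?thesis using absQ_tail[OF S(1), of "inverse (real (Suc n))"] S(2) by auto
  qed
  then obtain a where a: "\<And>n. absQ (A n \<ominus>\<^bsub>CQ\<^esub> cls (\<lambda>_. a n)) < inverse (real (Suc n))" by metis
  have kin: "cls (\<lambda>_. b) \<in> carrier CQ" for b by (simp add: cls_in V.seq_cauchy_const)
  have small: "\<exists>M. \<forall>n\<ge>M. absQ (A n \<ominus>\<^bsub>CQ\<^esub> cls (\<lambda>_. a n)) < e" if h: "e > 0" for e
  proof -
    obtain M where M: "inverse (real (Suc M)) < e" using reals_Archimedean[OF h] by blast
    have "absQ (A n \<ominus>\<^bsub>CQ\<^esub> cls (\<lambda>_. a n)) < e" if "n \<ge> M" for n
    proof -
      have "inverse (real (Suc n)) \<le> inverse (real (Suc M))" using that by (intro le_imp_inverse_le) auto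
      thus ?thesis using a[of n] M by linarith
    qed
    thus ?thesis by blast
  qed
  have S: "seq_cauchy V a" unfolding seq_cauchy_def
  proof (intro allI impI)
    fix e :: real assume e: "e > 0"
    obtain M1 where M1: "\<forall>n\<ge>M1. absQ (A n \<ominus>\<^bsub>CQ\<^esub> cls (\<lambda>_. a n)) < e" using small[OF e] by blast
    obtain M2 where M2: "\<forall>m\<ge>M2. \<forall>n\<ge>M2. absQ (A m \<ominus>\<^bsub>CQ\<^esub> A n) < e" using cau[OF e] by blast
    have "V (a m - a n) < e" if mn: "m \<ge> max M1 M2" "n \<ge> max M1 M2" for m n
    proof -
      have "absQ (cls (\<lambda>_. a m) \<ominus>\<^bsub>CQ\<^esub> A n) < e"
        using tri[OF kin A A, of "a m" n m] comm[OF kin A, of "a m" m] M1[rule_format, of m] M2[rule_format, of m n] mn by simp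
      hence "absQ (cls (\<lambda>_. a m) \<ominus>\<^bsub>CQ\<^esub> cls (\<lambda>_. a n)) < e"
        using tri[OF kin A kin, of "a m" "a n" n] M1[rule_format, of n] mn by simp
      thus ?thesis by (simp add: cls_minus V.seq_cauchy_const absQ_const[of "a m - a n"])
    qed
    thus "\<exists>M. \<forall>m\<ge>M. \<forall>n\<ge>M. V (a m - a n) < e" by blast
  qed
  have "(\<lambda>n. absQ (A n \<ominus>\<^bsub>CQ\<^esub> cls a)) \<longlonglongrightarrow> 0"
  proof (rule LIMSEQ_I)
    fix e :: real assume e: "e > 0"
    obtain M1 where M1: "\<forall>n\<ge>M1. absQ (A n \<ominus>\<^bsub>CQ\<^esub> cls (\<lambda>_. a n)) < e" using small[OF e] by blast
    obtain M2 where M2: "\<forall>m\<ge>M2. absQ (cls a \<ominus>\<^bsub>CQ\<^esub> cls (\<lambda>_. a m)) < e" using absQ_tail[OF S e] by blast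
    have nn: "0 \<le> absQ x" if "x \<in> carrier CQ" for x using aQ that by (cases "x = \<zero>\<^bsub>CQ\<^esub>") (auto intro: less_imp_le)
    have "absQ (A n \<ominus>\<^bsub>CQ\<^esub> cls a) < e" if n: "n \<ge> max M1 M2" for n
      using tri[OF A kin cls_in[OF S], of n "a n"] comm[OF kin cls_in[OF S], of "a n"]
        M1[rule_format, of n] M2[rule_format, of n] n by simp
    thus "\<exists>M. \<forall>n\<ge>M. norm (absQ (A n \<ominus>\<^bsub>CQ\<^esub> cls a) - 0) < e"
      using nn A cls_in[OF S] by (intro exI[of _ "max M1 M2"]) auto
  qed
  thus ?thesis using cls_in[OF S] by blast
qed

lemma const_hom: "(\<lambda>a. cls (\<lambda>_. up K a)) \<in> ring_hom K CQ"
proof -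
  have eq: "cls (\<lambda>_. x) = cls (\<lambda>_. y)" if "dn K x = dn K y" for x y
    unfolding cls_def sq_def using that by simp
  note dc = dn_carrier[OF cr] and ops = dn_ops[OF cr] and du = dn_up[OF cr]
  interpret cring K by (rule cr)
  show ?thesis
    by (rule ring_hom_memI) (auto simp: cls_in V.seq_cauchy_const cls_ops cls_one intro!: eq, simp_all add: ops du)
qed

end

section \<open>The p-adic absolute value\<close>
lemma padic_absval_fraction:
  assumes p: "Factorial_Ring.prime (p :: nat)" and ab: "a \<noteq> 0" "b \<noteq> 0"
  shows "padic_absval p (of_int a / of_int b) = real p powi (int (multiplicity (int p) b) - int (multiplicity (int p) a))"
proof -
  obtain c d where q: "quotient_of (of_int a / of_int b) = (c, d)" by (cases "quotient_of (of_int a / of_int b :: rat)")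
  have d: "d > 0" using quotient_of_denom_pos[OF q] .
  have eq: "(of_int a / of_int b :: rat) = of_int c / of_int d" using quotient_of_div[OF q] .
  hence "(of_int (a * d) :: rat) = of_int (c * b)" using ab d by (simp add: field_simps)
  hence e: "a * d = c * b" by (simp only: of_int_eq_iff)
  have c: "c \<noteq> 0" using e ab d by auto
  have pp: "prime_elem (int p)" using p by simp
  have "multiplicity (int p) a + multiplicity (int p) d = multiplicity (int p) c + multiplicity (int p) b"
    using arg_cong[OF e, of "multiplicity (int p)"] ab c d by (simp add: prime_elem_multiplicity_mult_distrib[OF pp])
  hence "int (multiplicity (int p) d) - int (multiplicity (int p) c) = int (multiplicity (int p) b) - int (multiplicity (int p) a)"
    by linarith
  moreover have "(of_int a / of_int b :: rat) \<noteq> 0" using ab by simp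
  ultimately show ?thesis unfolding padic_absval_def q by simp
qed

lemma padic_absval_unit_denominator:
  assumes p: "Factorial_Ring.prime p" and q: "padic_absval p q \<le> 1"
  shows "\<exists>r m. q = of_int r / of_int m \<and> m \<noteq> 0 \<and> padic_absval p (of_int m) = 1"
proof (cases "q = 0")
  case True
  thus ?thesis using padic_absval_fraction[OF p, of 1 1] by (intro exI[of _ 0] exI[of _ 1]) auto
next
  case False
  have p1: "real p > 1" using prime_gt_1_nat[OF p] by simp
  have pu: "\<not> is_unit (int p)" using p by auto
  obtain c d where qq: "quotient_of q = (c, d)" by (cases "quotient_of q")
  have d: "d > 0" and cop: "coprime c d" and zq: "q = of_int c / of_int d"
    using quotient_of_denom_pos[OF qq] quotient_of_coprime[OF qq] quotient_of_div[OF qq] by auto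
  have c0: "c \<noteq> 0" using False zq by auto
  have "multiplicity (int p) d \<le> multiplicity (int p) c"
  proof (rule ccontr)
    assume "\<not> ?thesis"
    hence "real p powi 0 < real p powi (int (multiplicity (int p) d) - int (multiplicity (int p) c))"
      using p1 by (intro power_int_strict_increasing) auto
    thus False using q padic_absval_fraction[OF p c0, of d] d zq by simp
  qed
  moreover have "multiplicity (int p) c = 0 \<or> multiplicity (int p) d = 0"
  proof (rule ccontr)
    assume "\<not> ?thesis"
    hence "int p dvd c" "int p dvd d" by (metis not_dvd_imp_multiplicity_0)+
    hence "is_unit (int p)" using cop coprime_common_divisor by blast
    thus False using pu by simp
  qed
  ultimately have d0: "multiplicity (int p) d = 0" by linarith
  have "padic_absval p (of_int d) = 1" using padic_absval_fraction[OF p, of d 1] d d0 by simp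
  moreover have "d \<noteq> 0" using d by simp
  ultimately show ?thesis using zq by blast
qed

lemma padic_absval_nonarch:
  assumes p: "Factorial_Ring.prime (p :: nat)"
  shows "nonarch_absval (ring_of_type_algebra :: rat ring) (padic_absval p)"
proof -
  have p1: "real p > 1" using prime_gt_1_nat[OF p] by simp
  have pp: "prime_elem (int p)" using p by simp
  have frac: "\<exists>a b. b \<noteq> 0 \<and> x = of_int a / of_int b \<and> (x \<noteq> 0 \<longrightarrow> a \<noteq> 0)" for x :: rat
  proof -
    obtain c d where q: "quotient_of x = (c, d)" by (cases "quotient_of x")
    show ?thesis using quotient_of_div[OF q] quotient_of_denom_pos[OF q] by (intro exI[of _ c] exI[of _ d]) auto
  qed
  have pos: "padic_absval p x > 0" if "x \<noteq> 0" for x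
    using that p1 by (auto simp: padic_absval_def)
  have zero: "padic_absval p 0 = 0" by (simp add: padic_absval_def)
  have mult: "padic_absval p (x * y) = padic_absval p x * padic_absval p y" for x y
  proof (cases "x = 0 \<or> y = 0")
    case False
    then obtain a b c d where xy: "b \<noteq> 0" "x = of_int a / of_int b" "a \<noteq> 0" "d \<noteq> 0" "y = of_int c / of_int d" "c \<noteq> 0"
      using frac[of x] frac[of y] by blast
    have "x * y = of_int (a * c) / of_int (b * d)" using xy by simp
    hence "padic_absval p (x * y) = real p powi (int (multiplicity (int p) (b * d)) - int (multiplicity (int p) (a * c)))"
      using padic_absval_fraction[OF p, of "a * c" "b * d"] xy by simp
    also have "\<dots> = real p powi ((int (multiplicity (int p) b) - int (multiplicity (int p) a)) + (int (multiplicity (int p) d) - int (multiplicity (int p) c)))"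
      using xy by (simp add: prime_elem_multiplicity_mult_distrib[OF pp] algebra_simps)
    also have "\<dots> = padic_absval p x * padic_absval p y"
      using xy padic_absval_fraction[OF p] p1 by (simp add: power_int_add)
    finally show ?thesis .
  qed (auto simp: zero)
  have int1: "padic_absval p (of_int m) \<le> 1" for m
  proof (cases "m = 0")
    case False
    have "padic_absval p (of_int m) = real p powi (- int (multiplicity (int p) m))"
      using padic_absval_fraction[OF p False, of 1] by simp
    also have "\<dots> \<le> real p powi 0" using p1 by (intro power_int_increasing) auto
    finally show ?thesis by simp
  qed (simp add: zero)
  have add1: "padic_absval p (1 + z) \<le> 1" if z: "padic_absval p z \<le> 1" for z
  proof (cases "z = 0")
    case False
    obtain c d where zq: "z = of_int c / of_int d" and d: "d \<noteq> 0" "padic_absval p (of_int d) = 1"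
      using padic_absval_unit_denominator[OF p z] by blast
    hence "padic_absval p (1 + z) = padic_absval p ((1 + z) * of_int d)" by (simp add: mult)
    also have "(1 + z) * of_int d = of_int (d + c)" using zq d by (simp add: field_simps)
    finally show ?thesis using int1 by metis
  qed (use int1[of 1] in simp)
  have add: "padic_absval p (x + y) \<le> max (padic_absval p x) (padic_absval p y)" for x y
  proof -
    have key: "padic_absval p (x + y) \<le> padic_absval p x" if le: "padic_absval p y \<le> padic_absval p x" and x: "x \<noteq> 0" for x y
    proof -
      have "padic_absval p (y / x) * padic_absval p x = padic_absval p y" using mult[of "y / x" x] x by simp
      hence "padic_absval p (y / x) * padic_absval p x \<le> 1 * padic_absval p x" using le by simp
      hence "padic_absval p (y / x) \<le> 1" using pos[OF x] by (simp add: mult_le_cancel_right)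
      hence "padic_absval p x * padic_absval p (1 + y / x) \<le> padic_absval p x * 1"
        using add1 pos[OF x] by (intro mult_left_mono) auto
      moreover have "x * (1 + y / x) = x + y" using x by (simp add: field_simps)
      ultimately show ?thesis using mult[of x "1 + y / x"] by simp
    qed
    show ?thesis
    proof (cases "x = 0 \<or> y = 0")
      case False
      thus ?thesis using key[of y x] key[of x y] by (cases "padic_absval p y \<le> padic_absval p x") (auto simp: add.commute)
    qed (auto simp: zero)
  qed
  show ?thesis unfolding nonarch_absval_def ring_of_type_algebra_def using zero pos mult add by auto
qed

lemma padic_absval_of_int_pos: "Factorial_Ring.prime p \<Longrightarrow> m \<noteq> 0 \<Longrightarrow> padic_absval p (of_int m) \<noteq> 0"
  using prime_gt_0_nat[of p] by (simp add: padic_absval_def)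

lemma padic_absval_self: "Factorial_Ring.prime p \<Longrightarrow> padic_absval p (of_int (int p)) = 1 / real p"
  using padic_absval_fraction[of p "int p" 1] by (simp add: power_int_minus divide_inverse)

text \<open>A nonzero integer \<open>m\<close> is divisible by no power of \<open>p\<close> that is larger than \<open>|m|\<close>.\<close>
lemma padic_absval_of_int_lower:
  assumes p: "Factorial_Ring.prime p" and m: "m \<noteq> 0"
  shows "1 / \<bar>real_of_int m\<bar> \<le> padic_absval p (of_int m)"
proof -
  have p0: "real p > 0" using prime_gt_0_nat[OF p] by simp
  have eq: "padic_absval p (of_int m) = 1 / real p ^ multiplicity (int p) m"
    using padic_absval_fraction[OF p m, of 1] by (simp add: power_int_minus divide_inverse)
  have "int p ^ multiplicity (int p) m dvd \<bar>m\<bar>" using multiplicity_dvd[of "int p" m] by simp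
  hence "int p ^ multiplicity (int p) m \<le> \<bar>m\<bar>" using m by (intro zdvd_imp_le) auto
  hence "real p ^ multiplicity (int p) m \<le> \<bar>real_of_int m\<bar>"
    by (metis of_int_abs of_int_le_iff of_int_of_nat_eq of_int_power)
  thus ?thesis unfolding eq using p0 m by (intro divide_left_mono mult_pos_pos) auto
qed

section \<open>Finite extensions of the p-adic numbers\<close>
lemma dn_combine:
  fixes R :: "'b ring"
  assumes R: "cring R" and "set Ks \<subseteq> carrier R" "set Us \<subseteq> carrier R" "length Ks = length Us" 
  shows "dn R (\<Sum>k<length Us. up R (Ks ! k) * up R (Us ! k)) = ring.combine R Ks Us"
proof -
  interpret cring R by (rule R)
  show ?thesis using assms(4,2,3)
proof (induction Ks Us rule: list_induct2)
  case Nil show ?case by (simp add: dn_ops[OF is_cring])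
next
  case (Cons k Ks u Us)
  have "(\<Sum>i<length (u # Us). up R ((k # Ks) ! i) * up R ((u # Us) ! i)) =
     up R k * up R u + (\<Sum>i<length Us. up R (Ks ! i) * up R (Us ! i))"
    by (simp add: sum.lessThan_Suc_shift del: sum.lessThan_Suc)
  thus ?case using Cons by (simp add: dn_ops[OF is_cring] dn_up[OF is_cring])
qed
qed

lemma dn_eval:
  fixes R :: "'b ring"
  assumes R: "cring R" and "set p \<subseteq> carrier R" "x \<in> carrier R"
  shows "dn R (\<Sum>i<length p. up R (p ! (length p - Suc i)) * up R x ^ i) = ring.eval R p x"
proof -
  interpret cring R by (rule R)
  show ?thesis using assms(2)
proof (induction p)
  case Nil show ?case by (simp add: dn_ops[OF is_cring])
next
  case (Cons k p)
  have "(\<Sum>i<length (k # p). up R ((k # p) ! (length (k # p) - Suc i)) * up R x ^ i) =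
     (\<Sum>i<length p. up R (p ! (length p - Suc i)) * up R x ^ i) + up R k * up R x ^ length p"
    by (simp add: Suc_diff_Suc)
  moreover have "dn R (\<Sum>i<length p. up R (p ! (length p - Suc i)) * up R x ^ i) \<in> carrier R"
    by (rule dn_carrier[OF is_cring])
  ultimately show ?case using Cons assms(3)
    by (simp add: dn_ops[OF is_cring] dn_power[OF is_cring] dn_up[OF is_cring] a_comm)
qed
qed

lemma ring_of_type_algebra_simps:
  "carrier ring_of_type_algebra = UNIV" "x \<otimes>\<^bsub>ring_of_type_algebra\<^esub> y = x * y" "\<one>\<^bsub>ring_of_type_algebra\<^esub> = 1"
  "x \<oplus>\<^bsub>ring_of_type_algebra\<^esub> y = x + y" "\<zero>\<^bsub>ring_of_type_algebra\<^esub> = 0"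
  by (simp_all add: ring_of_type_algebra_def)

lemma uminus_ring_of_type_algebra:
  fixes x :: "'a :: comm_ring_1"
  shows "\<ominus>\<^bsub>ring_of_type_algebra\<^esub> x = - x"
proof -
  interpret cring "ring_of_type_algebra :: 'a ring" by (rule cring_from_type_algebra)
  show ?thesis by (rule minus_equality) (auto simp: ring_of_type_algebra_simps)
qed

lemma dn_of_int: "dn ring_of_type_algebra (of_int m) = (of_int m :: 'a :: comm_ring_1)"
proof -
  note ops = dn_ops[OF cring_from_type_algebra, where 'a1 = 'a, unfolded ring_of_type_algebra_simps uminus_ring_of_type_algebra]
  have n: "dn ring_of_type_algebra (of_nat k) = (of_nat k :: 'a)" for k
    by (induction k) (simp_all add: ops)
  show ?thesis using n by (cases m rule: int_cases2) (simp_all add: ops)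
qed

text \<open>A finite extension of \<open>Qp p\<close>.\<close>
locale padic_extension =
  fixes L :: "'b ring" and p :: nat and h :: "(nat \<Rightarrow> rat) set \<Rightarrow> 'b"
  assumes p: "Factorial_Ring.prime p" and ext: "finite_field_ext (Qp p) h L"
begin

abbreviation "Q \<equiv> Qp p"

sublocale C: valued_field "ring_of_type_algebra :: rat ring" "padic_absval p"
  by (rule valued_field.intro) (auto simp: padic_absval_nonarch[OF p])

lemma Q_def': "Q = place_completion ring_of_type_algebra (padic_absval p)" by (simp add: Qp_def)

lemma Q_field: "field Q" and L_field: "field L" and h_hom: "h \<in> ring_hom Q L"
  and fin: "ring.finite_dimension L (h ` carrier Q) (carrier L)"
  using ext unfolding finite_field_ext_def by auto

sublocale L: field L by (rule L_field)

lemma crL: "cring L" by (rule L.is_cring)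
lemma crQ: "cring Q" using Q_field by (simp add: Q_def' C.CQ_cring)

sublocale h: ring_hom_cring Q L h
  using crQ crL h_hom by (simp add: ring_hom_cring_def ring_hom_cring_axioms_def)

lemma h_inj: "inj_on h (carrier Q)"
  using non_trivial_field_hom_is_inj[OF h_hom Q_field L_field] .

text \<open>
  The lifts of elements of the image of \<open>Qp p\<close>, the lifts of \<open>0\<close>, and the absolute value of
  \<open>Qp p\<close> transported to these lifts. They instantiate \<^locale>\<open>finite_extension_data\<close>.
\<close>
definition Fh :: "'b univ set" where "Fh = {x. dn L x \<in> h ` carrier Q}"
definition Zh :: "'b univ set" where "Zh = {x. dn L x = \<zero>\<^bsub>L\<^esub>}"
definition ph :: "'b univ \<Rightarrow> real" where "ph x = completion_absval (padic_absval p) (inv_into (carrier Q) h (dn L x))"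

lemma ph_eq: "A \<in> carrier Q \<Longrightarrow> dn L x = h A \<Longrightarrow> ph x = completion_absval (padic_absval p) A"
  unfolding ph_def using inv_into_f_f[OF h_inj] by simp

lemmas opsL = dn_ops[OF crL] and carL = dn_carrier[OF crL]

lemma FhE: "x \<in> Fh \<Longrightarrow> \<exists>A\<in>carrier Q. dn L x = h A" unfolding Fh_def by auto

lemma FhI: "A \<in> carrier Q \<Longrightarrow> dn L x = h A \<Longrightarrow> x \<in> Fh" unfolding Fh_def by simp

lemma sub: "subfield (h ` carrier Q) L"
proof -
  interpret Q: field Q by (rule Q_field)
  have "ring_hom_ring Q L h" by (rule ring_hom_ringI2[OF h.R.ring_axioms L.ring_axioms h_hom])
  thus ?thesis using ring_hom_ring.img_is_subfield(2)[of Q L h "carrier Q"] Q.carrier_is_subfield by simp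
qed

lemma exists_basis_data: "\<exists>e d. finite_extension_data Zh Fh ph e d"
proof -
  obtain n where "ring.dimension L n (h ` carrier Q) (carrier L)"
    using fin L.finite_dimension_def by blast
  then obtain Vs where Vs: "set Vs \<subseteq> carrier L" "L.independent (h ` carrier Q) Vs" "L.Span (h ` carrier Q) Vs = carrier L"
    using L.exists_base[OF sub] by blast
  define e where "e k = up L (Vs ! k)" for k
  define d where "d = length Vs"
  note aQ = C.absQ_nonarch[folded Q_def', unfolded nonarch_absval_def]
  have sub_c: "h ` carrier Q \<subseteq> carrier L" using h.hom_closed by auto
  interpret Q: field Q by (rule Q_field)
  have "finite_extension_data Zh Fh ph e d"
  proof unfold_locales
    show "0 \<in> Zh" by (simp add: Zh_def opsL)
    show "x - y \<in> Zh" if "x \<in> Zh" "y \<in> Zh" for x y using that by (simp add: Zh_def opsL a_minus_def)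
    show "x * y \<in> Zh" if "x \<in> Zh" for x y using that carL by (simp add: Zh_def opsL)
    show "1 \<notin> Zh" by (simp add: Zh_def opsL)
    show "\<exists>y. x * y - 1 \<in> Zh" if "x \<notin> Zh" for x
    proof -
      have "dn L x \<in> Units L" using that L.field_Units carL by (simp add: Zh_def)
      then obtain b where b: "b \<in> carrier L" "dn L x \<otimes>\<^bsub>L\<^esub> b = \<one>\<^bsub>L\<^esub>" using L.Units_r_inv_ex by blast
      have "x * up L b - 1 \<in> Zh" using b by (simp add: Zh_def opsL dn_up[OF crL])
      thus ?thesis by blast
    qed
    show "1 \<in> Fh" unfolding Fh_def by (simp add: opsL) (metis h.R.one_closed h.hom_one image_eqI)
    show "x - y \<in> Fh" "x * y \<in> Fh" if xy: "x \<in> Fh" "y \<in> Fh" for x y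
    proof -
      obtain A B where AB: "A \<in> carrier Q" "dn L x = h A" "B \<in> carrier Q" "dn L y = h B" using FhE xy by meson
      have "dn L (x - y) = h (A \<ominus>\<^bsub>Q\<^esub> B)" "dn L (x * y) = h (A \<otimes>\<^bsub>Q\<^esub> B)"
        using AB by (simp_all add: opsL a_minus_def)
      thus "x - y \<in> Fh" "x * y \<in> Fh"
        using FhI[of "A \<ominus>\<^bsub>Q\<^esub> B" "x - y"] FhI[of "A \<otimes>\<^bsub>Q\<^esub> B" "x * y"] AB by simp_all
    qed
    show "\<exists>y\<in>Fh. x * y - 1 \<in> Zh" if x: "x \<in> Fh" "x \<notin> Zh" for x
    proof -
      obtain A where A: "A \<in> carrier Q" "dn L x = h A" using FhE x by meson
      have "A \<noteq> \<zero>\<^bsub>Q\<^esub>" using A x by (auto simp: Zh_def)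
      hence "A \<in> Units Q" using Q.field_Units A by simp
      then obtain B where B: "B \<in> carrier Q" "A \<otimes>\<^bsub>Q\<^esub> B = \<one>\<^bsub>Q\<^esub>" using h.R.Units_r_inv_ex by blast
      have "h A \<otimes>\<^bsub>L\<^esub> h B = \<one>\<^bsub>L\<^esub>" using A B by (metis h.hom_mult h.hom_one)
      moreover have "dn L (up L (h B)) = h B" using B by (simp add: dn_up[OF crL])
      ultimately have "x * up L (h B) - 1 \<in> Zh" "up L (h B) \<in> Fh" using A B by (auto simp: Zh_def Fh_def opsL)
      thus ?thesis by blast
    qed
    show "Zh \<subseteq> Fh" unfolding Zh_def Fh_def using h.R.zero_closed h.hom_zero by (metis (mono_tags) image_eqI mem_Collect_eq subsetI)
    show "0 \<le> ph x" "ph x = 0 \<longleftrightarrow> x \<in> Zh" if x: "x \<in> Fh" for x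
    proof -
      obtain A where A: "A \<in> carrier Q" "dn L x = h A" using FhE x by meson
      have "h A = \<zero>\<^bsub>L\<^esub> \<longleftrightarrow> A = \<zero>\<^bsub>Q\<^esub>" using A h_inj h.R.zero_closed h.hom_zero by (metis inj_onD)
      thus "0 \<le> ph x" "ph x = 0 \<longleftrightarrow> x \<in> Zh"
        using ph_eq[OF A] aQ A by (cases "A = \<zero>\<^bsub>Q\<^esub>"; force simp: Zh_def)+
    qed
    show "ph (x * y) = ph x * ph y" "ph (x + y) \<le> max (ph x) (ph y)" if xy: "x \<in> Fh" "y \<in> Fh" for x y
    proof -
      obtain A B where AB: "A \<in> carrier Q" "dn L x = h A" "B \<in> carrier Q" "dn L y = h B" using FhE xy by meson
      have "dn L (x + y) = h (A \<oplus>\<^bsub>Q\<^esub> B)" "dn L (x * y) = h (A \<otimes>\<^bsub>Q\<^esub> B)"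
        using AB by (simp_all add: opsL)
      thus "ph (x * y) = ph x * ph y" "ph (x + y) \<le> max (ph x) (ph y)"
        using ph_eq[of "A \<oplus>\<^bsub>Q\<^esub> B" "x + y"] ph_eq[of "A \<otimes>\<^bsub>Q\<^esub> B" "x * y"] ph_eq[OF AB(1,2)] ph_eq[OF AB(3,4)] AB aQ by simp_all
    qed
    show "\<exists>c. (\<forall>k<d. c k \<in> Fh) \<and> x - (\<Sum>k<d. c k * e k) \<in> Zh" for x
    proof -
      have "dn L x \<in> L.Span (h ` carrier Q) Vs" using Vs carL by simp
      then obtain Ks where Ks: "length Ks = length Vs" "set Ks \<subseteq> h ` carrier Q" "dn L x = L.combine Ks Vs"
        using L.Span_eq_combine_set_length_version[OF sub Vs(1)] by blast
      have KsL: "set Ks \<subseteq> carrier L" using Ks sub_c by blast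
      have "dn L (\<Sum>k<d. up L (Ks ! k) * e k) = dn L x"
        using dn_combine[OF crL KsL Vs(1) Ks(1)] Ks(3) by (simp add: d_def e_def)
      hence "x - (\<Sum>k<d. up L (Ks ! k) * e k) \<in> Zh" using carL by (simp add: Zh_def opsL)
      moreover have "up L (Ks ! k) \<in> Fh" if "k < d" for k
      proof -
        have "Ks ! k \<in> set Ks" using that Ks(1) by (simp add: d_def)
        hence "Ks ! k \<in> h ` carrier Q" "Ks ! k \<in> carrier L" by (rule subsetD[OF Ks(2)], rule subsetD[OF KsL])
        thus ?thesis unfolding Fh_def mem_Collect_eq using dn_up[OF crL, of "Ks ! k"] by metis
      qed
      ultimately show ?thesis by (intro exI[of _ "\<lambda>k. up L (Ks ! k)"]) blast
    qed
    show "c k \<in> Zh" if c: "\<forall>k<d. c k \<in> Fh" "(\<Sum>k<d. c k * e k) \<in> Zh" "k < d" for c k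
    proof -
      define Ks where "Ks = map (\<lambda>k. dn L (c k)) [0..<d]"
      have len: "length Ks = length Vs" by (simp add: Ks_def d_def)
      have KsL: "set Ks \<subseteq> carrier L" using carL by (auto simp: Ks_def)
      have KsF: "set Ks \<subseteq> h ` carrier Q" using c by (auto simp: Ks_def Fh_def)
      have "dn L (\<Sum>k<m. up L (Ks ! k) * e k) = dn L (\<Sum>k<m. c k * e k)" if "m \<le> d" for m
        using that by (induction m) (simp_all add: opsL Ks_def dn_up[OF crL] carL)
      hence "L.combine Ks Vs = dn L (\<Sum>k<d. c k * e k)"
        using dn_combine[OF crL KsL Vs(1) len] by (simp add: e_def d_def)
      hence "L.combine Ks Vs = \<zero>\<^bsub>L\<^esub>" using c by (simp add: Zh_def)
      hence "set (take (length Vs) Ks) \<subseteq> {\<zero>\<^bsub>L\<^esub>}" using L.independent_imp_trivial_combine[OF sub Vs(2) KsF] by blast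
      moreover have "take (length Vs) Ks = Ks" using len by simp
      moreover have "dn L (c k) \<in> set Ks" using c(3) by (auto simp: Ks_def)
      ultimately show "c k \<in> Zh" by (auto simp: Zh_def)
    qed
  qed
  thus ?thesis by blast
qed

lemma exists_absval: "\<exists>a. extends_padic_absval L a"
proof -
  obtain e d where "finite_extension_data Zh Fh ph e d" using exists_basis_data by blast
  then interpret finite_extension_data Zh Fh ph e d .
  obtain N where N: "nonarch_fld N" "\<And>c. c \<in> Fh \<Longrightarrow> N c = ph c" "\<And>x. N x = 0 \<longleftrightarrow> x \<in> Zh"
    using absval_extension by blast
  interpret N: nonarch_fld N by (rule N(1))
  define a where "a x = N (up L x)" for x
  have cong: "N x = N y" if "dn L x = dn L y" for x y
    by (rule N.N_cong) (use that carL in \<open>simp add: N(3) Zh_def opsL\<close>)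
  note du = dn_up[OF crL]
  have "nonarch_absval L a" unfolding nonarch_absval_def
  proof (intro conjI ballI impI)
    show "a \<zero>\<^bsub>L\<^esub> = 0" by (simp add: a_def N(3) Zh_def du)
    fix x assume x: "x \<in> carrier L"
    show "0 < a x" if "x \<noteq> \<zero>\<^bsub>L\<^esub>"
      using that N(3)[of "up L x"] N.N_nonneg[of "up L x"] x by (simp add: a_def Zh_def du less_le)
    fix y assume y: "y \<in> carrier L"
    have "a (x \<otimes>\<^bsub>L\<^esub> y) = N (up L x * up L y)" unfolding a_def by (rule cong) (use x y in \<open>simp add: opsL du\<close>)
    thus "a (x \<otimes>\<^bsub>L\<^esub> y) = a x * a y" by (simp add: N.N_mult a_def)
    have "a (x \<oplus>\<^bsub>L\<^esub> y) = N (up L x + up L y)" unfolding a_def by (rule cong) (use x y in \<open>simp add: opsL du\<close>)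
    thus "a (x \<oplus>\<^bsub>L\<^esub> y) \<le> max (a x) (a y)" by (simp add: N.N_add a_def)
  qed
  moreover have "a (h A) = completion_absval (padic_absval p) A" if A: "A \<in> carrier Q" for A
    using N(2)[of "up L (h A)"] ph_eq[OF A, of "up L (h A)"] A by (simp add: a_def Fh_def du)
  ultimately show ?thesis unfolding extends_padic_absval_def using p ext by blast
qed

end

text \<open>A finite extension of \<open>Qp p\<close> with an absolute value \<open>a\<close> that extends the one of \<open>Qp p\<close>.\<close>
locale padic_extension_absval = padic_extension +
  fixes a :: "'a \<Rightarrow> real"
  assumes a: "nonarch_absval L a" and a_h: "\<And>A. A \<in> carrier (Qp p) \<Longrightarrow> a (h A) = completion_absval (padic_absval p) A"
begin

abbreviation N :: "'a univ \<Rightarrow> real" where "N x \<equiv> a (dn L x)"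

sublocale N: nonarch_fld N by (rule nonarch_absval_dn[OF L_field a])

lemma N_Zh: "N x = 0 \<longleftrightarrow> x \<in> Zh" using nonarch_absval_dn(2)[OF L_field a] by (simp add: Zh_def)

lemma dn_Q_of_int: "dn Q (of_int m) = C.cls (\<lambda>_. of_int m)"
proof -
  have "dn Q (of_int m) = C.cls (\<lambda>_. up ring_of_type_algebra (dn ring_of_type_algebra (of_int m)))"
    using dn_hom_of_int[OF C.cr C.CQ_cring C.const_hom] by (simp add: Q_def')
  thus ?thesis unfolding C.cls_def C.sq_def using dn_up[OF C.cr dn_carrier[OF C.cr]] by simp
qed

lemma N_of_int: "N (of_int m) = padic_absval p (of_int m)"
proof -
  have "N (of_int m) = a (h (dn Q (of_int m)))" using dn_hom_of_int[OF crQ crL h_hom] by simp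
  also have "\<dots> = C.absQ (dn Q (of_int m))" by (rule a_h[OF dn_carrier[OF crQ]])
  finally show ?thesis by (simp add: dn_Q_of_int C.absQ_const dn_of_int)
qed

lemma N_of_int_nz: "m \<noteq> 0 \<Longrightarrow> N (of_int m) \<noteq> 0"
  using N_of_int padic_absval_of_int_pos[OF p] by simp

lemma N_p: "N (of_int (int p)) < 1" "N (of_int (int p)) \<noteq> 0"
  using N_of_int[of "int p"] padic_absval_self[OF p] prime_gt_1_nat[OF p] by simp_all

text \<open>
  The rationals are dense in \<open>Qp p\<close>. An approximation of a \<open>p\<close>-adic integer has a
  denominator prime to \<open>p\<close>.
\<close>
lemma Fh_dense:
  assumes c: "c \<in> Fh" "N c \<le> 1" and e: "e > 0"
  shows "\<exists>r m. N (of_int m) = 1 \<and> N (c * of_int m - of_int r) < e"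
proof -
  obtain A where A: "A \<in> carrier Q" "dn L c = h A" using FhE c by meson
  obtain S where S: "seq_cauchy C.V S" "A = C.cls S" using A C.carrier_CQ by (auto simp: Q_def')
  define e' where "e' = min e 1"
  have e': "e' > 0" "e' \<le> e" "e' \<le> 1" using e by (auto simp: e'_def)
  obtain M where M: "C.absQ (C.cls S \<ominus>\<^bsub>C.CQ\<^esub> C.cls (\<lambda>_. S M)) < e'" using C.absQ_tail[OF S(1) e'(1)] by blast
  define B where "B = C.cls (\<lambda>_. S M)"
  have B: "B \<in> carrier Q" by (simp add: B_def Q_def' C.cls_in C.V.seq_cauchy_const)
  define b where "b = up L (h B)"
  have dnb: "dn L b = h B" using B by (simp add: b_def dn_up[OF crL])
  have "dn L (c - b) = h (A \<ominus>\<^bsub>Q\<^esub> B)" using A B dnb by (simp add: opsL a_minus_def)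
  moreover have "A \<ominus>\<^bsub>Q\<^esub> B \<in> carrier Q" using A B by simp
  ultimately have Ncb: "N (c - b) < e'" using a_h M by (simp add: S B_def Q_def')
  define q where "q = dn ring_of_type_algebra (S M)"
  have Nb: "N b = padic_absval p q" using a_h[OF B] dnb by (simp add: B_def C.absQ_const q_def)
  have "N b \<le> 1" using N.N_diff_le[of c 1 "c - b"] c Ncb e' by simp
  then obtain r m where rm: "q = of_int r / of_int m" "m \<noteq> 0" "padic_absval p (of_int m) = 1"
    using padic_absval_unit_denominator[OF p, of q] Nb by auto
  have Nm: "N (of_int m) = 1" using rm N_of_int by simp
  have "N (b * of_int m - of_int r) = 0"
  proof -
    have "dn ring_of_type_algebra (S M * of_int m) = dn ring_of_type_algebra (of_int r)"
      using rm by (simp add: dn_ops[OF C.cr] dn_of_int q_def[symmetric] ring_of_type_algebra_simps)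
    hence eq: "C.cls (\<lambda>_. S M * of_int m) = C.cls (\<lambda>_. of_int r)" unfolding C.cls_def C.sq_def by simp
    have "B \<otimes>\<^bsub>Q\<^esub> dn Q (of_int m) = dn Q (of_int r)"
      unfolding dn_Q_of_int B_def unfolding Q_def' using eq C.cls_ops(2)[of "\<lambda>_. S M" "\<lambda>_. of_int m"] by (simp add: C.V.seq_cauchy_const)
    hence "h B \<otimes>\<^bsub>L\<^esub> dn L (of_int m) = dn L (of_int r)"
      using h.hom_mult[OF B dn_carrier[OF crQ], of "of_int m"] dn_hom_of_int[OF crQ crL h_hom] by simp
    hence "b * of_int m - of_int r \<in> Zh" using dnb carL by (simp add: Zh_def opsL)
    thus ?thesis using N_Zh by blast
  qed
  moreover have "c * of_int m - of_int r = (c - b) * of_int m + (b * of_int m - of_int r)" by (simp add: algebra_simps)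
  moreover have "N ((c - b) * of_int m) < e'" using Ncb Nm by (simp add: N.N_mult)
  ultimately have "N (c * of_int m - of_int r) < e'" using N.N_add_less e'(1) by metis
  thus ?thesis using Nm e' by (meson order.strict_trans2)
qed

lemma Fh_complete:
  assumes S: "\<And>n. S n \<in> Fh" "seq_cauchy N S"
  shows "\<exists>y\<in>Fh. (\<lambda>n. N (S n - y)) \<longlonglongrightarrow> 0"
proof -
  obtain A where A: "\<And>n. A n \<in> carrier Q" "\<And>n. dn L (S n) = h (A n)" using FhE[OF S(1)] by metis
  have dif: "N (S m - S n) = C.absQ (A m \<ominus>\<^bsub>Q\<^esub> A n)" for m n
  proof -
    have "dn L (S m - S n) = h (A m \<ominus>\<^bsub>Q\<^esub> A n)" using A by (simp add: opsL a_minus_def)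
    thus ?thesis using a_h[of "A m \<ominus>\<^bsub>Q\<^esub> A n"] A by simp
  qed
  obtain B where B: "B \<in> carrier Q" "(\<lambda>n. C.absQ (A n \<ominus>\<^bsub>Q\<^esub> B)) \<longlonglongrightarrow> 0"
    using C.CQ_complete[of A] A(1) S(2) unfolding seq_cauchy_def dif Q_def' by blast
  have "N (S n - up L (h B)) = C.absQ (A n \<ominus>\<^bsub>Q\<^esub> B)" for n
  proof -
    have "dn L (S n - up L (h B)) = h (A n \<ominus>\<^bsub>Q\<^esub> B)" using A B by (simp add: opsL a_minus_def dn_up[OF crL])
    thus ?thesis using a_h[of "A n \<ominus>\<^bsub>Q\<^esub> B"] A B by simp
  qed
  moreover have "up L (h B) \<in> Fh" using B by (simp add: Fh_def dn_up[OF crL])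
  ultimately show ?thesis using B(2) by (intro bexI[of _ "up L (h B)"]) auto
qed

lemma N_complete: "complete_nonarch_fld N"
proof -
  obtain e d where "finite_extension_data Zh Fh ph e d" using exists_basis_data by blast
  then interpret D: finite_extension_data Zh Fh ph e d .
  interpret complete_finite_extension Zh Fh ph e d N
    by unfold_locales (use N_Zh Fh_complete in auto)
  show ?thesis by (rule complete_nonarch_fld_axioms)
qed

sublocale N: complete_nonarch_fld N by (rule N_complete)

lemma Fh_int_mult: "c \<in> Fh \<Longrightarrow> of_int m * c \<in> Fh"
proof -
  assume "c \<in> Fh"
  then obtain A where A: "A \<in> carrier Q" "dn L c = h A" using FhE by meson
  have "dn L (of_int m * c) = h (dn Q (of_int m) \<otimes>\<^bsub>Q\<^esub> A)"
    using A dn_hom_of_int[OF crQ crL h_hom] dn_carrier[OF crQ] by (simp add: opsL)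
  thus ?thesis using FhI[of "dn Q (of_int m) \<otimes>\<^bsub>Q\<^esub> A" "of_int m * c"] A dn_carrier[OF crQ] by simp
qed

text \<open>Algebraic dependence over \<open>Qp p\<close>, translated from lists of coefficients to finite sums.\<close>
lemma algebraic: "\<exists>n c. (\<forall>i\<le>n. c i \<in> Fh) \<and> N (c n) \<noteq> 0 \<and> N (\<Sum>i\<le>n. c i * x ^ i) = 0"
proof -
  have "(L.algebraic over (h ` carrier Q)) (dn L x)"
    using L.finite_dimension_imp_algebraic[OF sub L.carrier_is_subring fin] carL by blast
  then obtain q where q: "q \<in> carrier ((h ` carrier Q)[X]\<^bsub>L\<^esub>)" "q \<noteq> []" "L.eval q (dn L x) = \<zero>\<^bsub>L\<^esub>"
    using L.algebraicE[OF subfieldE(1)[OF sub] carL] by blast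
  have poly: "set q \<subseteq> h ` carrier Q" "hd q \<noteq> \<zero>\<^bsub>L\<^esub>" using q(1,2) unfolding univ_poly_carrier[symmetric] polynomial_def by auto
  have qL: "set q \<subseteq> carrier L" using poly(1) h.hom_closed by auto
  obtain n where n: "length q = Suc n" using q(2) by (cases q) auto
  define c where "c i = up L (q ! (n - i))" for i
  have mem: "q ! (n - i) \<in> set q" for i using n by (intro nth_mem) auto
  have cF: "c i \<in> Fh" for i unfolding c_def Fh_def using mem[of i] poly(1) qL by (auto simp: dn_up[OF crL] subset_iff)
  have cn: "N (c n) \<noteq> 0"
  proof -
    have "q ! 0 = hd q" using q(2) by (simp add: hd_conv_nth)
    hence "dn L (c n) \<noteq> \<zero>\<^bsub>L\<^esub>" using poly(2) qL q(2) by (simp add: c_def dn_up[OF crL] subset_iff)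
    thus ?thesis using N_Zh by (simp add: Zh_def)
  qed
  have "dn L (\<Sum>i<Suc n. c i * up L (dn L x) ^ i) = \<zero>\<^bsub>L\<^esub>"
    using dn_eval[OF crL qL carL, of x] q(3) n by (simp add: c_def del: sum.lessThan_Suc)
  moreover have "dn L (\<Sum>i<m. c i * up L (dn L x) ^ i) = dn L (\<Sum>i<m. c i * x ^ i)" for m
    by (induction m) (simp_all add: opsL dn_power[OF crL] dn_up[OF crL] carL)
  ultimately have "(\<Sum>i\<le>n. c i * x ^ i) \<in> Zh" by (simp add: Zh_def lessThan_Suc_atMost[symmetric] del: sum.lessThan_Suc)
  thus ?thesis using cF cn N_Zh by blast
qed

lemma approx_root_all: "N x \<le> 1 \<Longrightarrow> N.approx_root x"
  by (rule N.approx_root_of_algebraic[OF _ N_p N_of_int_nz Fh_int_mult Fh_dense algebraic])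

text \<open>
  The basis, scaled into the unit ball. A closed subfield contains \<open>Qp p\<close> by density of the
  rationals, so it contains everything as soon as it contains the basis.
\<close>
lemma spanning_set:
  "\<exists>A. finite A \<and> (\<forall>x\<in>A. N x \<le> 1) \<and> (\<forall>E. N.closed_subfield E \<longrightarrow> A \<subseteq> E \<longrightarrow> E = UNIV)"
proof -
  obtain e d where "finite_extension_data Zh Fh ph e d" using exists_basis_data by blast
  then interpret D: finite_extension_data Zh Fh ph e d .
  have scale: "\<exists>k. N (of_int (int p) ^ k * x) \<le> 1" for x
  proof -
    obtain k where k: "N (of_int (int p) ^ k) < 1 / (N x + 1)"
      using N.power_small[OF N_p(1), of "1 / (N x + 1)"] N.N_nonneg[of x] by (auto simp: add_nonneg_pos)
    have "N x + 1 > 0" using N.N_nonneg[of x] by linarith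
    hence "N (of_int (int p) ^ k) * (N x + 1) < 1" using k by (simp add: pos_less_divide_eq)
    hence "N (of_int (int p) ^ k * x) \<le> 1"
      using N.N_nonneg[of "of_int (int p) ^ k"] unfolding N.N_mult distrib_left mult_1_right by linarith
    thus ?thesis by blast
  qed
  then obtain k where k: "\<And>x. N (of_int (int p) ^ k x * x) \<le> 1" by metis
  have pk: "N (of_int (int p) ^ j) \<noteq> 0" for j using N_p by (simp add: N.N_power)
  define A where "A = (\<lambda>i. of_int (int p) ^ k (e i) * e i) ` {..<d}"
  have "E = UNIV" if E: "N.closed_subfield E" and AE: "A \<subseteq> E" for E
  proof -
    have pE: "of_int (int p) ^ j \<in> E" for j by (intro N.closed_subfield_power N.closed_subfield_of_int E)
    have FE: "c \<in> E" if c: "c \<in> Fh" for c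
    proof -
      define c' where "c' = of_int (int p) ^ k c * c"
      have c': "c' \<in> Fh" "N c' \<le> 1" using Fh_int_mult[OF c, of "int p ^ k c"] k[of c] by (simp_all add: c'_def)
      have "c' \<in> E"
      proof (rule N.closed_subfieldD(5)[OF E])
        fix r :: real assume "r > 0"
        then obtain s m where sm: "N (of_int m) = 1" "N (c' * of_int m - of_int s) < r" using Fh_dense[OF c'] by blast
        obtain z where z: "z \<in> E" "N (z * of_int m - of_int s) = 0"
          using N.closed_subfield_divide[OF E N.closed_subfield_of_int[OF E] N.closed_subfield_of_int[OF E]] sm by force
        have "N (c' - z) = N ((c' - z) * of_int m)" using sm by (simp add: N.N_mult)
        also have "(c' - z) * of_int m = (c' * of_int m - of_int s) - (z * of_int m - of_int s)" by (simp add: algebra_simps)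
        also have "N \<dots> < r" using sm z \<open>r > 0\<close> by (intro N.N_diff_less[of "c' * of_int m - of_int s" _ "z * of_int m - of_int s"]) auto
        finally show "\<exists>y\<in>E. N (c' - y) < r" using z by blast
      qed
      thus ?thesis using N.closed_subfield_cancel[OF E pE pk] unfolding c'_def by blast
    qed
    have eE: "e i \<in> E" if "i < d" for i
      using N.closed_subfield_cancel[OF E pE pk] AE that unfolding A_def by blast
    have "x \<in> E" for x
    proof (rule N.closed_subfield_cong[OF E])
      show "(\<Sum>i<d. D.coord x i * e i) \<in> E"
        by (intro N.closed_subfield_sum[OF E] N.closed_subfieldD(3)[OF E]) (auto intro: FE D.coord eE)
      show "N (x - (\<Sum>i<d. D.coord x i * e i)) = 0" using D.coord(2) N_Zh by blast
    qed
    thus ?thesis by blast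
  qed
  thus ?thesis using k by (intro exI[of _ A]) (auto simp: A_def)
qed

text \<open>
  Near every integer, \<open>L\<close> has a topological generator that is a simple root of an integer
  polynomial.
\<close>
lemma generator:
  assumes "r > 0"
  shows "\<exists>g G. N (g - of_int c) < r \<and> N g \<le> 1 \<and> N (iev G g) = 0 \<and> N (iev (pderiv G) g) \<noteq> 0 \<and> N.generates g"
proof -
  obtain A where A: "finite A" "\<And>x. x \<in> A \<Longrightarrow> N x \<le> 1" "\<And>E. N.closed_subfield E \<Longrightarrow> A \<subseteq> E \<Longrightarrow> E = UNIV"
    using spanning_set by blast
  show ?thesis by (rule N.generator_near_int[OF N_p approx_root_all A assms])
qed

end

lemma local_absval_extends:
  fixes L :: "'b ring"
  assumes "nonarch_local_field L"
  shows "extends_padic_absval L (local_absval L)"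
proof -
  obtain p h where "Factorial_Ring.prime p" "finite_field_ext (Qp p) h L"
    using assms unfolding nonarch_local_field_def by blast
  then interpret padic_extension L p h by unfold_locales
  show ?thesis unfolding local_absval_def using exists_absval by (rule someI_ex)
qed

section \<open>Uniqueness of the algebraic closure\<close>

text \<open>A prime ideal, such as the kernel of a ring homomorphism into a field.\<close>
definition prime_kernel :: "'r::comm_ring_1 set \<Rightarrow> bool" where
  "prime_kernel Z \<longleftrightarrow> (\<forall>x\<in>Z. \<forall>y\<in>Z. x - y \<in> Z) \<and> (\<forall>x y. x * y \<in> Z \<longleftrightarrow> x \<in> Z \<or> y \<in> Z) \<and> 0 \<in> Z \<and> 1 \<notin> Z"

lemma prime_kernelD:
  assumes "prime_kernel Z"
  shows "x \<in> Z \<Longrightarrow> y \<in> Z \<Longrightarrow> x - y \<in> Z" "x * y \<in> Z \<longleftrightarrow> x \<in> Z \<or> y \<in> Z" "0 \<in> Z" "1 \<notin> Z"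
    "x \<in> Z \<Longrightarrow> - x \<in> Z" "x \<in> Z \<Longrightarrow> y \<in> Z \<Longrightarrow> x + y \<in> Z"
proof -
  show d: "x \<in> Z \<Longrightarrow> y \<in> Z \<Longrightarrow> x - y \<in> Z" and "x * y \<in> Z \<longleftrightarrow> x \<in> Z \<or> y \<in> Z" and z: "0 \<in> Z" and "1 \<notin> Z" for x y
    using assms unfolding prime_kernel_def by auto
  show u: "x \<in> Z \<Longrightarrow> - x \<in> Z" for x using d[OF z, of x] by simp
  show "x \<in> Z \<Longrightarrow> y \<in> Z \<Longrightarrow> x + y \<in> Z" using d[of x "- y"] u by simp
qed

text \<open>Subrings that contain the unit element of the ring.\<close>
definition unital_subring :: "'r::comm_ring_1 set \<Rightarrow> bool" where
  "unital_subring G \<longleftrightarrow> 1 \<in> G \<and> (\<forall>x\<in>G. \<forall>y\<in>G. x - y \<in> G \<and> x * y \<in> G)"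

lemma unital_subringD:
  assumes "unital_subring G"
  shows "1 \<in> G" "x \<in> G \<Longrightarrow> y \<in> G \<Longrightarrow> x - y \<in> G" "x \<in> G \<Longrightarrow> y \<in> G \<Longrightarrow> x * y \<in> G" "0 \<in> G"
    "x \<in> G \<Longrightarrow> - x \<in> G" "x \<in> G \<Longrightarrow> y \<in> G \<Longrightarrow> x + y \<in> G"
proof -
  show o: "1 \<in> G" and d: "x \<in> G \<Longrightarrow> y \<in> G \<Longrightarrow> x - y \<in> G" and "x \<in> G \<Longrightarrow> y \<in> G \<Longrightarrow> x * y \<in> G" for x y
    using assms unfolding unital_subring_def by auto
  show z: "0 \<in> G" using d[OF o o] by simp
  show u: "x \<in> G \<Longrightarrow> - x \<in> G" for x using d[OF z, of x] by simp
  show "x \<in> G \<Longrightarrow> y \<in> G \<Longrightarrow> x + y \<in> G" using d[of x "- y"] u by simp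
qed

text \<open>Polynomials with coefficients in \<open>G\<close>.\<close>
definition poly_over :: "'r::comm_ring_1 set \<Rightarrow> 'r poly \<Rightarrow> bool" where
  "poly_over G P \<longleftrightarrow> (\<forall>i. Polynomial.coeff P i \<in> G)"

lemma unital_subring_sum: "unital_subring G \<Longrightarrow> (\<And>i. i \<in> A \<Longrightarrow> f i \<in> G) \<Longrightarrow> sum f A \<in> G"
  by (induction A rule: infinite_finite_induct) (auto simp: unital_subringD)

lemma poly_over_ops:
  assumes G: "unital_subring G"
  shows "poly_over G P \<Longrightarrow> poly_over G Q \<Longrightarrow> poly_over G (P - Q)"
    "poly_over G P \<Longrightarrow> poly_over G Q \<Longrightarrow> poly_over G (P * Q)"
    "c \<in> G \<Longrightarrow> poly_over G (Polynomial.monom c n)"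
  using unital_subringD[OF G]
  by (auto simp: poly_over_def coeff_mult intro!: unital_subring_sum[OF G])

lemma poly_over_eval: "unital_subring G \<Longrightarrow> poly_over G P \<Longrightarrow> x \<in> G \<Longrightarrow> poly P x \<in> G"
proof (induction P)
  case 0
  then show ?case by (simp add: unital_subringD(4))
next
  case (pCons a P)
  have "Polynomial.coeff (pCons a P) 0 \<in> G" "\<And>i. Polynomial.coeff (pCons a P) (Suc i) \<in> G"
    using pCons(4) unfolding poly_over_def by blast+
  hence "a \<in> G" "poly_over G P" by (simp_all add: poly_over_def)
  then show ?case using pCons by (simp add: unital_subringD)
qed

text \<open>
  A subring \<open>S\<close> whose elements are algebraic over the subfield \<open>K0\<close> (modulo \<open>Z\<close>) is a field.
  The inverse is read off from a relation after removing factors \<open>x\<close> until the constant term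
  is not in \<open>Z\<close>.
\<close>
lemma algebraic_inverse:
  assumes Z: "prime_kernel Z" and S: "unital_subring S" "K0 \<subseteq> S"
    and inv: "\<And>c. c \<in> K0 \<Longrightarrow> c \<notin> Z \<Longrightarrow> \<exists>d\<in>K0. c * d - 1 \<in> Z"
    and x: "x \<in> S" "x \<notin> Z"
  shows "poly_over K0 P \<Longrightarrow> \<exists>i. Polynomial.coeff P i \<notin> Z \<Longrightarrow> poly P x \<in> Z \<Longrightarrow> \<exists>y\<in>S. x * y - 1 \<in> Z"
proof (induction P)
  case 0
  then show ?case using prime_kernelD(3)[OF Z] by simp
next
  case (pCons c P)
  note ZD = prime_kernelD[OF Z] and SD = unital_subringD[OF S(1)]
  have "Polynomial.coeff (pCons c P) 0 \<in> K0" "\<And>i. Polynomial.coeff (pCons c P) (Suc i) \<in> K0"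
    using pCons(3) unfolding poly_over_def by blast+
  hence c: "c \<in> K0" and P: "poly_over K0 P" by (simp_all add: poly_over_def)
  show ?case
  proof (cases "c \<in> Z")
    case False
    obtain d where d: "d \<in> K0" "c * d - 1 \<in> Z" using inv[OF c False] by blast
    have PS: "poly_over S P" using P S(2) by (auto simp: poly_over_def)
    define y where "y = - d * poly P x"
    have "y \<in> S" unfolding y_def using d S(2) SD(3,5) poly_over_eval[OF S(1) PS x(1)] by blast
    moreover have "x * y - 1 = - d * poly (pCons c P) x + (c * d - 1)" by (simp add: y_def algebra_simps)
    moreover have "- d * poly (pCons c P) x \<in> Z" using pCons(5) ZD(2) by blast
    ultimately show ?thesis using ZD(6) d(2) by metis
  next
    case True
    have "x * poly P x = poly (pCons c P) x - c" by simp
    hence "x * poly P x \<in> Z" using ZD(1) pCons(5) True by metis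
    hence "poly P x \<in> Z" using ZD(2) x by blast
    moreover have "\<exists>i. Polynomial.coeff P i \<notin> Z"
      using pCons(4) True by (metis coeff_pCons_0 coeff_pCons_Suc not0_implies_Suc)
    ultimately show ?thesis using pCons(2) P by blast
  qed
qed

text \<open>
  A subring that contains \<open>K0\<close> and on which the prime ideals \<open>Z1\<close> and \<open>Z2\<close> agree. It encodes
  a partial isomorphism between the two quotients, namely the one between its images in
  them.
\<close>
definition coherent :: "'r::comm_ring_1 set \<Rightarrow> 'r set \<Rightarrow> 'r set \<Rightarrow> 'r set \<Rightarrow> bool" where
  "coherent K0 Z1 Z2 G \<longleftrightarrow> K0 \<subseteq> G \<and> unital_subring G \<and> (\<forall>x\<in>G. x \<in> Z1 \<longleftrightarrow> x \<in> Z2)"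

lemma coherent_swap: "coherent K0 Z1 Z2 G \<longleftrightarrow> coherent K0 Z2 Z1 G"
  unfolding coherent_def by blast

lemma degree_reduce:
  assumes "Polynomial.degree Q \<le> Suc m"
  shows "Polynomial.degree (Q - Polynomial.monom (Polynomial.coeff Q (Suc m)) (Suc m)) \<le> m"
  by (rule degree_le) (use assms in \<open>auto simp: coeff_monom coeff_eq_0\<close>)

text \<open>
  One step in the extension of a partial isomorphism to an algebraic element \<open>a\<close>. Let \<open>P\<close> be
  a polynomial over \<open>G\<close> of least degree that vanishes at \<open>a\<close> modulo \<open>Z1\<close>, and let \<open>t\<close> be
  congruent to \<open>a\<close> modulo \<open>Z1\<close> and a root of \<open>P\<close> modulo \<open>Z2\<close>. Division by \<open>P\<close> shows that
  each polynomial over \<open>G\<close> that vanishes at \<open>t\<close> modulo \<open>Z1\<close> also vanishes there modulo \<open>Z2\<close>,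
  and the converse holds because the values at \<open>t\<close> form a field modulo \<open>Z1\<close>.
\<close>
lemma coherent_extend:
  assumes Z1: "prime_kernel Z1" and Z2: "prime_kernel Z2" and G: "coherent K0 Z1 Z2 G"
    and inv: "\<And>c. c \<in> K0 \<Longrightarrow> c \<notin> Z1 \<Longrightarrow> \<exists>d\<in>K0. c * d - 1 \<in> Z1"
    and alg: "\<And>x. \<exists>P. poly_over K0 P \<and> (\<exists>i. Polynomial.coeff P i \<notin> Z1) \<and> poly P x \<in> Z1"
    and root: "\<And>P. Polynomial.degree P > 0 \<Longrightarrow> Polynomial.coeff P (Polynomial.degree P) \<notin> Z2 \<Longrightarrow> \<exists>t. t - a \<in> Z1 \<and> poly P t \<in> Z2"
  shows "\<exists>t G'. coherent K0 Z1 Z2 G' \<and> G \<subseteq> G' \<and> t \<in> G' \<and> t - a \<in> Z1"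
proof -
  note Z1D = prime_kernelD[OF Z1] and Z2D = prime_kernelD[OF Z2]
  have K0G: "K0 \<subseteq> G" and Gs: "unital_subring G" and G12: "\<And>x. x \<in> G \<Longrightarrow> x \<in> Z1 \<longleftrightarrow> x \<in> Z2"
    using G unfolding coherent_def by auto
  note GD = unital_subringD[OF Gs]
  have cong1: "poly P t \<in> Z1 \<longleftrightarrow> poly P s \<in> Z1" if "t - s \<in> Z1" for P t s
  proof -
    have "poly P t - poly P s \<in> Z1"
    proof (induction P)
      case (pCons c P)
      have "poly (pCons c P) t - poly (pCons c P) s = t * (poly P t - poly P s) + (t - s) * poly P s"
        by (simp add: algebra_simps)
      thus ?case using pCons(2) that Z1D(2,6) by metis
    qed (use Z1D in simp)
    moreover have "poly P t = (poly P t - poly P s) + poly P s" "poly P s = poly P t - (poly P t - poly P s)" by simp_all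
    ultimately show ?thesis using Z1D(1,6) by metis
  qed
  \<comment> \<open>Degrees are those of actual polynomials, so leading coefficients that lie in \<open>Z1\<close> have to be removed.\<close>
  define good where "good n P \<longleftrightarrow> poly_over G P \<and> Polynomial.degree P = n \<and> Polynomial.coeff P n \<notin> Z1 \<and> poly P a \<in> Z1" for n P
  have ex: "\<exists>n P. good n P"
  proof -
    obtain P where P: "poly_over K0 P" "\<exists>i. Polynomial.coeff P i \<notin> Z1" "poly P a \<in> Z1" using alg by blast
    have "poly_over G P \<Longrightarrow> \<exists>i. Polynomial.coeff P i \<notin> Z1 \<Longrightarrow> poly P a \<in> Z1 \<Longrightarrow> \<exists>n P. good n P" for P
    proof (induction "Polynomial.degree P" arbitrary: P rule: less_induct)
      case less
      define n where "n = Polynomial.degree P"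
      show ?case
      proof (cases "Polynomial.coeff P n \<in> Z1")
        case False thus ?thesis using less(2,4) unfolding good_def n_def by blast
      next
        case True
        obtain i where i: "Polynomial.coeff P i \<notin> Z1" using less(3) by blast
        have "n \<noteq> 0" using True i Z1D(3) coeff_eq_0[of P i] unfolding n_def by (metis gr0I)
        then obtain m where m: "n = Suc m" by (cases n) auto
        define P' where "P' = P - Polynomial.monom (Polynomial.coeff P n) n"
        have "Polynomial.degree P' \<le> m" unfolding P'_def m by (rule degree_reduce) (use m n_def in simp)
        hence "Polynomial.degree P' < Polynomial.degree P" using m n_def by simp
        moreover have "poly_over G P'"
          unfolding P'_def using less(2) by (intro poly_over_ops[OF Gs]) (auto simp: poly_over_def)
        moreover have "Polynomial.coeff P' i \<notin> Z1" using i True by (auto simp: P'_def coeff_monom)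
        moreover have "poly P' a \<in> Z1" using less(4) True Z1D(1,2) by (simp add: P'_def poly_monom)
        ultimately show ?thesis using less(1) by blast
      qed
    qed
    moreover have "poly_over G P" using P(1) K0G by (auto simp: poly_over_def)
    ultimately show ?thesis using P by blast
  qed
  define d where "d = (LEAST n. \<exists>P. good n P)"
  obtain P where P: "good d P" using LeastI_ex[OF ex] unfolding d_def by blast
  have least: "d \<le> n" if "good n Q" for n Q unfolding d_def using that by (auto intro: Least_le)
  have d0: "d > 0"
  proof (rule ccontr)
    assume "\<not> ?thesis"
    hence "d = 0" by simp
    then obtain c where "P = [:c:]" using P unfolding good_def by (auto elim: degree_eq_zeroE)
    thus False using P \<open>d = 0\<close> unfolding good_def by auto
  qed
  note P' = P[unfolded good_def]
  have lcG: "Polynomial.coeff P d \<in> G" using P' by (simp add: poly_over_def)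
  obtain t where t: "t - a \<in> Z1" "poly P t \<in> Z2" using root[of P] P' d0 G12[OF lcG] by auto
  have Pt1: "poly P t \<in> Z1" using cong1[OF t(1)] P' by blast
  obtain u where u: "u \<in> G" "Polynomial.coeff P d * u - 1 \<in> Z1"
    using algebraic_inverse[OF Z1 Gs K0G inv lcG] P' alg by metis
  have main: "poly_over G Q \<Longrightarrow> Polynomial.degree Q \<le> n \<Longrightarrow> poly Q t \<in> Z1 \<Longrightarrow> poly Q t \<in> Z2" for Q n
  proof (induction n arbitrary: Q)
    case 0
    then obtain c where c: "Q = [:c:]" by (auto elim: degree_eq_zeroE)
    have "Polynomial.coeff Q 0 \<in> G" using 0(1) unfolding poly_over_def by blast
    thus ?case using 0 G12[of c] c by simp
  next
    case (Suc m)
    have red: "poly Q t \<in> Z2" if Q: "poly_over G Q" "Polynomial.degree Q \<le> Suc m" "poly Q t \<in> Z1" "Polynomial.coeff Q (Suc m) \<in> Z1" for Q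
    proof -
      define c where "c = Polynomial.coeff Q (Suc m)"
      have cG: "c \<in> G" using Q(1) by (simp add: c_def poly_over_def)
      have c2: "c \<in> Z2" using Q(4) G12[OF cG] by (simp add: c_def)
      define Q' where "Q' = Q - Polynomial.monom c (Suc m)"
      have "poly Q' t \<in> Z1" using Q(3,4) Z1D(1,2) by (simp add: Q'_def c_def poly_monom)
      moreover have "Polynomial.degree Q' \<le> m" unfolding Q'_def c_def by (rule degree_reduce[OF Q(2)])
      moreover have "poly_over G Q'" unfolding Q'_def using Q(1) cG by (intro poly_over_ops[OF Gs])
      ultimately have "poly Q' t \<in> Z2" using Suc.IH by blast
      moreover have "poly Q t = poly Q' t + c * t ^ Suc m" by (simp add: Q'_def poly_monom)
      ultimately show ?thesis using c2 Z2D(2,6) by metis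
    qed
    show ?case
    proof (cases "Polynomial.coeff Q (Suc m) \<in> Z1")
      case True thus ?thesis using red Suc.prems by blast
    next
      case False
      define c where "c = Polynomial.coeff Q (Suc m)"
      have c: "c \<in> G" "c \<notin> Z1" using Suc.prems(1) False by (auto simp: c_def poly_over_def)
      have "Polynomial.degree Q = Suc m"
        using Suc.prems(2) False Z1D(3) coeff_eq_0[of Q "Suc m"] by (metis le_neq_implies_less)
      moreover have "poly Q a \<in> Z1" using cong1[OF t(1)] Suc.prems(3) by blast
      ultimately have "good (Suc m) Q" using Suc.prems False unfolding good_def by blast
      hence dm: "d \<le> Suc m" by (rule least)
      \<comment> \<open>One step of polynomial division; \<open>u\<close> inverts the leading coefficient of \<open>P\<close> modulo \<open>Z1\<close>.\<close>
      define R where "R = Polynomial.monom (c * u) (Suc m - d) * P"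
      define Q' where "Q' = Q - R"
      have RG: "poly_over G R" unfolding R_def using c u P' GD(3) by (intro poly_over_ops[OF Gs]) auto
      have "Polynomial.degree R \<le> Suc m" unfolding R_def
        using degree_mult_le[of "Polynomial.monom (c * u) (Suc m - d)" P] degree_monom_le[of "c * u" "Suc m - d"] P' dm by linarith
      hence degQ': "Polynomial.degree Q' \<le> Suc m" unfolding Q'_def using Suc.prems(2) by (intro degree_diff_le) auto
      have "Polynomial.coeff R (Suc m) = (c * u) * Polynomial.coeff P d"
        unfolding R_def using dm by (simp add: coeff_monom_mult)
      hence "Polynomial.coeff Q' (Suc m) = - c * (Polynomial.coeff P d * u - 1)"
        by (simp add: Q'_def c_def algebra_simps)
      hence "Polynomial.coeff Q' (Suc m) \<in> Z1" using u Z1D(2) by metis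
      moreover have "poly R t \<in> Z1" "poly R t \<in> Z2" using Pt1 t(2) Z1D(2) Z2D(2) by (simp_all add: R_def)
      moreover have "poly_over G Q'" unfolding Q'_def using Suc.prems(1) RG by (rule poly_over_ops[OF Gs])
      ultimately have "poly Q' t \<in> Z2" using red[OF _ degQ'] Suc.prems(3) Z1D(1) by (simp add: Q'_def)
      moreover have "poly Q t = poly Q' t + poly R t" by (simp add: Q'_def)
      ultimately show ?thesis using Z2D(6) \<open>poly R t \<in> Z2\<close> by metis
    qed
  qed
  define G' where "G' = {poly Q t | Q. poly_over G Q}"
  have G's: "unital_subring G'" unfolding unital_subring_def
  proof (intro conjI ballI)
    have "poly_over G 1" using poly_over_ops(3)[OF Gs GD(1), of 0] by (simp add: monom_0 one_pCons)
    thus "1 \<in> G'" unfolding G'_def by (intro CollectI exI[of _ 1]) simp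
    fix x y assume "x \<in> G'" "y \<in> G'"
    then obtain A B where AB: "poly_over G A" "x = poly A t" "poly_over G B" "y = poly B t" unfolding G'_def by blast
    show "x - y \<in> G'" unfolding G'_def using AB poly_over_ops(1)[OF Gs AB(1,3)] by (intro CollectI exI[of _ "A - B"]) simp
    show "x * y \<in> G'" unfolding G'_def using AB poly_over_ops(2)[OF Gs AB(1,3)] by (intro CollectI exI[of _ "A * B"]) simp
  qed
  have GG': "G \<subseteq> G'"
  proof
    fix x assume "x \<in> G"
    hence "poly_over G (Polynomial.monom x 0)" by (rule poly_over_ops[OF Gs])
    moreover have "x = poly (Polynomial.monom x 0) t" by (simp add: poly_monom)
    ultimately show "x \<in> G'" unfolding G'_def by blast
  qed
  have tG': "t \<in> G'"
  proof -
    have "poly_over G (Polynomial.monom 1 1)" using GD(1) by (rule poly_over_ops[OF Gs])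
    moreover have "t = poly (Polynomial.monom 1 1) t" by (simp add: poly_monom)
    ultimately show ?thesis unfolding G'_def by blast
  qed
  have 12: "x \<in> Z2" if "x \<in> G'" "x \<in> Z1" for x using that main unfolding G'_def by blast
  have 21: "x \<in> Z1" if x: "x \<in> G'" "x \<in> Z2" for x
  proof (rule ccontr)
    assume n: "x \<notin> Z1"
    obtain y where y: "y \<in> G'" "x * y - 1 \<in> Z1"
      using algebraic_inverse[OF Z1 G's _ inv x(1) n] K0G GG' alg by (metis subset_trans)
    have "x * y - 1 \<in> G'" using unital_subringD[OF G's] x y by blast
    hence "x * y - 1 \<in> Z2" using 12 y by blast
    moreover have "x * y \<in> Z2" using x Z2D(2) by blast
    ultimately have "x * y - (x * y - 1) \<in> Z2" using Z2D(1) by blast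
    thus False using Z2D(4) by simp
  qed
  have "coherent K0 Z1 Z2 G'" unfolding coherent_def using K0G GG' G's 12 21 by blast
  thus ?thesis using GG' tG' t by blast
qed

lemma coherent_maximal:
  assumes "coherent K0 Z1 Z2 K0"
  shows "\<exists>G. coherent K0 Z1 Z2 G \<and> (\<forall>G'. coherent K0 Z1 Z2 G' \<longrightarrow> G \<subseteq> G' \<longrightarrow> G' = G)"
proof -
  have "\<exists>M\<in>{G. coherent K0 Z1 Z2 G}. \<forall>G\<in>{G. coherent K0 Z1 Z2 G}. M \<subseteq> G \<longrightarrow> G = M"
  proof (rule subset_Zorn_nonempty)
    show "{G. coherent K0 Z1 Z2 G} \<noteq> {}" using assms by blast
    fix C assume ne: "C \<noteq> {}" and C: "subset.chain {G. coherent K0 Z1 Z2 G} C"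
    have co: "coherent K0 Z1 Z2 G" if "G \<in> C" for G using C that unfolding subset.chain_def by blast
    have ch: "G \<subseteq> H \<or> H \<subseteq> G" if "G \<in> C" "H \<in> C" for G H using C that unfolding subset.chain_def by blast
    have sub: "unital_subring G" "K0 \<subseteq> G" "\<And>x. x \<in> G \<Longrightarrow> x \<in> Z1 \<longleftrightarrow> x \<in> Z2" if "G \<in> C" for G
      using co[OF that] unfolding coherent_def by auto
    have "unital_subring (\<Union>C)" unfolding unital_subring_def
    proof (intro conjI ballI)
      show "1 \<in> \<Union>C" using ne unital_subringD(1)[OF sub(1)] by blast
      fix x y assume "x \<in> \<Union>C" "y \<in> \<Union>C"
      then obtain G where G: "G \<in> C" "x \<in> G" "y \<in> G" using ch by blast
      show "x - y \<in> \<Union>C" "x * y \<in> \<Union>C" using unital_subringD(2,3)[OF sub(1)[OF G(1)] G(2,3)] G(1) by blast+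
    qed
    moreover have "K0 \<subseteq> \<Union>C" using ne sub(2) by blast
    moreover have "x \<in> Z1 \<longleftrightarrow> x \<in> Z2" if "x \<in> \<Union>C" for x using that sub(3) by blast
    ultimately show "\<Union>C \<in> {G. coherent K0 Z1 Z2 G}" unfolding coherent_def by simp
  qed
  thus ?thesis by blast
qed

text \<open>
  A ring homomorphism \<open>pi\<close> from a type into an algebraic closure \<open>W\<close> of \<open>k\<close>, with a subring
  \<open>K0\<close> that is mapped onto \<open>k\<close>.
\<close>
locale closure_projection =
  fixes W :: "'w ring" and k :: "'w set" and pi :: "'r::comm_ring_1 \<Rightarrow> 'w" and K0 :: "'r set"
  assumes W: "algebraic_closure W k"
    and pi_closed: "pi x \<in> carrier W" and pi_one: "pi 1 = \<one>\<^bsub>W\<^esub>"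
    and pi_add: "pi (x + y) = pi x \<oplus>\<^bsub>W\<^esub> pi y" and pi_mult: "pi (x * y) = pi x \<otimes>\<^bsub>W\<^esub> pi y"
    and K0: "unital_subring K0" and pi_K0: "pi ` K0 = k"
begin

sublocale W: algebraic_closure W k by (rule W)

abbreviation "ker \<equiv> {x. pi x = \<zero>\<^bsub>W\<^esub>}"

lemma pi_zero: "pi 0 = \<zero>\<^bsub>W\<^esub>"
proof -
  have "pi 0 \<oplus>\<^bsub>W\<^esub> pi 0 = pi 0" using pi_add[of 0 0] by simp
  thus ?thesis using pi_closed[of 0] W.add.r_cancel_one by simp
qed

lemma pi_uminus: "pi (- x) = \<ominus>\<^bsub>W\<^esub> pi x"
  using W.minus_equality[of "pi (- x)" "pi x"] pi_closed pi_add[of "- x" x] pi_zero by simp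

lemma pi_diff: "pi (x - y) = pi x \<ominus>\<^bsub>W\<^esub> pi y"
  using pi_add[of x "- y"] by (simp add: pi_uminus a_minus_def)

lemma pi_power: "pi (x ^ n) = pi x [^]\<^bsub>W\<^esub> n"
  by (induction n) (simp_all add: pi_one pi_mult pi_closed W.m_comm)

lemma prime_kernel_ker: "prime_kernel ker"
  unfolding prime_kernel_def
  using W.integral_iff pi_closed by (auto simp: pi_diff pi_mult pi_zero pi_one a_minus_def)

lemma inverse_K0:
  assumes c: "c \<in> K0" "c \<notin> ker"
  shows "\<exists>d\<in>K0. c * d - 1 \<in> ker"
proof -
  have "pi c \<in> k - {\<zero>\<^bsub>W\<^esub>}" using c pi_K0 by auto
  hence "inv\<^bsub>W\<^esub> (pi c) \<in> k - {\<zero>\<^bsub>W\<^esub>}" using W.subfield_m_inv(1)[OF W.subfield_axioms] by simp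
  then obtain d where d: "d \<in> K0" "pi d = inv\<^bsub>W\<^esub> (pi c)" using pi_K0 by (metis DiffD1 imageE)
  have "pi c \<otimes>\<^bsub>W\<^esub> pi d = \<one>\<^bsub>W\<^esub>"
    using \<open>pi c \<in> k - {\<zero>\<^bsub>W\<^esub>}\<close> d(2) W.subfield_m_inv(2)[OF W.subfield_axioms] by simp
  hence "c * d - 1 \<in> ker" by (simp add: pi_diff pi_mult pi_one a_minus_def W.r_neg)
  thus ?thesis using d(1) by blast
qed

lemma eval_rev:
  "pi (\<Sum>i<m. c i * t ^ i) = W.eval (rev (map (\<lambda>i. pi (c i)) [0..<m])) (pi t)"
proof (induction m)
  case (Suc m)
  have "pi (\<Sum>i<m. c i * t ^ i) \<in> carrier W" by (rule pi_closed)
  thus ?case using Suc by (simp add: pi_add pi_mult pi_power pi_closed W.a_comm)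
qed (simp add: pi_zero)

text \<open>
  Nonconstant polynomials over the type have roots in \<open>W\<close> after projection, as \<open>W\<close> is
  algebraically closed.
\<close>
lemma root_exists:
  assumes P: "Polynomial.degree P > 0" "Polynomial.coeff P (Polynomial.degree P) \<notin> ker"
  shows "\<exists>b\<in>carrier W. \<forall>t. pi t = b \<longrightarrow> poly P t \<in> ker"
proof -
  define n where "n = Polynomial.degree P"
  define q where "q = rev (map (\<lambda>i. pi (Polynomial.coeff P i)) [0..<Suc n])"
  have q: "q = pi (Polynomial.coeff P n) # rev (map (\<lambda>i. pi (Polynomial.coeff P i)) [0..<n])" by (simp add: q_def)
  have qc: "q \<in> carrier (poly_ring W)"
    unfolding univ_poly_carrier[symmetric] polynomial_def using P pi_closed by (auto simp: q n_def)
  have "W.splitted q" by (rule W.roots_over_carrier[OF qc])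
  hence "size (W.roots q) = length q - 1" by (simp add: W.splitted_def)
  hence "W.roots q \<noteq> {#}" using P(1) by (auto simp: q n_def)
  then obtain b where b: "b \<in># W.roots q" by blast
  hence root: "b \<in> carrier W" "W.eval q b = \<zero>\<^bsub>W\<^esub>"
    using W.roots_mem_iff_is_root[OF qc] unfolding W.is_root_def by auto
  have "poly P t \<in> ker" if "pi t = b" for t
  proof -
    have "poly P t = (\<Sum>i<Suc n. Polynomial.coeff P i * t ^ i)"
      unfolding n_def lessThan_Suc_atMost by (rule poly_altdef)
    thus ?thesis using eval_rev[of "Polynomial.coeff P" t "Suc n"] root(2) that by (simp add: q_def del: upt_Suc sum.lessThan_Suc)
  qed
  thus ?thesis using root(1) by blast
qed

lemma algebraic_poly:
  "\<exists>P. poly_over K0 P \<and> (\<exists>i. Polynomial.coeff P i \<notin> ker) \<and> poly P x \<in> ker"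
proof -
  have "(W.algebraic over k) (pi x)" by (rule W.algebraic_extension[OF pi_closed])
  then obtain q where q: "q \<in> carrier (k[X]\<^bsub>W\<^esub>)" "q \<noteq> []" "W.eval q (pi x) = \<zero>\<^bsub>W\<^esub>"
    using W.algebraicE[OF subfieldE(1)[OF W.subfield_axioms] pi_closed] by blast
  have poly: "set q \<subseteq> k" "hd q \<noteq> \<zero>\<^bsub>W\<^esub>" using q(1,2) unfolding univ_poly_carrier[symmetric] polynomial_def by auto
  have lift: "set p \<subseteq> k \<Longrightarrow> \<exists>P. poly_over K0 P \<and> (\<forall>i\<ge>length p. Polynomial.coeff P i = 0) \<and> pi (poly P x) = W.eval p (pi x) \<and>
     (p \<noteq> [] \<longrightarrow> pi (Polynomial.coeff P (length p - 1)) = hd p)" for p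
  proof (induction p)
    case Nil
    show ?case using unital_subringD(4)[OF K0] by (intro exI[of _ 0]) (simp add: poly_over_def pi_zero)
  next
    case (Cons c p)
    obtain P where P: "poly_over K0 P" "\<forall>i\<ge>length p. Polynomial.coeff P i = 0" "pi (poly P x) = W.eval p (pi x)"
      using Cons by auto
    obtain c' where c': "c' \<in> K0" "pi c' = c" using Cons(2) pi_K0 by (metis imageE list.set_intros(1) subsetD)
    define P' where "P' = P + Polynomial.monom c' (length p)"
    have "poly_over K0 P'" using P(1) c'(1) unital_subringD(6,4)[OF K0] by (auto simp: P'_def poly_over_def coeff_monom)
    moreover have "pi (poly P' x) = W.eval (c # p) (pi x)"
      using P(3) c'(2) pi_closed[of "poly P x"] pi_closed[of c'] pi_closed[of x]
      by (simp add: P'_def poly_monom pi_add pi_mult pi_power W.a_comm)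
    ultimately show ?case using P(2) c' by (intro exI[of _ P']) (auto simp: P'_def coeff_monom)
  qed
  obtain P where P: "poly_over K0 P" "pi (poly P x) = W.eval q (pi x)" "pi (Polynomial.coeff P (length q - 1)) = hd q"
    using lift[OF poly(1)] q(2) by blast
  have "Polynomial.coeff P (length q - 1) \<notin> ker" using P(3) poly(2) by simp
  moreover have "poly P x \<in> ker" using P(2) q(3) by simp
  ultimately show ?thesis using P(1) by (intro exI[of _ P] conjI exI[of _ "length q - 1"])
qed

end

text \<open>
  Let the type project onto the product ring of \<open>W1\<close> and \<open>W2\<close>, and let \<open>K0\<close> be the preimage
  of the graph of \<open>f\<close>. A maximal coherent subring \<open>G\<close> over \<open>K0\<close> is the preimage of the graph
  of an isomorphism that extends \<open>f\<close>; it projects onto \<open>W1\<close> and onto \<open>W2\<close>, since otherwise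
  \<open>coherent_extend\<close> would enlarge it.
\<close>
theorem algebraic_closure_unique:
  fixes W1 :: "'a ring" and W2 :: "'b ring"
  assumes W1: "algebraic_closure W1 k1" and W2: "algebraic_closure W2 k2"
    and f: "bij_betw f k1 k2" "\<And>x y. x \<in> k1 \<Longrightarrow> y \<in> k1 \<Longrightarrow> f (x \<oplus>\<^bsub>W1\<^esub> y) = f x \<oplus>\<^bsub>W2\<^esub> f y"
      "\<And>x y. x \<in> k1 \<Longrightarrow> y \<in> k1 \<Longrightarrow> f (x \<otimes>\<^bsub>W1\<^esub> y) = f x \<otimes>\<^bsub>W2\<^esub> f y"
  shows "\<exists>\<Phi>\<in>ring_iso W1 W2. \<forall>x\<in>k1. \<Phi> x = f x"
proof -
  interpret W1: algebraic_closure W1 k1 by (rule W1)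
  interpret W2: algebraic_closure W2 k2 by (rule W2)
  define R where "R = RDirProd W1 W2"
  have Rc: "carrier R = carrier W1 \<times> carrier W2" by (simp add: R_def RDirProd_carrier)
  have Rops: "\<one>\<^bsub>R\<^esub> = (\<one>\<^bsub>W1\<^esub>, \<one>\<^bsub>W2\<^esub>)"
    "x \<oplus>\<^bsub>R\<^esub> y = (fst x \<oplus>\<^bsub>W1\<^esub> fst y, snd x \<oplus>\<^bsub>W2\<^esub> snd y)"
    "x \<otimes>\<^bsub>R\<^esub> y = (fst x \<otimes>\<^bsub>W1\<^esub> fst y, snd x \<otimes>\<^bsub>W2\<^esub> snd y)" for x y
    by (cases x; cases y; simp add: R_def RDirProd_def DirProd_def monoid.defs)+
  have cr: "cring R"
  proof (rule cring.intro)
    show "ring R" unfolding R_def by (rule RDirProd_ring[OF W1.ring_axioms W2.ring_axioms])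
    then interpret ring R .
    show "comm_monoid R"
      by (rule monoid.monoid_comm_monoidI[OF monoid_axioms]) (auto simp: Rc Rops W1.m_comm W2.m_comm)
  qed
  define p1 where "p1 x = fst (dn R x)" for x
  define p2 where "p2 x = snd (dn R x)" for x
  have pc: "p1 x \<in> carrier W1" "p2 x \<in> carrier W2" for x using dn_carrier[OF cr, of x] by (auto simp: p1_def p2_def Rc)
  have ph: "p1 1 = \<one>\<^bsub>W1\<^esub>" "p2 1 = \<one>\<^bsub>W2\<^esub>" "p1 (x + y) = p1 x \<oplus>\<^bsub>W1\<^esub> p1 y" "p2 (x + y) = p2 x \<oplus>\<^bsub>W2\<^esub> p2 y"
    "p1 (x * y) = p1 x \<otimes>\<^bsub>W1\<^esub> p1 y" "p2 (x * y) = p2 x \<otimes>\<^bsub>W2\<^esub> p2 y" for x y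
    by (simp_all add: p1_def p2_def dn_ops[OF cr] Rops)
  have p_up: "\<exists>x. p1 x = a \<and> p2 x = b" if "a \<in> carrier W1" "b \<in> carrier W2" for a b
    using that dn_up[OF cr, of "(a, b)"] by (intro exI[of _ "up R (a, b)"]) (simp add: p1_def p2_def Rc)
  have k1c: "k1 \<subseteq> carrier W1" and k2c: "k2 \<subseteq> carrier W2" using W1.subset W2.subset by auto
  have fk: "f x \<in> k2" if "x \<in> k1" for x using f(1) that bij_betwE by blast
  define K0 where "K0 = {x. p1 x \<in> k1 \<and> p2 x = f (p1 x)}"
  have f1: "f \<one>\<^bsub>W1\<^esub> = \<one>\<^bsub>W2\<^esub>"
  proof -
    have one: "\<one>\<^bsub>W1\<^esub> \<in> k1" by (rule W1.one_closed)
    have sq: "f \<one>\<^bsub>W1\<^esub> \<otimes>\<^bsub>W2\<^esub> f \<one>\<^bsub>W1\<^esub> = f \<one>\<^bsub>W1\<^esub>" using f(3)[OF one one] by simp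
    obtain y where y: "y \<in> k1" "f y = \<one>\<^bsub>W2\<^esub>" using f(1) W2.one_closed unfolding bij_betw_def by (metis imageE)
    have "f y = f \<one>\<^bsub>W1\<^esub> \<otimes>\<^bsub>W2\<^esub> f y" using f(3)[OF one y(1)] y(1) k1c by auto
    thus ?thesis using y(2) fk[OF one] k2c by auto
  qed
  have z1: "\<zero>\<^bsub>W1\<^esub> \<in> k1" using subringE(2)[OF subfieldE(1)[OF W1.subfield_axioms]] .
  have f0: "f \<zero>\<^bsub>W1\<^esub> = \<zero>\<^bsub>W2\<^esub>"
  proof -
    note z = z1
    have "f \<zero>\<^bsub>W1\<^esub> \<oplus>\<^bsub>W2\<^esub> f \<zero>\<^bsub>W1\<^esub> = f \<zero>\<^bsub>W1\<^esub>" using f(2)[OF z z] by simp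
    thus ?thesis using fk[OF z] k2c W2.add.r_cancel_one by auto
  qed
  have K0sub: "unital_subring K0"
  proof -
    have K0m: "1 \<in> K0" using f1 by (simp add: K0_def ph)
    have neg: "- x \<in> K0" if x: "x \<in> K0" for x
    proof -
      have p10: "p1 0 = \<zero>\<^bsub>W1\<^esub>" using ph(3)[of 0 0] pc(1)[of 0] W1.add.r_cancel_one by simp
      have p20: "p2 0 = \<zero>\<^bsub>W2\<^esub>" using ph(4)[of 0 0] pc(2)[of 0] W2.add.r_cancel_one by simp
      have n1: "p1 (- x) = \<ominus>\<^bsub>W1\<^esub> p1 x" using ph(3)[of "- x" x] pc p10 by (simp add: W1.minus_equality)
      have xk: "p1 x \<in> k1" "p2 x = f (p1 x)" using x by (auto simp: K0_def)
      have mk: "\<ominus>\<^bsub>W1\<^esub> p1 x \<in> k1" using subringE(5)[OF subfieldE(1)[OF W1.subfield_axioms]] xk by blast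
      have "f (p1 (- x)) \<oplus>\<^bsub>W2\<^esub> p2 x = \<zero>\<^bsub>W2\<^esub>"
        using f(2)[OF mk xk(1)] f0 pc(1)[of x] by (simp add: n1 xk(2) W1.l_neg)
      moreover have "p2 (- x) \<oplus>\<^bsub>W2\<^esub> p2 x = \<zero>\<^bsub>W2\<^esub>" using ph(4)[of "- x" x] p20 by simp
      moreover have "f (p1 (- x)) \<in> carrier W2" using fk[OF mk] k2c n1 by auto
      ultimately have "p2 (- x) = f (p1 (- x))" using pc(2) by (metis W2.add.right_cancel)
      thus ?thesis using mk n1 by (simp add: K0_def)
    qed
    have add: "x + y \<in> K0" "x * y \<in> K0" if "x \<in> K0" "y \<in> K0" for x y
      using that f(2,3) subringE(6,7)[OF subfieldE(1)[OF W1.subfield_axioms]] by (auto simp: K0_def ph)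
    show ?thesis unfolding unital_subring_def using K0m add neg by (metis diff_conv_add_uminus)
  qed
  have im1: "p1 ` K0 = k1"
  proof
    show "k1 \<subseteq> p1 ` K0"
    proof
      fix x assume x: "x \<in> k1"
      then obtain z where "p1 z = x" "p2 z = f x" using p_up[of x "f x"] fk[OF x] k1c k2c by auto
      thus "x \<in> p1 ` K0" using x by (auto simp: K0_def image_iff)
    qed
  qed (auto simp: K0_def)
  have im2: "p2 ` K0 = k2"
  proof
    show "k2 \<subseteq> p2 ` K0"
    proof
      fix y assume "y \<in> k2"
      then obtain x where x: "x \<in> k1" "y = f x" using f(1) unfolding bij_betw_def by blast
      then obtain z where "p1 z = x" "p2 z = f x" using p_up[of x "f x"] fk[OF x(1)] k1c k2c by auto
      thus "y \<in> p2 ` K0" using x by (auto simp: K0_def image_iff)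
    qed
  qed (auto simp: K0_def fk)
  interpret P1: closure_projection W1 k1 p1 K0 by unfold_locales (use pc ph K0sub im1 in auto)
  interpret P2: closure_projection W2 k2 p2 K0 by unfold_locales (use pc ph K0sub im2 in auto)
  have co0: "coherent K0 P1.ker P2.ker K0"
  proof -
    have "p1 x = \<zero>\<^bsub>W1\<^esub> \<longleftrightarrow> p2 x = \<zero>\<^bsub>W2\<^esub>" if "x \<in> K0" for x
    proof -
      have "p1 x \<in> k1" "p2 x = f (p1 x)" using that by (auto simp: K0_def)
      thus ?thesis using f0 z1 inj_onD[OF bij_betw_imp_inj_on[OF f(1)], of "p1 x" "\<zero>\<^bsub>W1\<^esub>"] by metis
    qed
    thus ?thesis unfolding coherent_def using K0sub by auto
  qed
  obtain G where G: "coherent K0 P1.ker P2.ker G"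
    and max: "\<And>G'. coherent K0 P1.ker P2.ker G' \<Longrightarrow> G \<subseteq> G' \<Longrightarrow> G' = G"
    using coherent_maximal[OF co0] by blast
  have Gs: "unital_subring G" and K0G: "K0 \<subseteq> G" and G12: "\<And>x. x \<in> G \<Longrightarrow> p1 x = \<zero>\<^bsub>W1\<^esub> \<longleftrightarrow> p2 x = \<zero>\<^bsub>W2\<^esub>"
    using G unfolding coherent_def by auto
  note GD = unital_subringD[OF Gs]
  have surj1: "\<exists>t\<in>G. p1 t = a" if a: "a \<in> carrier W1" for a
  proof -
    obtain a' where a': "p1 a' = a" using p_up[OF a W2.zero_closed] W2.subset by auto
    have "\<exists>t. t - a' \<in> P1.ker \<and> poly P t \<in> P2.ker"
      if P: "Polynomial.degree P > 0" "Polynomial.coeff P (Polynomial.degree P) \<notin> P2.ker" for P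
    proof -
      obtain b where b: "b \<in> carrier W2" "\<forall>t. p2 t = b \<longrightarrow> poly P t \<in> P2.ker" using P2.root_exists[OF P] by blast
      obtain t where "p1 t = a" "p2 t = b" using p_up[OF a b(1)] by blast
      thus ?thesis using a' b(2) a by (intro exI[of _ t]) (simp add: P1.pi_diff a_minus_def W1.r_neg)
    qed
    from coherent_extend[OF P1.prime_kernel_ker P2.prime_kernel_ker G P1.inverse_K0 P1.algebraic_poly this]
    obtain t G' where "coherent K0 P1.ker P2.ker G'" "G \<subseteq> G'" "t \<in> G'" "t - a' \<in> P1.ker" by blast
    thus ?thesis using max a' a pc(1)[of t] by (auto simp: P1.pi_diff)
  qed
  have surj2: "\<exists>t\<in>G. p2 t = a" if a: "a \<in> carrier W2" for a
  proof -
    obtain a' where a': "p2 a' = a" using p_up[OF _ a] W1.zero_closed W1.subset by blast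
    have "\<exists>t. t - a' \<in> P2.ker \<and> poly P t \<in> P1.ker"
      if P: "Polynomial.degree P > 0" "Polynomial.coeff P (Polynomial.degree P) \<notin> P1.ker" for P
    proof -
      obtain b where b: "b \<in> carrier W1" "\<forall>t. p1 t = b \<longrightarrow> poly P t \<in> P1.ker" using P1.root_exists[OF P] by blast
      obtain t where "p1 t = b" "p2 t = a" using p_up[OF b(1) a] by blast
      thus ?thesis using a' b(2) a by (intro exI[of _ t]) (simp add: P2.pi_diff a_minus_def W2.r_neg)
    qed
    from coherent_extend[OF P2.prime_kernel_ker P1.prime_kernel_ker coherent_swap[THEN iffD1, OF G] P2.inverse_K0 P2.algebraic_poly this]
    obtain t G' where "coherent K0 P2.ker P1.ker G'" "G \<subseteq> G'" "t \<in> G'" "t - a' \<in> P2.ker" by blast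
    moreover have "G' = G" using max[OF coherent_swap[THEN iffD1]] calculation(1,2) by blast
    ultimately show ?thesis using a' a pc(2)[of t] by (auto simp: P2.pi_diff)
  qed
  have eq: "p1 s = p1 t \<longleftrightarrow> p2 s = p2 t" if "s \<in> G" "t \<in> G" for s t
    using G12[OF GD(2)[OF that]] pc by (simp add: P1.pi_diff P2.pi_diff)
  define \<Phi> where "\<Phi> a = p2 (SOME t. t \<in> G \<and> p1 t = a)" for a
  have \<Phi>: "\<Phi> (p1 t) = p2 t" if "t \<in> G" for t
  proof -
    have "(SOME s. s \<in> G \<and> p1 s = p1 t) \<in> G \<and> p1 (SOME s. s \<in> G \<and> p1 s = p1 t) = p1 t"
      by (rule someI[of _ t]) (use that in simp)
    thus ?thesis unfolding \<Phi>_def using eq that by blast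
  qed
  have "\<Phi> \<in> ring_iso W1 W2"
  proof (rule ring_iso_memI)
    fix x assume "x \<in> carrier W1"
    then obtain s where s: "s \<in> G" "p1 s = x" using surj1 by blast
    show "\<Phi> x \<in> carrier W2" using \<Phi>[OF s(1)] s pc by auto
    fix y assume "y \<in> carrier W1"
    then obtain t where t: "t \<in> G" "p1 t = y" using surj1 by blast
    show "\<Phi> (x \<otimes>\<^bsub>W1\<^esub> y) = \<Phi> x \<otimes>\<^bsub>W2\<^esub> \<Phi> y"
      using \<Phi>[OF s(1)] \<Phi>[OF t(1)] \<Phi>[OF GD(3)[OF s(1) t(1)]] s t by (simp add: ph)
    show "\<Phi> (x \<oplus>\<^bsub>W1\<^esub> y) = \<Phi> x \<oplus>\<^bsub>W2\<^esub> \<Phi> y"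
      using \<Phi>[OF s(1)] \<Phi>[OF t(1)] \<Phi>[OF GD(6)[OF s(1) t(1)]] s t by (simp add: ph)
  next
    show "\<Phi> \<one>\<^bsub>W1\<^esub> = \<one>\<^bsub>W2\<^esub>" using \<Phi>[OF GD(1)] by (simp add: ph)
    show "bij_betw \<Phi> (carrier W1) (carrier W2)" unfolding bij_betw_def
    proof
      show "inj_on \<Phi> (carrier W1)"
      proof (rule inj_onI)
        fix x y assume "x \<in> carrier W1" "y \<in> carrier W1" and e: "\<Phi> x = \<Phi> y"
        then obtain s t where st: "s \<in> G" "p1 s = x" "t \<in> G" "p1 t = y" using surj1 by meson
        have "p2 s = p2 t" using e \<Phi>[OF st(1)] \<Phi>[OF st(3)] st by simp
        thus "x = y" using eq[OF st(1,3)] st by simp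
      qed
      show "\<Phi> ` carrier W1 = carrier W2"
      proof
        show "\<Phi> ` carrier W1 \<subseteq> carrier W2"
        proof
          fix y assume "y \<in> \<Phi> ` carrier W1"
          then obtain s where "s \<in> G" "y = \<Phi> (p1 s)" using surj1 by blast
          thus "y \<in> carrier W2" using \<Phi> pc by simp
        qed
        show "carrier W2 \<subseteq> \<Phi> ` carrier W1"
        proof
          fix y assume "y \<in> carrier W2"
          then obtain s where s: "s \<in> G" "p2 s = y" using surj2 by blast
          hence "y = \<Phi> (p1 s)" using \<Phi> by simp
          thus "y \<in> \<Phi> ` carrier W1" using pc by blast
        qed
      qed
    qed
  qed
  moreover have "\<Phi> x = f x" if x: "x \<in> k1" for x
  proof -
    have "x \<in> p1 ` K0" using im1 x by simp
    then obtain t where t: "t \<in> K0" "p1 t = x" by blast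
    have "\<Phi> (p1 t) = p2 t" using \<Phi> K0G t(1) by blast
    thus ?thesis using t by (simp add: K0_def)
  qed
  ultimately show ?thesis by blast
qed

section \<open>Isomorphic fields are anabelomorphic\<close>

text \<open>
  The automorphisms of \<open>W\<close> over \<open>k\<close> and the basic open sets of their Krull topology, for an
  arbitrary ring \<open>W\<close> in place of the algebraic closure of a field.
\<close>
definition galois_set :: "('w, 'm) ring_scheme \<Rightarrow> 'w set \<Rightarrow> ('w \<Rightarrow> 'w) set" where
  "galois_set W k = {\<sigma> \<in> Bij (carrier W). \<sigma> \<in> ring_iso W W \<and> (\<forall>x\<in>k. \<sigma> x = x)}"

definition galois_basis :: "('w, 'm) ring_scheme \<Rightarrow> 'w set \<Rightarrow> ('w \<Rightarrow> 'w) set set" where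
  "galois_basis W k = {{\<tau> \<in> galois_set W k. \<forall>x\<in>E. \<tau> x = \<sigma> x} | \<sigma> E.
     \<sigma> \<in> galois_set W k \<and> subfield E W \<and> k \<subseteq> E \<and> ring.finite_dimension W k E}"

lemma carrier_abs_galois_group: "carrier (abs_galois_group F) = galois_set (field.alg_closure F) (base_image F)"
  by (simp add: abs_galois_group_def galois_set_def)

lemma krull_topology_eq: "krull_topology F = topology_generated_by (galois_basis (field.alg_closure F) (base_image F))"
  unfolding krull_topology_def galois_basis_def carrier_abs_galois_group ..

lemma mult_abs_galois_group:
  "\<sigma> \<in> carrier (abs_galois_group F) \<Longrightarrow> \<tau> \<in> carrier (abs_galois_group F) \<Longrightarrow>
   \<sigma> \<otimes>\<^bsub>abs_galois_group F\<^esub> \<tau> = compose (carrier (field.alg_closure F)) \<sigma> \<tau>"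
  by (simp add: abs_galois_group_def BijGroup_def)

lemma galois_set_closed: "\<sigma> \<in> galois_set W k \<Longrightarrow> x \<in> carrier W \<Longrightarrow> \<sigma> x \<in> carrier W"
  unfolding galois_set_def by (auto dest: ring_iso_memE(1))

text \<open>An isomorphism \<open>\<Phi>\<close> between two fields, with inverse \<open>\<Theta>\<close>, that maps a subfield \<open>k1\<close> onto \<open>k2\<close>.\<close>
locale closure_iso =
  fixes W1 :: "'a ring" and W2 :: "'b ring" and k1 k2 \<Phi> \<Theta>
  assumes W1: "field W1" and W2: "field W2"
    and \<Phi>: "\<Phi> \<in> ring_iso W1 W2" and \<Theta>: "\<Theta> \<in> ring_iso W2 W1"
    and \<Theta>\<Phi>: "\<And>x. x \<in> carrier W1 \<Longrightarrow> \<Theta> (\<Phi> x) = x" and \<Phi>\<Theta>: "\<And>y. y \<in> carrier W2 \<Longrightarrow> \<Phi> (\<Theta> y) = y"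
    and k1: "subfield k1 W1" and k2: "subfield k2 W2" and image: "\<Phi> ` k1 = k2"
begin

text \<open>Transport of automorphisms by conjugation with \<open>\<Phi>\<close>, restricted to the carrier.\<close>
definition conj :: "('a \<Rightarrow> 'a) \<Rightarrow> 'b \<Rightarrow> 'b" where
  "conj \<sigma> = (\<lambda>y\<in>carrier W2. \<Phi> (\<sigma> (\<Theta> y)))"

lemma \<Phi>_closed: "x \<in> carrier W1 \<Longrightarrow> \<Phi> x \<in> carrier W2" and \<Theta>_closed: "y \<in> carrier W2 \<Longrightarrow> \<Theta> y \<in> carrier W1"
  using ring_iso_memE(1)[OF \<Phi>] ring_iso_memE(1)[OF \<Theta>] by auto

lemma k1c: "k1 \<subseteq> carrier W1" using subfieldE(3)[OF k1] .
lemma k2c: "k2 \<subseteq> carrier W2" using subfieldE(3)[OF k2] .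

lemma image': "\<Theta> ` k2 = k1"
  using image \<Theta>\<Phi> k1c by (force simp: image_iff)

lemma conj_galois:
  assumes \<sigma>: "\<sigma> \<in> galois_set W1 k1"
  shows "conj \<sigma> \<in> galois_set W2 k2"
proof -
  have s: "\<sigma> \<in> ring_iso W1 W1" "\<forall>x\<in>k1. \<sigma> x = x" "\<sigma> \<in> Bij (carrier W1)" using \<sigma> by (auto simp: galois_set_def)
  have "\<Phi> \<circ> (\<sigma> \<circ> \<Theta>) \<in> ring_iso W2 W2"
    using ring_iso_set_trans[OF ring_iso_set_trans[OF \<Theta> s(1)] \<Phi>] by simp
  hence iso: "conj \<sigma> \<in> ring_iso W2 W2"
    by (rule ring.ring_iso_restrict[OF field.is_ring[OF W2]]) (simp add: conj_def)
  have "conj \<sigma> \<in> Bij (carrier W2)"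
    using ring_iso_memE(5)[OF iso] by (simp add: Bij_def conj_def)
  moreover have "conj \<sigma> y = y" if "y \<in> k2" for y
  proof -
    have "\<Theta> y \<in> k1" using image' that by blast
    thus ?thesis using s(2) that k2c \<Phi>\<Theta> by (auto simp: conj_def)
  qed
  ultimately show ?thesis using iso by (auto simp: galois_set_def)
qed

lemma conj_compose:
  assumes "\<sigma> \<in> galois_set W1 k1" "\<tau> \<in> galois_set W1 k1"
  shows "conj (compose (carrier W1) \<sigma> \<tau>) = compose (carrier W2) (conj \<sigma>) (conj \<tau>)"
proof
  fix y
  have t: "\<tau> x \<in> carrier W1" if "x \<in> carrier W1" for x
    using galois_set_closed[OF assms(2) that] .
  show "conj (compose (carrier W1) \<sigma> \<tau>) y = compose (carrier W2) (conj \<sigma>) (conj \<tau>) y"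
  proof (cases "y \<in> carrier W2")
    case True
    have "\<Theta> (\<Phi> (\<tau> (\<Theta> y))) = \<tau> (\<Theta> y)" using \<Theta>\<Phi> t \<Theta>_closed[OF True] by blast
    thus ?thesis using True \<Theta>_closed[OF True] \<Phi>_closed[OF t[OF \<Theta>_closed[OF True]]] by (simp add: conj_def compose_eq)
  qed (simp add: conj_def compose_def)
qed

lemma swap: "closure_iso W2 W1 k2 k1 \<Theta> \<Phi>"
  by (rule closure_iso.intro[OF W2 W1 \<Theta> \<Phi> \<Phi>\<Theta> \<Theta>\<Phi> k2 k1 image'])

end

lemma (in closure_iso) conj_conj:
  assumes "\<sigma> \<in> galois_set W1 k1"
  shows "closure_iso.conj W1 \<Theta> \<Phi> (conj \<sigma>) = \<sigma>"
proof -
  interpret S: closure_iso W2 W1 k2 k1 \<Theta> \<Phi> by (rule swap)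
  have ext: "\<sigma> \<in> extensional (carrier W1)" and iso: "\<sigma> \<in> ring_iso W1 W1" using assms by (auto simp: galois_set_def Bij_def)
  show ?thesis
  proof
    fix x
    show "S.conj (conj \<sigma>) x = \<sigma> x"
      using ext ring_iso_memE(1)[OF iso] by (cases "x \<in> carrier W1") (auto simp: S.conj_def conj_def \<Phi>_closed \<Theta>\<Phi> extensional_def)
  qed
qed

lemma finite_dimension_image:
  assumes "field R" "field S" "h \<in> ring_hom R S" "E \<subseteq> carrier R" "ring.finite_dimension R k E" "subfield k R"
  shows "ring.finite_dimension S (h ` k) (h ` E)"
proof -
  interpret R: field R by fact
  interpret S: field S by fact
  interpret h: ring_hom_ring R S h by (rule ring_hom_ringI2[OF R.ring_axioms S.ring_axioms assms(3)])
  have "inj_on h E" using non_trivial_field_hom_is_inj[OF assms(3,1,2)] assms(4) by (rule inj_on_subset)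
  thus ?thesis using h.inj_hom_dimension[OF assms(6) S.one_not_zero] assms(5)
    unfolding R.finite_dimension_def S.finite_dimension_def by blast
qed

context closure_iso
begin

text \<open>The preimage of a coset of the group fixing \<open>E\<close> is a coset of the group fixing \<open>\<Theta> ` E\<close>.\<close>
lemma conj_preimage_basis:
  assumes U: "U \<in> galois_basis W2 k2"
  shows "{\<tau> \<in> galois_set W1 k1. conj \<tau> \<in> U} \<in> galois_basis W1 k1"
proof -
  interpret S: closure_iso W2 W1 k2 k1 \<Theta> \<Phi> by (rule swap)
  obtain \<sigma> E where \<sigma>: "\<sigma> \<in> galois_set W2 k2" and E: "subfield E W2" "k2 \<subseteq> E" "ring.finite_dimension W2 k2 E"
    and Ueq: "U = {\<tau> \<in> galois_set W2 k2. \<forall>x\<in>E. \<tau> x = \<sigma> x}"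
    using U unfolding galois_basis_def by blast
  have Ec: "E \<subseteq> carrier W2" using subfieldE(3)[OF E(1)] .
  have \<Theta>h: "\<Theta> \<in> ring_hom W2 W1" using \<Theta> by (simp add: ring_iso_def)
  have "ring_hom_ring W2 W1 \<Theta>" by (rule ring_hom_ringI2[OF field.is_ring[OF W2] field.is_ring[OF W1] \<Theta>h])
  hence 1: "subfield (\<Theta> ` E) W1"
    using ring_hom_ring.img_is_subfield(2)[of W2 W1 \<Theta> E] E(1) domain.one_not_zero[OF field.axioms(1)[OF W1]] by blast
  have 2: "k1 \<subseteq> \<Theta> ` E" using image' E(2) by blast
  have 3: "ring.finite_dimension W1 k1 (\<Theta> ` E)"
    using finite_dimension_image[OF W2 W1 \<Theta>h Ec E(3) k2] image' by simp
  have "{\<tau> \<in> galois_set W1 k1. conj \<tau> \<in> U} = {\<tau> \<in> galois_set W1 k1. \<forall>x\<in>\<Theta> ` E. \<tau> x = S.conj \<sigma> x}"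
  proof -
    have "conj \<tau> \<in> U \<longleftrightarrow> (\<forall>x\<in>\<Theta> ` E. \<tau> x = S.conj \<sigma> x)" if \<tau>: "\<tau> \<in> galois_set W1 k1" for \<tau>
    proof -
      have "conj \<tau> y = \<sigma> y \<longleftrightarrow> \<tau> (\<Theta> y) = S.conj \<sigma> (\<Theta> y)" if "y \<in> E" for y
      proof -
        have y: "y \<in> carrier W2" using that Ec by blast
        have t: "\<tau> (\<Theta> y) \<in> carrier W1" "\<sigma> y \<in> carrier W2"
          using galois_set_closed[OF \<tau> \<Theta>_closed[OF y]] galois_set_closed[OF \<sigma> y] .
        have "\<Phi> (\<tau> (\<Theta> y)) = \<sigma> y \<longleftrightarrow> \<tau> (\<Theta> y) = \<Theta> (\<sigma> y)" using \<Theta>\<Phi>[OF t(1)] \<Phi>\<Theta>[OF t(2)] by metis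
        thus ?thesis using y by (simp add: conj_def S.conj_def \<Theta>_closed \<Phi>\<Theta>)
      qed
      thus ?thesis using conj_galois[OF \<tau>] unfolding Ueq by auto
    qed
    thus ?thesis by blast
  qed
  thus ?thesis unfolding galois_basis_def using S.conj_galois[OF \<sigma>] 1 2 3 by blast
qed

lemma galois_basis_Union: "\<Union>(galois_basis W1 k1) = galois_set W1 k1"
proof
  interpret W1: field W1 by (rule W1)
  have "ring.finite_dimension W1 k1 k1" using W1.dimension_one[OF k1] W1.finite_dimensionI by blast
  hence "{\<tau> \<in> galois_set W1 k1. \<forall>x\<in>k1. \<tau> x = \<sigma> x} \<in> galois_basis W1 k1" if "\<sigma> \<in> galois_set W1 k1" for \<sigma>
    unfolding galois_basis_def using that k1 by blast
  thus "galois_set W1 k1 \<subseteq> \<Union>(galois_basis W1 k1)" by blast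
qed (auto simp: galois_basis_def)

lemma conj_continuous:
  "continuous_map (topology_generated_by (galois_basis W1 k1)) (topology_generated_by (galois_basis W2 k2)) conj"
proof (rule continuous_on_generated_topo)
  interpret S: closure_iso W2 W1 k2 k1 \<Theta> \<Phi> by (rule swap)
  fix U assume U: "U \<in> galois_basis W2 k2"
  have "conj -` U \<inter> topspace (topology_generated_by (galois_basis W1 k1)) = {\<tau> \<in> galois_set W1 k1. conj \<tau> \<in> U}"
    by (auto simp: topology_generated_by_topspace galois_basis_Union)
  thus "openin (topology_generated_by (galois_basis W1 k1)) (conj -` U \<inter> topspace (topology_generated_by (galois_basis W1 k1)))"
    using topology_generated_by_Basis[OF conj_preimage_basis[OF U]] by simp
next
  interpret S: closure_iso W2 W1 k2 k1 \<Theta> \<Phi> by (rule swap)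
  show "conj ` topspace (topology_generated_by (galois_basis W1 k1)) \<subseteq> \<Union>(galois_basis W2 k2)"
    unfolding topology_generated_by_topspace galois_basis_Union S.galois_basis_Union using conj_galois by blast
qed

lemma conj_homeomorphic:
  "homeomorphic_map (topology_generated_by (galois_basis W1 k1)) (topology_generated_by (galois_basis W2 k2)) conj"
proof -
  interpret S: closure_iso W2 W1 k2 k1 \<Theta> \<Phi> by (rule swap)
  show ?thesis unfolding homeomorphic_map_maps homeomorphic_maps_def
    using conj_continuous S.conj_continuous conj_conj S.conj_conj galois_basis_Union S.galois_basis_Union
    by (intro exI[of _ S.conj]) (simp add: topology_generated_by_topspace)
qed

lemma conj_bij: "bij_betw conj (galois_set W1 k1) (galois_set W2 k2)"
proof -
  interpret S: closure_iso W2 W1 k2 k1 \<Theta> \<Phi> by (rule swap)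
  show ?thesis by (rule bij_betwI[of _ _ _ S.conj]) (auto simp: conj_galois S.conj_galois conj_conj S.conj_conj)
qed

end

theorem ring_iso_imp_anabelomorphic:
  fixes F :: "'a ring" and E :: "'b ring"
  assumes F: "field F" and E: "field E" and \<psi>: "\<psi> \<in> ring_iso F E"
  shows "anabelomorphic F E"
proof -
  interpret F: field F by (rule F)
  interpret E: field E by (rule E)
  define ic1 :: "'a \<Rightarrow> ('a list \<times> nat) multiset \<Rightarrow> 'a" where "ic1 = F.indexed_const"
  define ic2 :: "'b \<Rightarrow> ('b list \<times> nat) multiset \<Rightarrow> 'b" where "ic2 = E.indexed_const"
  note c1 = F.alg_closureE[folded ic1_def] and c2 = E.alg_closureE[folded ic2_def]
  note bi = base_image_def[of F, folded ic1_def] base_image_def[of E, folded ic2_def]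
  interpret W1: algebraic_closure F.alg_closure "ic1 ` carrier F" by (rule c1(1))
  interpret W2: algebraic_closure E.alg_closure "ic2 ` carrier E" by (rule c2(1))
  note i1 = ring_hom_memE[OF c1(2)] and i2 = ring_hom_memE[OF c2(2)] and ps = ring_iso_memE[OF \<psi>]
  have inj1: "inj_on ic1 (carrier F)" and inj2: "inj_on ic2 (carrier E)"
    unfolding ic1_def ic2_def by (rule F.indexed_const_inj_on, rule E.indexed_const_inj_on)
  \<comment> \<open>The isomorphism \<open>\<psi>\<close>, read on the images of \<open>F\<close> and \<open>E\<close> in their algebraic closures.\<close>
  define f :: "(('a list \<times> nat) multiset \<Rightarrow> 'a) \<Rightarrow> ('b list \<times> nat) multiset \<Rightarrow> 'b"
    where "f x = ic2 (\<psi> (inv_into (carrier F) ic1 x))" for x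
  have f: "f (ic1 a) = ic2 (\<psi> a)" if "a \<in> carrier F" for a
    using inv_into_f_f[OF inj1 that] by (simp add: f_def)
  have "\<exists>\<Phi>\<in>ring_iso F.alg_closure E.alg_closure. \<forall>x\<in>ic1 ` carrier F. \<Phi> x = f x"
  proof (rule algebraic_closure_unique[OF c1(1) c2(1)])
    show "bij_betw f (ic1 ` carrier F) (ic2 ` carrier E)" unfolding bij_betw_def
    proof
      show "inj_on f (ic1 ` carrier F)"
      proof (rule inj_onI)
        fix x y assume "x \<in> ic1 ` carrier F" "y \<in> ic1 ` carrier F" and e: "f x = f y"
        then obtain a b where ab: "a \<in> carrier F" "x = ic1 a" "b \<in> carrier F" "y = ic1 b" by blast
        hence "\<psi> a = \<psi> b" using e f inj_onD[OF inj2] ps(1) by metis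
        hence "a = b" using inj_onD[OF bij_betw_imp_inj_on[OF ps(5)]] ab by blast
        thus "x = y" using ab by simp
      qed
      have "f ` ic1 ` carrier F = ic2 ` \<psi> ` carrier F" using f by (auto simp: image_image)
      thus "f ` ic1 ` carrier F = ic2 ` carrier E" using bij_betw_imp_surj_on[OF ps(5)] by simp
    qed
    fix x y assume "x \<in> ic1 ` carrier F" "y \<in> ic1 ` carrier F"
    then obtain a b where ab: "a \<in> carrier F" "x = ic1 a" "b \<in> carrier F" "y = ic1 b" by blast
    show "f (x \<oplus>\<^bsub>F.alg_closure\<^esub> y) = f x \<oplus>\<^bsub>E.alg_closure\<^esub> f y"
      using f[OF F.a_closed[OF ab(1,3)]] ab f ps i1(3)[OF ab(1,3)] i2(3) by simp
    show "f (x \<otimes>\<^bsub>F.alg_closure\<^esub> y) = f x \<otimes>\<^bsub>E.alg_closure\<^esub> f y"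
      using f[OF F.m_closed[OF ab(1,3)]] ab f ps i1(2)[OF ab(1,3)] i2(2) by simp
  qed
  then obtain \<Phi> where \<Phi>: "\<Phi> \<in> ring_iso F.alg_closure E.alg_closure" "\<And>x. x \<in> ic1 ` carrier F \<Longrightarrow> \<Phi> x = f x"
    by blast
  define \<Theta> where "\<Theta> = inv_into (carrier F.alg_closure) \<Phi>"
  have bij: "bij_betw \<Phi> (carrier F.alg_closure) (carrier E.alg_closure)" by (rule ring_iso_memE(5)[OF \<Phi>(1)])
  have \<Theta>: "\<Theta> \<in> ring_iso E.alg_closure F.alg_closure"
    unfolding \<Theta>_def by (rule ring_iso_set_sym[OF W1.ring_axioms \<Phi>(1)])
  have image: "\<Phi> ` base_image F = base_image E"
  proof -
    have "\<Phi> ` base_image F = (\<lambda>a. ic2 (\<psi> a)) ` carrier F"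
      unfolding bi image_image using \<Phi>(2) f by auto
    also have "\<dots> = ic2 ` \<psi> ` carrier F" by (simp add: image_image)
    finally show ?thesis using bij_betw_imp_surj_on[OF ps(5)] by (simp add: bi)
  qed
  interpret closure_iso F.alg_closure E.alg_closure "base_image F" "base_image E" \<Phi> \<Theta>
  proof (rule closure_iso.intro)
    show "field F.alg_closure" "field E.alg_closure" by (rule W1.field_axioms, rule W2.field_axioms)
    show "\<Theta> (\<Phi> x) = x" if "x \<in> carrier F.alg_closure" for x
      unfolding \<Theta>_def by (rule bij_betw_inv_into_left[OF bij that])
    show "\<Phi> (\<Theta> y) = y" if "y \<in> carrier E.alg_closure" for y
      unfolding \<Theta>_def by (rule bij_betw_inv_into_right[OF bij that])
    show "subfield (base_image F) F.alg_closure" "subfield (base_image E) E.alg_closure"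
      unfolding bi by (rule W1.subfield_axioms, rule W2.subfield_axioms)
  qed (use \<Phi>(1) \<Theta> image in auto)
  have "conj \<in> iso (abs_galois_group F) (abs_galois_group E)"
  proof (rule isoI)
    show "conj \<in> hom (abs_galois_group F) (abs_galois_group E)"
      by (rule homI) (auto simp: mult_abs_galois_group, auto simp: carrier_abs_galois_group conj_galois conj_compose mult_abs_galois_group)
    show "bij_betw conj (carrier (abs_galois_group F)) (carrier (abs_galois_group E))"
      unfolding carrier_abs_galois_group by (rule conj_bij)
  qed
  hence "anabelomorphism F E conj" unfolding anabelomorphism_def krull_topology_eq using conj_homeomorphic by blast
  thus ?thesis unfolding anabelomorphic_def by blast
qed

lemma anabelomorphic_trans:
  "anabelomorphic F E \<Longrightarrow> anabelomorphic E D \<Longrightarrow> anabelomorphic F D"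
  unfolding anabelomorphic_def anabelomorphism_def
  by (meson homeomorphic_map_compose iso_set_trans)

section \<open>Number fields dense in local fields\<close>

text \<open>
  For \<open>k\<close> large, the term \<open>P ^ k (x ^ (deg G + 1) + q)\<close> of the perturbation is negligible at
  \<open>g\<close>, both in value and in derivative.
\<close>
lemma (in complete_nonarch_fld) perturbed_root:
  assumes g: "N g \<le> 1" "N (iev G g) = 0" "N (iev (pderiv G) g) \<noteq> 0" "generates g"
    and P: "N (of_int P) < 1" and q: "N (of_int q) \<noteq> 0" and e: "e > 0"
  shows "\<exists>K. \<forall>k\<ge>K. \<exists>x. N (iev (eisenstein_perturbation q (P ^ k) G) x) = 0 \<and> N (x - g) < e \<and> generates x"
proof -
  define d where "d = N (of_int (q\<^sup>2) * iev (pderiv G) g)"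
  have d: "d > 0" using g(3) q by (simp add: d_def N_mult N_power less_le)
  obtain t where t: "t > 0" "\<And>f. N (iev f g) < t \<Longrightarrow> d \<le> N (iev (pderiv f) g) \<Longrightarrow> \<exists>x. N (iev f x) = 0 \<and> N (x - g) < e \<and> generates x"
    using generating_root_stable[OF g e d] by blast
  obtain K where K: "N (of_int P ^ K) < min t d" using power_small[OF P, of "min t d"] t d by auto
  have "\<exists>x. N (iev (eisenstein_perturbation q (P ^ k) G) x) = 0 \<and> N (x - g) < e \<and> generates x" if k: "k \<ge> K" for k
  proof (rule t(2))
    define H where "H = Polynomial.monom (1 :: int) (Suc (Polynomial.degree G)) + [:q:]"
    have f: "eisenstein_perturbation q (P ^ k) G = Polynomial.smult (q\<^sup>2) G + Polynomial.smult (P ^ k) H"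
      by (simp add: eisenstein_perturbation_def H_def)
    have "N (of_int P ^ k) \<le> N (of_int P ^ K)" unfolding N_power using P k by (intro power_decreasing) auto
    hence small: "N (of_int P ^ k) < t" "N (of_int P ^ k) < d" using K by auto
    have part: "N (of_int P ^ k * iev J g) \<le> N (of_int P ^ k)" for J
      using N_mult_le_1[of "iev J g" "of_int P ^ k"] iev_le_1[OF g(1)] by (simp add: mult.commute)
    have "N (iev (eisenstein_perturbation q (P ^ k) G) g) \<le> N (of_int P ^ k)"
      unfolding f using part[of H] g(2) by (simp, intro N_add_le) (simp_all add: N_mult)
    thus "N (iev (eisenstein_perturbation q (P ^ k) G) g) < t" using small by simp
    have "iev (pderiv (eisenstein_perturbation q (P ^ k) G)) g - of_int (q\<^sup>2) * iev (pderiv G) g = of_int P ^ k * iev (pderiv H) g"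
      unfolding f by (simp add: pderiv_add pderiv_smult)
    hence "N (iev (pderiv (eisenstein_perturbation q (P ^ k) G)) g - of_int (q\<^sup>2) * iev (pderiv G) g) < N (of_int (q\<^sup>2) * iev (pderiv G) g)"
      using part[of "pderiv H"] small(2) unfolding d_def by simp
    from N_eq_of_close[OF this] show "d \<le> N (iev (pderiv (eisenstein_perturbation q (P ^ k) G)) g)" by (simp add: d_def)
  qed
  thus ?thesis by blast
qed

lemma (in nonarch_ring) limit_mult:
  assumes S: "(\<lambda>n. N (S n - x)) \<longlonglongrightarrow> 0" and T: "(\<lambda>n. N (T n - y)) \<longlonglongrightarrow> 0"
  shows "(\<lambda>n. N (S n * T n - x * y)) \<longlonglongrightarrow> 0"
proof (rule tendsto_sandwich[OF _ _ tendsto_const])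
  have "(\<lambda>n. N (S n - x) * N (T n) + N x * N (T n - y)) \<longlonglongrightarrow> 0 * N y + N x * 0"
    by (intro tendsto_intros S T N_limit[OF T])
  thus "(\<lambda>n. N (S n - x) * N (T n) + N x * N (T n - y)) \<longlonglongrightarrow> 0" by simp
  have "N (S n * T n - x * y) \<le> N (S n - x) * N (T n) + N x * N (T n - y)" for n
  proof -
    have "S n * T n - x * y = (S n - x) * T n + x * (T n - y)" by (simp add: algebra_simps)
    hence "N (S n * T n - x * y) \<le> max (N ((S n - x) * T n)) (N (x * (T n - y)))" using N_add by metis
    thus ?thesis using N_nonneg[of "(S n - x) * T n"] N_nonneg[of "x * (T n - y)"]
      unfolding N_mult by linarith
  qed
  thus "\<forall>\<^sub>F n in sequentially. N (S n * T n - x * y) \<le> N (S n - x) * N (T n) + N x * N (T n - y)" by simp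
qed auto

lemma (in nonarch_ring) limit_add:
  assumes S: "(\<lambda>n. N (S n - x)) \<longlonglongrightarrow> 0" and T: "(\<lambda>n. N (T n - y)) \<longlonglongrightarrow> 0"
  shows "(\<lambda>n. N (S n + T n - (x + y))) \<longlonglongrightarrow> 0"
proof (rule tendsto_sandwich[OF _ _ tendsto_const])
  show "(\<lambda>n. max (N (S n - x)) (N (T n - y))) \<longlonglongrightarrow> 0" using tendsto_max[OF S T] by simp
  have "N (S n + T n - (x + y)) \<le> max (N (S n - x)) (N (T n - y))" for n
    using N_add[of "S n - x" "T n - y"] by (simp add: algebra_simps)
  thus "\<forall>\<^sub>F n in sequentially. N (S n + T n - (x + y)) \<le> max (N (S n - x)) (N (T n - y))" by simp
qed auto

lemma (in nonarch_ring) limit_unique: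
  assumes S: "(\<lambda>n. N (S n - x)) \<longlonglongrightarrow> 0" and T: "(\<lambda>n. N (S n - y)) \<longlonglongrightarrow> 0"
  shows "N (x - y) = 0"
proof -
  have "(\<lambda>n. max (N (S n - y)) (N (S n - x))) \<longlonglongrightarrow> 0" using tendsto_max[OF T S] by simp
  moreover have "N (x - y) \<le> max (N (S n - y)) (N (S n - x))" for n
    using N_diff[of "S n - y" "S n - x"] by simp
  ultimately have "N (x - y) \<le> 0" using LIMSEQ_le_const by blast
  thus ?thesis using N_nonneg[of "x - y"] by simp
qed

lemma (in nonarch_ring) limit_cauchy:
  assumes S: "(\<lambda>n. N (S n - x)) \<longlonglongrightarrow> 0"
  shows "seq_cauchy N S"
  unfolding seq_cauchy_def
proof (intro allI impI)
  fix e :: real assume "e > 0"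
  then obtain M where M: "\<forall>n\<ge>M. N (S n - x) < e" using LIMSEQ_D[OF S] by fastforce
  have "N (S m - S n) < e" if "m \<ge> M" "n \<ge> M" for m n
    using N_diff_less[of "S m - x" e "S n - x"] M that by simp
  thus "\<exists>M. \<forall>m\<ge>M. \<forall>n\<ge>M. N (S m - S n) < e" by blast
qed

text \<open>
  A complete field is the completion of each of its dense subfields: Cauchy sequences of the
  subfield have limits, the null sequences are those with limit \<open>0\<close>, and every element is a
  limit by density.
\<close>
theorem completion_of_dense_subfield:
  fixes M :: "'m ring" and L :: "'b ring"
  assumes M: "field M" and L: "field L" and b: "nonarch_absval L b"
    and complete: "complete_nonarch_fld (\<lambda>x. b (dn L x))"
    and \<sigma>: "\<sigma> \<in> ring_hom M L"
    and dense: "\<And>y e. y \<in> carrier L \<Longrightarrow> e > 0 \<Longrightarrow> \<exists>x\<in>carrier M. b (\<sigma> x \<ominus>\<^bsub>L\<^esub> y) < e"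
    and w: "nonarch_absval M (b \<circ> \<sigma>)"
  shows "\<exists>\<psi>. \<psi> \<in> ring_iso (place_completion M (b \<circ> \<sigma>)) L"
proof -
  interpret L: field L by (rule L)
  interpret C: valued_field M "b \<circ> \<sigma>" by (rule valued_field.intro[OF M w])
  interpret N: complete_nonarch_fld "\<lambda>x. b (dn L x)" by (rule complete)
  note crL = L.is_cring and crM = C.cr
  let ?N = "\<lambda>x. b (dn L x)"
  note opsL = dn_ops[OF crL] and carL = dn_carrier[OF crL] and upL = dn_up[OF crL]
  note sh = ring_hom_memE[OF \<sigma>]
  have Nz: "?N x = 0 \<longleftrightarrow> dn L x = \<zero>\<^bsub>L\<^esub>" for x by (rule nonarch_absval_dn(2)[OF L b])
  have Neq: "dn L x = dn L y" if "?N (x - y) = 0" for x y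
    using that Nz dn_minus_zero_iff[OF crL] by blast
  have sig: "\<sigma> (x \<ominus>\<^bsub>M\<^esub> y) = \<sigma> x \<ominus>\<^bsub>L\<^esub> \<sigma> y" if "x \<in> carrier M" "y \<in> carrier M" for x y
  proof -
    interpret M: field M by (rule M)
    interpret h: ring_hom_ring M L \<sigma> by (rule ring_hom_ringI2[OF M.ring_axioms L.ring_axioms \<sigma>])
    show ?thesis using that by (simp add: a_minus_def)
  qed
  define T where "T x n = up L (\<sigma> (x n))" for x :: "nat \<Rightarrow> 'm" and n
  have dT: "dn L (T x n) = \<sigma> (x n)" if "x \<in> carrier C.CR" for x n
    using C.CR_in[OF that] sh(1) by (simp add: T_def upL)
  have cau: "seq_cauchy ?N (T x)" if x: "x \<in> carrier C.CR" for x
  proof -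
    have "?N (T x m - T x n) = (b \<circ> \<sigma>) (x m \<ominus>\<^bsub>M\<^esub> x n)" for m n
      using dT[OF x] sig C.CR_in[OF x] by (simp add: opsL)
    thus ?thesis using x unfolding seq_cauchy_def cauchy_ring_def by simp
  qed
  define lm where "lm x y \<longleftrightarrow> (\<lambda>n. ?N (T x n - y)) \<longlonglongrightarrow> 0" for x y
  have lm_ex: "\<exists>y. lm x y" if "x \<in> carrier C.CR" for x
    using N.N_complete cau[OF that] unfolding seq_cauchy_def lm_def by blast
  define lam where "lam x = dn L (SOME y. lm x y)" for x
  have lam: "lam x = dn L y" if "lm x y" for x y
  proof -
    have "lm x (SOME y. lm x y)" using that by (rule someI)
    hence "?N ((SOME y. lm x y) - y) = 0" using that N.limit_unique unfolding lm_def by blast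
    thus ?thesis unfolding lam_def by (rule Neq)
  qed
  have cong: "lm x y" if "\<And>n. dn L (S n) = dn L (T x n)" "(\<lambda>n. ?N (S n - y)) \<longlonglongrightarrow> 0" for x y S
    using that unfolding lm_def by (simp add: opsL)
  have hom: "lam \<in> ring_hom C.CR L"
  proof (rule ring_hom_memI)
    fix x assume x: "x \<in> carrier C.CR"
    show "lam x \<in> carrier L" by (simp add: lam_def carL)
    fix y assume y: "y \<in> carrier C.CR"
    obtain l m where lm: "lm x l" "lm y m" using lm_ex x y by blast
    have xy: "x \<otimes>\<^bsub>C.CR\<^esub> y \<in> carrier C.CR" "x \<oplus>\<^bsub>C.CR\<^esub> y \<in> carrier C.CR" using x y by auto
    have "lm (x \<otimes>\<^bsub>C.CR\<^esub> y) (l * m)"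
    proof (rule cong)
      show "(\<lambda>n. ?N (T x n * T y n - l * m)) \<longlonglongrightarrow> 0" using N.limit_mult lm unfolding lm_def by blast
      show "dn L (T x n * T y n) = dn L (T (x \<otimes>\<^bsub>C.CR\<^esub> y) n)" for n
        using dT[OF x] dT[OF y] dT[OF xy(1)] sh(2) C.CR_in[OF x] C.CR_in[OF y] by (simp add: opsL) (simp add: cauchy_ring_def)
    qed
    thus "lam (x \<otimes>\<^bsub>C.CR\<^esub> y) = lam x \<otimes>\<^bsub>L\<^esub> lam y" using lam lm by (simp add: opsL)
    have "lm (x \<oplus>\<^bsub>C.CR\<^esub> y) (l + m)"
    proof (rule cong)
      show "(\<lambda>n. ?N (T x n + T y n - (l + m))) \<longlonglongrightarrow> 0" using N.limit_add lm unfolding lm_def by blast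
      show "dn L (T x n + T y n) = dn L (T (x \<oplus>\<^bsub>C.CR\<^esub> y) n)" for n
        using dT[OF x] dT[OF y] dT[OF xy(2)] sh(3) C.CR_in[OF x] C.CR_in[OF y] by (simp add: opsL) (simp add: cauchy_ring_def)
    qed
    thus "lam (x \<oplus>\<^bsub>C.CR\<^esub> y) = lam x \<oplus>\<^bsub>L\<^esub> lam y" using lam lm by (simp add: opsL)
  next
    have "lm \<one>\<^bsub>C.CR\<^esub> 1"
    proof (rule cong)
      show "(\<lambda>n. ?N ((\<lambda>n. 1) n - 1)) \<longlonglongrightarrow> 0" by simp
      have "\<one>\<^bsub>C.CR\<^esub> n = \<one>\<^bsub>M\<^esub>" for n by (simp add: cauchy_ring_def)
      thus "dn L ((\<lambda>n. 1) n) = dn L (T \<one>\<^bsub>C.CR\<^esub> n)" for n using dT[OF C.CR.one_closed] sh(4) by (simp add: opsL)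
    qed
    thus "lam \<one>\<^bsub>C.CR\<^esub> = \<one>\<^bsub>L\<^esub>" using lam by (simp add: opsL)
  qed
  interpret h: ring_hom_ring C.CR L lam by (rule ring_hom_ringI2[OF C.CR.ring_axioms L.ring_axioms hom])
  have ker: "a_kernel C.CR L lam = C.NS"
  proof -
    have "lam x = \<zero>\<^bsub>L\<^esub> \<longleftrightarrow> (\<lambda>n. (b \<circ> \<sigma>) (x n)) \<longlonglongrightarrow> 0" if x: "x \<in> carrier C.CR" for x
    proof -
      obtain l where l: "lm x l" using lm_ex[OF x] by blast
      have lim: "(\<lambda>n. ?N (T x n)) \<longlonglongrightarrow> ?N l" using l N.N_limit unfolding lm_def by blast
      have "lam x = \<zero>\<^bsub>L\<^esub> \<longleftrightarrow> ?N l = 0" using lam[OF l] Nz by simp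
      also have "\<dots> \<longleftrightarrow> (\<lambda>n. ?N (T x n)) \<longlonglongrightarrow> 0" using lim LIMSEQ_unique by metis
      finally show ?thesis using dT[OF x] by simp
    qed
    thus ?thesis unfolding a_kernel_def' null_sequences_def by auto
  qed
  have surj: "lam ` carrier C.CR = carrier L"
  proof
    show "carrier L \<subseteq> lam ` carrier C.CR"
    proof
      fix y assume y: "y \<in> carrier L"
      have "\<forall>n. \<exists>x\<in>carrier M. b (\<sigma> x \<ominus>\<^bsub>L\<^esub> y) < inverse (real (Suc n))" using dense[OF y] by simp
      then obtain x where x: "\<And>n. x n \<in> carrier M" "\<And>n. b (\<sigma> (x n) \<ominus>\<^bsub>L\<^esub> y) < inverse (real (Suc n))" by metis
      have Nx: "?N (T x n - up L y) = b (\<sigma> (x n) \<ominus>\<^bsub>L\<^esub> y)" for n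
        using x(1) sh(1) y by (simp add: opsL T_def upL)
      have lim: "lm x (up L y)" unfolding lm_def
      proof (rule tendsto_sandwich[OF _ _ tendsto_const LIMSEQ_inverse_real_of_nat])
        show "\<forall>\<^sub>F n in sequentially. ?N (T x n - up L y) \<le> inverse (real (Suc n))"
          unfolding Nx using x(2) by (intro always_eventually allI less_imp_le)
      qed auto
      have "x \<in> carrier C.CR"
      proof -
        have "?N (T x m - T x n) = (b \<circ> \<sigma>) (x m \<ominus>\<^bsub>M\<^esub> x n)" for m n
          using sig[OF x(1) x(1)] x(1) sh(1) by (simp add: opsL T_def upL)
        thus ?thesis using N.limit_cauchy[OF lim[unfolded lm_def]] x(1) unfolding seq_cauchy_def cauchy_ring_def by simp
      qed
      moreover have "lam x = y" using lam[OF lim] y by (simp add: upL)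
      ultimately show "y \<in> lam ` carrier C.CR" by blast
    qed
  qed (use h.hom_closed in auto)
  show ?thesis using h.FactRing_iso_set[OF surj] unfolding ker place_completion_def by blast
qed

lemma ring_of_type_algebra_eval:
  "ring.eval (ring_of_type_algebra :: 'a::comm_ring_1 ring) (rev (map c [0..<n])) x = (\<Sum>i<n. c i * x ^ i)"
proof (induction n)
  case 0
  show ?case by (simp add: ring.eval.simps[OF ring_from_type_algebra] ring_of_type_algebra_simps)
next
  case (Suc n)
  have pow: "x [^]\<^bsub>ring_of_type_algebra\<^esub> m = x ^ m" for m
  proof (induction m)
    case 0
    show ?case using monoid.nat_pow_0[OF ring.is_monoid[OF ring_from_type_algebra], of x] by (simp add: ring_of_type_algebra_simps)
  next
    case (Suc m)
    thus ?case using monoid.nat_pow_Suc[OF ring.is_monoid[OF ring_from_type_algebra], of x m] by (simp add: ring_of_type_algebra_simps mult.commute)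
  qed
  show ?case using Suc by (simp add: ring.eval.simps[OF ring_from_type_algebra] ring_of_type_algebra_simps pow add.commute)
qed

text \<open>
  The field of rational expressions in an algebraic complex number \<open>z\<close>, as a subfield of the
  complex numbers. Each of its elements is a value at \<open>z\<close> of an integer polynomial, up to an
  integer denominator.
\<close>
lemma generated_number_field:
  fixes z :: complex and f :: "int poly"
  assumes f: "f \<noteq> 0" "iev f z = 0"
  shows "\<exists>M :: complex ring. number_field M \<and> field M \<and> (\<forall>P. iev P z \<in> carrier M) \<and>
     (\<forall>x\<in>carrier M. \<exists>P m. m \<noteq> 0 \<and> x * of_int m = iev P z) \<and>
     (\<forall>x y. x \<otimes>\<^bsub>M\<^esub> y = x * y) \<and> (\<forall>x y. x \<oplus>\<^bsub>M\<^esub> y = x + y) \<and> \<one>\<^bsub>M\<^esub> = 1 \<and> \<zero>\<^bsub>M\<^esub> = 0"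
proof -
  define R where "R = (ring_of_type_algebra :: complex ring)"
  define K where "K = range (of_rat :: rat \<Rightarrow> complex)"
  have Rs: "carrier R = UNIV" "x \<otimes>\<^bsub>R\<^esub> y = x * y" "\<one>\<^bsub>R\<^esub> = 1" "x \<oplus>\<^bsub>R\<^esub> y = x + y" "\<zero>\<^bsub>R\<^esub> = 0" for x y
    by (simp_all add: R_def ring_of_type_algebra_simps)
  interpret R: field R unfolding R_def by (rule field_from_type_algebra)
  have hr: "(of_rat :: rat \<Rightarrow> complex) \<in> ring_hom ring_of_type_algebra R"
    by (rule ring_hom_memI) (simp_all add: Rs ring_of_type_algebra_simps of_rat_mult of_rat_add)
  have Qf: "field (ring_of_type_algebra :: rat ring)" by (rule field_from_type_algebra)
  have K: "subfield K R"
  proof -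
    have "ring_hom_ring ring_of_type_algebra R (of_rat :: rat \<Rightarrow> complex)"
      by (rule ring_hom_ringI2[OF field.is_ring[OF Qf] R.ring_axioms hr])
    from ring_hom_ring.img_is_subfield(2)[OF this field.carrier_is_subfield[OF Qf] R.one_not_zero]
    show ?thesis by (simp add: K_def ring_of_type_algebra_simps)
  qed
  have alg: "(R.algebraic over K) z"
  proof -
    define d where "d = Polynomial.degree f"
    define q where "q = rev (map (\<lambda>i. complex_of_int (Polynomial.coeff f i)) [0..<Suc d])"
    have q: "q = complex_of_int (Polynomial.coeff f d) # rev (map (\<lambda>i. complex_of_int (Polynomial.coeff f i)) [0..<d])" by (simp add: q_def)
    have intK: "complex_of_int m \<in> K" for m unfolding K_def by (metis of_rat_of_int_eq rangeI)
    have "q \<in> carrier (K[X]\<^bsub>R\<^esub>)"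
      unfolding univ_poly_carrier[symmetric] polynomial_def using f(1) intK by (auto simp: q Rs d_def)
    moreover have "R.eval q z = \<zero>\<^bsub>R\<^esub>"
    proof -
      have "R.eval q z = (\<Sum>i<Suc d. of_int (Polynomial.coeff f i) * z ^ i)"
        unfolding R_def q_def by (rule ring_of_type_algebra_eval)
      also have "\<dots> = iev f z"
        unfolding iev_def poly_altdef lessThan_Suc_atMost d_def by (simp add: coeff_map_poly degree_map_poly)
      finally show ?thesis using f(2) by (simp add: Rs)
    qed
    ultimately show ?thesis using R.algebraicI[of q K z] q by simp
  qed
  define E where "E = R.simple_extension K z"
  have zR: "z \<in> carrier R" by (simp add: Rs)
  have E: "subfield E R" unfolding E_def using R.simple_extension_is_subfield[OF K zR] alg by simp
  have KE: "K \<subseteq> E" unfolding E_def using R.simple_extension_incl[OF subfieldE(3)[OF K] zR] .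
  have zE: "z \<in> E" unfolding E_def using R.simple_extension_mem[OF subfieldE(1)[OF K] zR] .
  define M where "M = R\<lparr>carrier := E\<rparr>"
  have Mf: "field M" unfolding M_def by (rule R.subfield_iff(2)[OF E])
  have Ms: "x \<otimes>\<^bsub>M\<^esub> y = x * y" "x \<oplus>\<^bsub>M\<^esub> y = x + y" "\<one>\<^bsub>M\<^esub> = 1" "\<zero>\<^bsub>M\<^esub> = 0" "carrier M = E" for x y
    by (simp_all add: M_def Rs)
  interpret M: field M by (rule Mf)
  have Kin: "complex_of_int m \<in> E" for m using KE unfolding K_def by (metis of_rat_of_int_eq rangeI subsetD)
  have ievE: "iev P z \<in> E" for P
  proof (induction P)
    case 0 show ?case using M.zero_closed by (simp add: Ms)
  next
    case (pCons a P)
    have "of_int a \<oplus>\<^bsub>M\<^esub> (z \<otimes>\<^bsub>M\<^esub> iev P z) \<in> carrier M" using pCons Kin zE by (intro M.a_closed M.m_closed) (simp_all add: Ms)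
    thus ?case by (simp add: Ms)
  qed
  have rep: "\<exists>P m. m \<noteq> 0 \<and> x * of_int m = iev P z" if "x \<in> E" for x
    using that unfolding E_def
  proof (induction rule: R.simple_extension.induct)
    case zero
    show ?case by (intro exI[of _ 0] exI[of _ 1]) (simp add: Rs)
  next
    case (lin k1 k2)
    obtain P m where P: "m \<noteq> 0" "k1 * of_int m = iev P z" using lin by blast
    obtain r where r: "k2 = of_rat r" using lin(2) by (auto simp: K_def)
    obtain a b where ab: "quotient_of r = (a, b)" by (cases "quotient_of r")
    have b: "b \<noteq> 0" "k2 * of_int b = of_int a"
      using quotient_of_denom_pos[OF ab] quotient_of_div[OF ab] by (simp_all add: r of_rat_divide)
    have "(k1 \<otimes>\<^bsub>R\<^esub> z \<oplus>\<^bsub>R\<^esub> k2) * of_int (m * b) = z * (k1 * of_int m) * of_int b + (k2 * of_int b) * of_int m"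
      by (simp add: Rs algebra_simps)
    also have "\<dots> = iev (pCons (a * m) (Polynomial.smult b P)) z" by (simp add: P b)
    finally show ?case using P(1) b(1) by (intro exI[of _ "pCons (a * m) (Polynomial.smult b P)"] exI[of _ "m * b"]) simp
  qed
  have "number_field M"
    unfolding number_field_def finite_field_ext_def
  proof (intro exI[of _ of_rat] conjI)
    show "of_rat \<in> ring_hom ring_of_type_algebra M"
      by (rule ring_hom_memI) (use KE in \<open>auto simp: Ms ring_of_type_algebra_simps of_rat_mult of_rat_add K_def\<close>)
    have KM: "subfield K M"
    proof (rule M.subfield_iff(1))
      show "K \<subseteq> carrier M" using KE by (simp add: Ms)
      have "field (R\<lparr>carrier := K\<rparr>)" by (rule R.subfield_iff(2)[OF K])
      thus "field (M\<lparr>carrier := K\<rparr>)" by (simp add: M_def)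
    qed
    have "R.finite_dimension K E" unfolding E_def using R.finite_dimension_simple_extension[OF K zR] alg by simp
    then obtain n where "R.dimension n K E" unfolding R.finite_dimension_def by blast
    then obtain Us where Us: "set Us \<subseteq> carrier R" "R.Span K Us = E" using R.exists_base[OF K] by blast
    have "set Us \<subseteq> E" using R.Span_base_incl[OF K Us(1)] Us(2) by simp
    hence "M.finite_dimension K (M.Span K Us)" by (intro M.Span_finite_dimension[OF KM]) (simp add: Ms)
    moreover have "M.Span K Us = E" using R.Span_consistent[OF subfieldE(1)[OF E]] Us(2) by (simp add: M_def)
    ultimately show "M.finite_dimension (of_rat ` carrier ring_of_type_algebra) (carrier M)"
      by (simp add: Ms K_def ring_of_type_algebra_simps)
  qed (use Qf Mf in auto)
  thus ?thesis using Mf ievE rep Ms by (intro exI[of _ M]) auto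
qed

text \<open>The absolute value of a local field as a seminorm on the type \<open>'b univ\<close>.\<close>
abbreviation uabs :: "'b ring \<Rightarrow> 'b univ \<Rightarrow> real" where
  "uabs L x \<equiv> local_absval L (dn L x)"

lemma local_field_facts:
  fixes L :: "'b ring"
  assumes "nonarch_local_field L"
  shows "field L" "nonarch_absval L (local_absval L)" "complete_nonarch_fld (uabs L)"
    "\<exists>p. Factorial_Ring.prime p \<and> (\<forall>m. uabs L (of_int m) = padic_absval p (of_int m))"
    "r > 0 \<Longrightarrow> \<exists>g G. uabs L (g - of_int c) < r \<and> uabs L g \<le> 1 \<and> uabs L (iev G g) = 0 \<and>
       uabs L (iev (pderiv G) g) \<noteq> 0 \<and> complete_nonarch_fld.generates (uabs L) g"
proof -
  have "extends_padic_absval L (local_absval L)" by (rule local_absval_extends[OF assms])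
  then obtain p h where ph: "nonarch_absval L (local_absval L)" "Factorial_Ring.prime p" "finite_field_ext (Qp p) h L"
    "\<forall>x\<in>carrier (Qp p). local_absval L (h x) = completion_absval (padic_absval p) x"
    unfolding extends_padic_absval_def by blast
  interpret padic_extension L p h by (rule padic_extension.intro[OF ph(2,3)])
  interpret padic_extension_absval L p h "local_absval L"
    by unfold_locales (use ph in auto)
  show "field L" "nonarch_absval L (local_absval L)" by (rule L_field, rule ph(1))
  show "complete_nonarch_fld (uabs L)" by (rule N_complete)
  show "\<exists>p. Factorial_Ring.prime p \<and> (\<forall>m. uabs L (of_int m) = padic_absval p (of_int m))"
    using ph(2) N_of_int by blast
  show "r > 0 \<Longrightarrow> \<exists>g G. uabs L (g - of_int c) < r \<and> uabs L g \<le> 1 \<and> uabs L (iev G g) = 0 \<and>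
       uabs L (iev (pderiv G) g) \<noteq> 0 \<and> complete_nonarch_fld.generates (uabs L) g"
    by (rule generator)
qed

text \<open>
  The embedding of the number field generated by \<open>z\<close> that maps \<open>z\<close> to \<open>t\<close>. It is well
  defined as \<open>t\<close> satisfies all relations of \<open>z\<close>, and its image is dense as \<open>t\<close> is a
  topological generator.
\<close>
lemma embedding_of_generated_field:
  fixes M :: "complex ring" and L :: "'b ring"
  assumes M: "field M" "\<And>P. iev P z \<in> carrier M" "\<And>x. x \<in> carrier M \<Longrightarrow> \<exists>P m. m \<noteq> 0 \<and> x * of_int m = iev P z"
    and Mops: "\<And>x y. x \<otimes>\<^bsub>M\<^esub> y = x * y" "\<And>x y. x \<oplus>\<^bsub>M\<^esub> y = x + y" "\<one>\<^bsub>M\<^esub> = 1" "\<zero>\<^bsub>M\<^esub> = 0"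
    and L: "nonarch_local_field L"
    and gen: "complete_nonarch_fld.generates (uabs L) t"
    and rel: "\<And>P. iev P z = 0 \<Longrightarrow> uabs L (iev P t) = 0"
  shows "\<exists>\<sigma>. \<sigma> \<in> ring_hom M L \<and> (\<forall>P. local_absval L (\<sigma> (iev P z)) = uabs L (iev P t)) \<and>
     (\<forall>y\<in>carrier L. \<forall>e>0. \<exists>x\<in>carrier M. local_absval L (\<sigma> x \<ominus>\<^bsub>L\<^esub> y) < e)"
proof -
  note Lf = local_field_facts[OF L]
  interpret L: field L by (rule Lf(1))
  interpret M: field M by (rule M(1))
  interpret N: complete_nonarch_fld "uabs L" by (rule Lf(3))
  note crL = L.is_cring
  obtain p where p: "Factorial_Ring.prime p" "\<And>m. uabs L (of_int m) = padic_absval p (of_int m)" using Lf(4) by blast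
  have char: "uabs L (of_int m) \<noteq> 0" if "m \<noteq> 0" for m using p padic_absval_of_int_pos that by simp
  have Nz: "uabs L x = 0 \<longleftrightarrow> dn L x = \<zero>\<^bsub>L\<^esub>" for x by (rule nonarch_absval_dn(2)[OF Lf(1,2)])
  \<comment> \<open>The graph of the embedding: \<open>x = P z / m\<close> corresponds to \<open>y = P t / m\<close>.\<close>
  define corr where "corr x y \<longleftrightarrow> (\<exists>P m. m \<noteq> 0 \<and> x * of_int m = iev P z \<and> uabs L (y * of_int m - iev P t) = 0)" for x y
  have corr_ex: "\<exists>y. corr x y" if x: "x \<in> carrier M" for x
  proof -
    obtain P m where P: "m \<noteq> 0" "x * of_int m = iev P z" using M(3)[OF x] by blast
    obtain u where u: "uabs L (of_int m * u - 1) = 0" using N.N_inverse[OF char[OF P(1)]] by blast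
    have "(iev P t * u) * of_int m - iev P t = iev P t * (of_int m * u - 1)" by (simp add: algebra_simps)
    hence "uabs L ((iev P t * u) * of_int m - iev P t) = 0" using u by (simp add: N.N_mult)
    thus ?thesis unfolding corr_def using P by blast
  qed
  have corr_eq: "dn L y = dn L y'" if yy: "corr x y" "corr x y'" for x y y'
  proof -
    obtain P m P' m' where P: "m \<noteq> 0" "x * of_int m = iev P z" "uabs L (y * of_int m - iev P t) = 0"
      and P': "m' \<noteq> 0" "x * of_int m' = iev P' z" "uabs L (y' * of_int m' - iev P' t) = 0"
      using yy unfolding corr_def by blast
    have "iev (Polynomial.smult m' P - Polynomial.smult m P') z = 0"
      by (simp flip: P(2) P'(2))
    hence 0: "uabs L (of_int m' * iev P t - of_int m * iev P' t) = 0" using rel by fastforce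
    have "(y - y') * (of_int m * of_int m') = of_int m' * (y * of_int m - iev P t) - of_int m * (y' * of_int m' - iev P' t)
        + (of_int m' * iev P t - of_int m * iev P' t)" by (simp add: algebra_simps)
    also have "uabs L \<dots> \<le> 0" by (intro N.N_add_le N.N_diff_le[of "of_int m' * (y * of_int m - iev P t)"]) (simp_all add: N.N_mult P P' 0)
    finally have "uabs L (y - y') * (uabs L (of_int m) * uabs L (of_int m')) \<le> 0" by (simp add: N.N_mult)
    hence "uabs L (y - y') = 0"
      using char[OF P(1)] char[OF P'(1)] N.N_nonneg[of "y - y'"] N.N_nonneg[of "of_int m"] N.N_nonneg[of "of_int m'"]
      by (smt (verit) mult_pos_pos)
    thus ?thesis using Nz dn_minus_zero_iff[OF crL] by blast
  qed
  have corr_mult: "corr (x * x') (y * y')" and corr_add: "corr (x + x') (y + y')" if yy: "corr x y" "corr x' y'" for x x' y y'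
  proof -
    obtain P m P' m' where P: "m \<noteq> 0" "x * of_int m = iev P z" "uabs L (y * of_int m - iev P t) = 0"
      and P': "m' \<noteq> 0" "x' * of_int m' = iev P' z" "uabs L (y' * of_int m' - iev P' t) = 0"
      using yy unfolding corr_def by blast
    have "(y * y') * of_int (m * m') - iev (P * P') t = (y * of_int m - iev P t) * (y' * of_int m') + iev P t * (y' * of_int m' - iev P' t)"
      by (simp add: algebra_simps)
    also have "uabs L \<dots> \<le> 0" by (intro N.N_add_le) (simp_all add: N.N_mult P P')
    finally have 1: "uabs L ((y * y') * of_int (m * m') - iev (P * P') t) = 0" using N.N_nonneg by (metis order_antisym)
    have "(x * x') * of_int (m * m') = iev (P * P') z" by (simp flip: P(2) P'(2))
    thus "corr (x * x') (y * y')" unfolding corr_def using 1 P(1) P'(1) by (metis mult_eq_0_iff)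
    have "(y + y') * of_int (m * m') - iev (Polynomial.smult m' P + Polynomial.smult m P') t =
       of_int m' * (y * of_int m - iev P t) + of_int m * (y' * of_int m' - iev P' t)" by (simp add: algebra_simps)
    also have "uabs L \<dots> \<le> 0" by (intro N.N_add_le) (simp_all add: N.N_mult P P')
    finally have 2: "uabs L ((y + y') * of_int (m * m') - iev (Polynomial.smult m' P + Polynomial.smult m P') t) = 0"
      using N.N_nonneg by (metis order_antisym)
    have "(x + x') * of_int (m * m') = iev (Polynomial.smult m' P + Polynomial.smult m P') z"
      by (simp add: algebra_simps flip: P(2) P'(2))
    thus "corr (x + x') (y + y')" unfolding corr_def using 2 P(1) P'(1) by (metis mult_eq_0_iff)
  qed
  have corr_iev: "corr (iev P z) (iev P t)" for P
    unfolding corr_def by (intro exI[of _ P] exI[of _ 1]) simp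
  define \<sigma> where "\<sigma> x = dn L (SOME y. corr x y)" for x
  have \<sigma>: "\<sigma> x = dn L y" if "corr x y" for x y
    unfolding \<sigma>_def using corr_eq[OF someI[of "corr x", OF that] that] .
  note ops = dn_ops[OF crL]
  have hom: "\<sigma> \<in> ring_hom M L"
  proof (rule ring_hom_memI)
    fix x assume x: "x \<in> carrier M"
    show "\<sigma> x \<in> carrier L" by (simp add: \<sigma>_def dn_carrier[OF crL])
    fix x' assume x': "x' \<in> carrier M"
    obtain y y' where y: "corr x y" "corr x' y'" using corr_ex x x' by blast
    show "\<sigma> (x \<otimes>\<^bsub>M\<^esub> x') = \<sigma> x \<otimes>\<^bsub>L\<^esub> \<sigma> x'" using \<sigma>[OF corr_mult[OF y]] \<sigma>[OF y(1)] \<sigma>[OF y(2)] by (simp add: Mops ops)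
    show "\<sigma> (x \<oplus>\<^bsub>M\<^esub> x') = \<sigma> x \<oplus>\<^bsub>L\<^esub> \<sigma> x'" using \<sigma>[OF corr_add[OF y]] \<sigma>[OF y(1)] \<sigma>[OF y(2)] by (simp add: Mops ops)
  next
    show "\<sigma> \<one>\<^bsub>M\<^esub> = \<one>\<^bsub>L\<^esub>" using \<sigma>[OF corr_iev[of 1]] by (simp add: Mops ops)
  qed
  have "\<exists>x\<in>carrier M. local_absval L (\<sigma> x \<ominus>\<^bsub>L\<^esub> y) < e" if y: "y \<in> carrier L" and e: "e > 0" for y e
  proof -
    define u where "u = up L y"
    obtain P Q where PQ: "uabs L (iev Q t) \<noteq> 0" "uabs L (u * iev Q t - iev P t) < e * uabs L (iev Q t)"
      using N.generates_dense[OF gen e] by blast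
    have Qz: "iev Q z \<noteq> 0" using rel PQ(1) by blast
    have "iev Q z \<in> Units M" using Qz M(2) M.field_Units by (simp add: Mops)
    then obtain q where q: "q \<in> carrier M" "iev Q z * q = 1" using M.Units_r_inv_ex by (auto simp: Mops)
    define x where "x = iev P z * q"
    have x: "x \<in> carrier M" using M.m_closed[OF M(2) q(1)] by (simp add: x_def Mops)
    obtain s where s: "corr x s" using corr_ex[OF x] by blast
    have "x * iev Q z = iev P z" using q(2) by (simp add: x_def mult_ac)
    hence "dn L (s * iev Q t) = dn L (iev P t)" using corr_eq corr_mult[OF s corr_iev] corr_iev by metis
    hence 0: "uabs L (s * iev Q t - iev P t) = 0" using Nz dn_minus_zero_iff[OF crL] by blast
    have "(s - u) * iev Q t = (s * iev Q t - iev P t) - (u * iev Q t - iev P t)" by (simp add: algebra_simps)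
    also have "uabs L \<dots> < e * uabs L (iev Q t)"
      using PQ 0 e by (intro N.N_diff_less[of "s * iev Q t - iev P t"]) (auto simp: less_le)
    finally have "uabs L (s - u) * uabs L (iev Q t) < e * uabs L (iev Q t)" by (simp add: N.N_mult)
    hence "uabs L (s - u) < e" using PQ(1) N.N_nonneg[of "iev Q t"] by (simp add: less_le)
    moreover have "dn L (s - u) = \<sigma> x \<ominus>\<^bsub>L\<^esub> y" using \<sigma>[OF s] y by (simp add: ops u_def dn_up[OF crL])
    ultimately show ?thesis using x by auto
  qed
  thus ?thesis using hom \<sigma>[OF corr_iev] by auto
qed

lemma nonarch_absval_comp:
  assumes M: "field M" and L: "field L" and \<sigma>: "\<sigma> \<in> ring_hom M L" and b: "nonarch_absval L b"
  shows "nonarch_absval M (b \<circ> \<sigma>)"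
proof -
  interpret M: field M by (rule M)
  interpret L: field L by (rule L)
  interpret h: ring_hom_ring M L \<sigma> by (rule ring_hom_ringI2[OF M.ring_axioms L.ring_axioms \<sigma>])
  have inj: "inj_on \<sigma> (carrier M)" by (rule non_trivial_field_hom_is_inj[OF \<sigma> M L])
  have "\<sigma> x \<noteq> \<zero>\<^bsub>L\<^esub>" if "x \<in> carrier M" "x \<noteq> \<zero>\<^bsub>M\<^esub>" for x
    using inj_onD[OF inj, of x "\<zero>\<^bsub>M\<^esub>"] that by auto
  thus ?thesis using b unfolding nonarch_absval_def by auto
qed

lemma padic_absval_other_prime:
  assumes "Factorial_Ring.prime p" "Factorial_Ring.prime q" "padic_absval p (of_int (int q)) < 1"
  shows "p = q"
proof (rule ccontr)
  assume "p \<noteq> q"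
  hence "\<not> p dvd q" using assms(1,2) primes_dvd_imp_eq by blast
  hence "\<not> int p dvd int q" by simp
  hence "multiplicity (int p) (int q) = 0" by (rule not_dvd_imp_multiplicity_0)
  hence "padic_absval p (of_int (int q)) = 1"
    using padic_absval_fraction[OF assms(1), of "int q" 1] assms(2) by (auto simp: prime_gt_0_nat)
  thus False using assms(3) by simp
qed

text \<open>
  Every finite family of local fields is cohesive, including families that contain the same
  field several times.
\<close>
theorem local_fields_cohesive:
  fixes L :: "nat \<Rightarrow> 'b ring"
  assumes L: "\<And>i. i \<in> {1..n} \<Longrightarrow> nonarch_local_field (L i)"
  shows "\<exists>(M :: complex ring) \<sigma>. field M \<and> cohesive_via n L M \<sigma> \<and>
    (\<forall>i\<in>{1..n}. nonarch_place M (induced_absval (\<sigma> i) (L i)))"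
proof -
  define I where "I = {1..n}"
  note LI = L[folded I_def]
  have nz: "real n > 0" if "i \<in> I" for i using that by (simp add: I_def)
  obtain p where p: "\<And>i. i \<in> I \<Longrightarrow> Factorial_Ring.prime (p i)"
    and Nint: "\<And>i m. i \<in> I \<Longrightarrow> uabs (L i) (of_int m) = padic_absval (p i) (of_int m)"
    using local_field_facts(4)[OF LI] by metis
  have char: "uabs (L i) (of_int m) \<noteq> 0" if "i \<in> I" "m \<noteq> 0" for i m
    using Nint p padic_absval_of_int_pos that by simp
  have "\<forall>i\<in>I. \<exists>g G. uabs (L i) (g - of_int (int i)) < 1 / real n \<and> uabs (L i) g \<le> 1 \<and> uabs (L i) (iev G g) = 0 \<and>
       uabs (L i) (iev (pderiv G) g) \<noteq> 0 \<and> complete_nonarch_fld.generates (uabs (L i)) g"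
  proof
    fix i assume i: "i \<in> I"
    show "\<exists>g G. uabs (L i) (g - of_int (int i)) < 1 / real n \<and> uabs (L i) g \<le> 1 \<and> uabs (L i) (iev G g) = 0 \<and>
       uabs (L i) (iev (pderiv G) g) \<noteq> 0 \<and> complete_nonarch_fld.generates (uabs (L i)) g"
      using nz[OF i] by (intro local_field_facts(5)[OF LI[OF i]]) simp
  qed
  then obtain g G where g: "\<And>i. i \<in> I \<Longrightarrow> uabs (L i) (g i - of_int (int i)) < 1 / real n" "\<And>i. i \<in> I \<Longrightarrow> uabs (L i) (g i) \<le> 1"
    "\<And>i. i \<in> I \<Longrightarrow> uabs (L i) (iev (G i) (g i)) = 0" "\<And>i. i \<in> I \<Longrightarrow> uabs (L i) (iev (pderiv (G i)) (g i)) \<noteq> 0"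
    "\<And>i. i \<in> I \<Longrightarrow> complete_nonarch_fld.generates (uabs (L i)) (g i)"
    by metis
  have cnf: "complete_nonarch_fld (uabs (L i))" if "i \<in> I" for i by (rule local_field_facts(3)[OF LI[OF that]])
  have nar: "nonarch_ring (uabs (L i))" if "i \<in> I" for i
    using cnf[OF that] by (simp add: complete_nonarch_fld_def nonarch_fld_def)
  have rels: "prime_relations (\<lambda>P. uabs (L i) (iev P x) = 0)" if "i \<in> I" for i x
    by (rule nonarch_ring.prime_relations_at[OF nar[OF that] char[OF that]])
  have "\<exists>H. H \<noteq> 0 \<and> (\<forall>i\<in>I. uabs (L i) (iev H (g i)) = 0 \<and> \<not> uabs (L i) (iev (pderiv H) (g i)) = 0)"
  proof (rule common_relation_simple_roots)
    show "finite I" by (simp add: I_def)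
    show "prime_relations (\<lambda>P. uabs (L i) (iev P (g i)) = 0)" if "i \<in> I" for i by (rule rels[OF that])
    show "\<exists>P. P \<noteq> 0 \<and> uabs (L i) (iev P (g i)) = 0" if i: "i \<in> I" for i
    proof (intro exI[of _ "G i"] conjI)
      show "G i \<noteq> 0" using g(4)[OF i] prime_relationsD(5)[OF rels[OF i]] by (metis pderiv_0)
    qed (rule g(3)[OF i])
  qed
  then obtain H where H: "H \<noteq> 0" "\<And>i. i \<in> I \<Longrightarrow> uabs (L i) (iev H (g i)) = 0" "\<And>i. i \<in> I \<Longrightarrow> uabs (L i) (iev (pderiv H) (g i)) \<noteq> 0"
    by blast
  \<comment> \<open>The powers of \<open>P\<close> tend to \<open>0\<close> in every \<open>L i\<close>.\<close>
  define P where "P = (\<Prod>i\<in>I. int (p i))"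
  have Ppos: "P > 0" unfolding P_def using p by (intro prod_pos) (auto simp: prime_gt_0_nat)
  have NP: "uabs (L i) (of_int P) < 1" if i: "i \<in> I" for i
  proof -
    interpret nonarch_ring "uabs (L i)" by (rule nar[OF i])
    have "P = int (p i) * (\<Prod>j\<in>I - {i}. int (p j))" unfolding P_def using i by (simp add: I_def prod.remove)
    hence "uabs (L i) (of_int P) \<le> uabs (L i) (of_int (int (p i)))"
      using N_mult_le_1[OF N_of_int, of "\<Prod>j\<in>I - {i}. int (p j)" "of_int (int (p i))"] by (simp add: mult.commute)
    also have "\<dots> = 1 / real (p i)" using Nint[OF i, of "int (p i)"] padic_absval_self[OF p[OF i]] by simp
    also have "\<dots> < 1" using prime_gt_1_nat[OF p[OF i]] by simp
    finally show ?thesis .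
  qed
  \<comment> \<open>Being larger than \<open>P\<close>, the prime \<open>q\<close> does not divide any power of \<open>P\<close>.\<close>
  obtain q where q: "Factorial_Ring.prime q" "q > nat P" using bigger_prime by blast
  have qi: "Factorial_Ring.prime (int q)" using q by simp
  have qP: "\<not> int q dvd P ^ k" for k
  proof
    assume "int q dvd P ^ k"
    hence "int q dvd P" using qi prime_dvd_power by blast
    hence "int q \<le> P" using Ppos by (rule zdvd_imp_le)
    thus False using q(2) by linarith
  qed
  have "\<forall>i\<in>I. \<exists>K. \<forall>k\<ge>K. \<exists>x. uabs (L i) (iev (eisenstein_perturbation (int q) (P ^ k) H) x) = 0 \<and>
      uabs (L i) (x - g i) < 1 / real n \<and> complete_nonarch_fld.generates (uabs (L i)) x"
  proof
    fix i assume i: "i \<in> I"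
    show "\<exists>K. \<forall>k\<ge>K. \<exists>x. uabs (L i) (iev (eisenstein_perturbation (int q) (P ^ k) H) x) = 0 \<and>
      uabs (L i) (x - g i) < 1 / real n \<and> complete_nonarch_fld.generates (uabs (L i)) x"
      using q(1) nz[OF i] char[OF i, of "int q"]
      by (intro complete_nonarch_fld.perturbed_root[OF cnf[OF i] g(2)[OF i] H(2)[OF i] H(3)[OF i] g(5)[OF i] NP[OF i]])
         (auto simp: prime_gt_0_nat)
  qed
  then obtain K where K: "\<And>i k. i \<in> I \<Longrightarrow> k \<ge> K i \<Longrightarrow> \<exists>x. uabs (L i) (iev (eisenstein_perturbation (int q) (P ^ k) H) x) = 0 \<and>
      uabs (L i) (x - g i) < 1 / real n \<and> complete_nonarch_fld.generates (uabs (L i)) x"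
    by metis
  define k where "k = Max (insert 0 (K ` I))"
  have Kk: "K i \<le> k" if "i \<in> I" for i unfolding k_def using that by (intro Max_ge) (auto simp: I_def)
  define f where "f = eisenstein_perturbation (int q) (P ^ k) H"
  have eis: "eisenstein_at (int q) f" unfolding f_def by (rule eisenstein_perturbation[OF qi qP])
  obtain t where t: "\<And>i. i \<in> I \<Longrightarrow> uabs (L i) (iev f (t i)) = 0" "\<And>i. i \<in> I \<Longrightarrow> uabs (L i) (t i - g i) < 1 / real n"
    "\<And>i. i \<in> I \<Longrightarrow> complete_nonarch_fld.generates (uabs (L i)) (t i)"
    using K[OF _ Kk] unfolding f_def by metis
  have fdeg: "Polynomial.degree f > 0" using eis by (simp add: eisenstein_at_def)
  obtain z :: complex where z: "iev f z = 0" using iev_complex_root[OF fdeg] by blast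
  obtain M :: "complex ring" where M: "number_field M" "field M" "\<And>P. iev P z \<in> carrier M"
    "\<And>x. x \<in> carrier M \<Longrightarrow> \<exists>P m. m \<noteq> 0 \<and> x * of_int m = iev P z"
    and Mops: "\<And>x y. x \<otimes>\<^bsub>M\<^esub> y = x * y" "\<And>x y. x \<oplus>\<^bsub>M\<^esub> y = x + y" "\<one>\<^bsub>M\<^esub> = 1" "\<zero>\<^bsub>M\<^esub> = 0"
    using generated_number_field[OF _ z] fdeg by (metis degree_0 less_irrefl)
  \<comment> \<open>As \<open>f\<close> is irreducible, its root \<open>t i\<close> satisfies all relations of its root \<open>z\<close>.\<close>
  have transfer: "uabs (L i) (iev A (t i)) = 0" if i: "i \<in> I" and A: "iev A z = 0" for i A
  proof -
    obtain c h where ch: "c \<noteq> 0" "Polynomial.smult c A = f * h"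
      using eisenstein_generates_relations[OF prime_relations_complex eis z A] by blast
    note ZD = prime_relationsD[OF rels[OF i, of "t i"]]
    have "uabs (L i) (iev (f * h) (t i)) = 0" using t(1)[OF i] ZD(2) by blast
    thus ?thesis using ZD(4)[of c A] ch by metis
  qed
  have "\<forall>i\<in>I. \<exists>\<sigma>. \<sigma> \<in> ring_hom M (L i) \<and> (\<forall>A. local_absval (L i) (\<sigma> (iev A z)) = uabs (L i) (iev A (t i))) \<and>
     (\<forall>y\<in>carrier (L i). \<forall>e>0. \<exists>x\<in>carrier M. local_absval (L i) (\<sigma> x \<ominus>\<^bsub>L i\<^esub> y) < e)"
    using embedding_of_generated_field[OF M(2-4) Mops LI t(3) transfer] by blast
  then obtain \<sigma> where \<sigma>: "\<And>i. i \<in> I \<Longrightarrow> \<sigma> i \<in> ring_hom M (L i)"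
    "\<And>i A. i \<in> I \<Longrightarrow> local_absval (L i) (\<sigma> i (iev A z)) = uabs (L i) (iev A (t i))"
    "\<And>i y e. i \<in> I \<Longrightarrow> y \<in> carrier (L i) \<Longrightarrow> e > 0 \<Longrightarrow> \<exists>x\<in>carrier M. local_absval (L i) (\<sigma> i x \<ominus>\<^bsub>L i\<^esub> y) < e"
    by metis
  define w where "w i = induced_absval (\<sigma> i) (L i)" for i
  have w: "w i (iev A z) = uabs (L i) (iev A (t i))" if "i \<in> I" for i A
    using \<sigma>(2)[OF that] by (simp add: w_def induced_absval_def)
  have wint: "w i (of_int m) = padic_absval (p i) (of_int m)" if "i \<in> I" for i m
    using w[OF that, of "[:m:]"] Nint[OF that] by simp
  have intM: "of_int m \<in> carrier M" for m using M(3)[of "[:m:]"] by simp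
  have place: "nonarch_place M (w i)" if i: "i \<in> I" for i
    unfolding nonarch_place_def
  proof
    show "nonarch_absval M (w i)" unfolding w_def induced_absval_def
      by (rule nonarch_absval_comp[OF M(2) local_field_facts(1)[OF LI[OF i]] \<sigma>(1)[OF i] local_field_facts(2)[OF LI[OF i]]])
    have "w i (of_int (int (p i))) = 1 / real (p i)" using wint[OF i, of "int (p i)"] padic_absval_self[OF p[OF i]] by simp
    thus "\<exists>x\<in>carrier M. x \<noteq> \<zero>\<^bsub>M\<^esub> \<and> w i x \<noteq> 1"
      using prime_gt_1_nat[OF p[OF i]] intM[of "int (p i)"] by (intro bexI[of _ "of_int (int (p i))"]) (auto simp: Mops)
  qed
  have ineq: "\<not> equiv_absval M (w i) (w j)" if i: "i \<in> I" and j: "j \<in> I" and ij: "i \<noteq> j" for i j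
  proof
    assume "equiv_absval M (w i) (w j)"
    then obtain s where s: "s > 0" "\<And>x. x \<in> carrier M \<Longrightarrow> w j x = w i x powr s" unfolding equiv_absval_def by blast
    have p1: "real (p i) > 1" using prime_gt_1_nat[OF p[OF i]] by simp
    have wj: "w j (of_int (int (p i))) = (1 / real (p i)) powr s"
      using s(2)[OF intM, of "int (p i)"] wint[OF i, of "int (p i)"] padic_absval_self[OF p[OF i]] by simp
    have "(1 / real (p i)) powr s < 1" using powr_less_mono2[OF s(1), of "1 / real (p i)" 1] p1 by simp
    \<comment> \<open>Equivalence forces the residue characteristics to agree, as \<open>p i\<close> has value less than \<open>1\<close> at \<open>j\<close>.\<close>
    hence pp: "p j = p i" using padic_absval_other_prime[OF p[OF j] p[OF i]] wj wint[OF j] by metis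
    have "(1 / real (p i)) powr s = (1 / real (p i)) powr 1"
      using wj wint[OF j, of "int (p i)"] padic_absval_self[OF p[OF i]] pp by simp
    hence "s = 1" using p1 by (subst (asm) powr_inj) auto
    \<comment> \<open>The element \<open>z - i\<close> of \<open>M\<close>, which separates the places \<open>w i\<close> and \<open>w j\<close>.\<close>
    define B where "B = [:- int i, 1:]"
    have Bt: "iev B x = x - of_int (int i)" for x :: "'b univ" by (simp add: B_def)
    interpret Ni: nonarch_ring "uabs (L i)" by (rule nar[OF i])
    interpret Nj: nonarch_ring "uabs (L j)" by (rule nar[OF j])
    have close: "uabs (L l) (t l - of_int (int l)) < 1 / real n" if l: "l \<in> I" for l
    proof -
      interpret Nl: nonarch_ring "uabs (L l)" by (rule nar[OF l])
      show ?thesis using Nl.N_add_less[OF t(2)[OF l] g(1)[OF l]] by simp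
    qed
    have wi: "w i (iev B z) < 1 / real n" using w[OF i, of B] close[OF i] by (simp add: Bt)
    \<comment> \<open>Indices in \<open>{1..n}\<close> differ by less than \<open>n\<close>.\<close>
    have "1 / real n \<le> 1 / \<bar>real_of_int (int j - int i)\<bar>"
      using i j ij by (intro divide_left_mono) (auto simp: I_def)
    also have "\<dots> \<le> padic_absval (p j) (of_int (int j - int i))"
      using ij by (intro padic_absval_of_int_lower[OF p[OF j]]) simp
    also have "\<dots> = uabs (L j) (of_int (int j - int i))" by (rule Nint[OF j, symmetric])
    finally have low: "1 / real n \<le> uabs (L j) (of_int (int j - int i))" .
    have "(t j - of_int (int i)) - of_int (int j - int i) = t j - of_int (int j)" by simp
    hence "uabs (L j) (t j - of_int (int i)) = uabs (L j) (of_int (int j - int i))"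
      using close[OF j] low by (intro Nj.N_eq_of_close) simp
    hence "1 / real n \<le> w j (iev B z)" using w[OF j, of B] low by (simp add: Bt)
    moreover have "0 \<le> w i (iev B z)" using w[OF i] by simp
    ultimately show False using s(2)[OF M(3)[of B]] \<open>s = 1\<close> wi by simp
  qed
  have "cohesive_via n L M \<sigma>"
    unfolding cohesive_via_def dense_embedding_def
    using M(1) L \<sigma>(1,3) ineq unfolding I_def w_def pairwise_def by auto
  thus ?thesis using place M(2) unfolding I_def w_def by blast
qed

lemma finite_field_ext_refl:
  assumes "field F" shows "finite_field_ext F id F"
proof -
  interpret field F by (rule assms)
  have "finite_dimension (carrier F) (carrier F)"
    using dimension_one[OF carrier_is_subfield] finite_dimensionI by blast
  thus ?thesis unfolding finite_field_ext_def using assms by (auto intro: ring_hom_memI)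
qed

lemma equiv_absval_refl: "nonarch_absval K v \<Longrightarrow> equiv_absval K v v"
  unfolding equiv_absval_def nonarch_absval_def
  by (intro exI[of _ 1]) (metis less_eq_real_def powr_one_gt_zero_iff powr_zero_eq_one zero_less_one powr_one order_refl)

text \<open>As \<open>L\<close> is complete and \<open>M\<close> is dense in it, the two fields are even isomorphic.\<close>
lemma completion_anabelomorphic:
  fixes M :: "complex ring" and L :: "'b ring"
  assumes M: "field M" and d: "dense_embedding M \<sigma> L"
  shows "anabelomorphic L (place_completion M (induced_absval \<sigma> L))"
proof -
  have L: "nonarch_local_field L" and hom: "\<sigma> \<in> ring_hom M L"
    and dense: "\<And>y e. y \<in> carrier L \<Longrightarrow> e > 0 \<Longrightarrow> \<exists>x\<in>carrier M. local_absval L (\<sigma> x \<ominus>\<^bsub>L\<^esub> y) < e"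
    using d unfolding dense_embedding_def by auto
  note Lf = local_field_facts[OF L]
  have w: "nonarch_absval M (local_absval L \<circ> \<sigma>)" by (rule nonarch_absval_comp[OF M Lf(1) hom Lf(2)])
  interpret C: valued_field M "local_absval L \<circ> \<sigma>" by (rule valued_field.intro[OF M w])
  interpret L: field L by (rule Lf(1))
  obtain \<psi> where \<psi>: "\<psi> \<in> ring_iso C.CQ L"
    using completion_of_dense_subfield[OF M Lf(1,2,3) hom dense w] by blast
  define \<theta> where "\<theta> = inv_into (carrier C.CQ) \<psi>"
  have \<theta>: "\<theta> \<in> ring_iso L C.CQ" unfolding \<theta>_def by (rule ring_iso_set_sym[OF C.CQ_ring \<psi>])
  have "\<theta> \<zero>\<^bsub>L\<^esub> = \<zero>\<^bsub>C.CQ\<^esub>"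
    using ring_hom_zero[OF _ L.ring_axioms C.CQ_ring] \<theta> by (simp add: ring_iso_def)
  hence "field C.CQ" using L.ring_iso_imp_img_field[OF \<theta>] by simp
  thus ?thesis using ring_iso_imp_anabelomorphic[OF Lf(1) _ \<theta>] by (simp add: induced_absval_def)
qed

theorem theorem9p2p3:
  fixes K :: "'a ring" and n :: nat and v :: "nat \<Rightarrow> 'a \<Rightarrow> real" and L :: "nat \<Rightarrow> 'b ring"
  assumes "number_field K"
    and "\<And>i. i \<in> {1..n} \<Longrightarrow> nonarch_place K (v i)"
    and "pairwise (\<lambda>i j. \<not> equiv_absval K (v i) (v j)) {1..n}"
    and "\<And>i. i \<in> {1..n} \<Longrightarrow> nonarch_local_field (L i)"
    and "\<And>i. i \<in> {1..n} \<Longrightarrow> anabelomorphism (place_completion K (v i)) (L i) (\<alpha> i)"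
  shows "\<exists>(L' :: nat \<Rightarrow> 'b ring) (g :: nat \<Rightarrow> 'b \<Rightarrow> 'b)
           (M' :: complex ring) (\<sigma> :: nat \<Rightarrow> complex \<Rightarrow> 'b) (w :: nat \<Rightarrow> complex \<Rightarrow> real)
           (K' :: 'a ring) (\<iota> :: 'a \<Rightarrow> 'a) (u :: nat \<Rightarrow> 'a \<Rightarrow> real).
           ((\<forall>i\<in>{1..n}. finite_field_ext (L i) (g i) (L' i)) \<and>
            cohesive_via n L' M' \<sigma> \<and>
            (\<forall>i\<in>{1..n}. nonarch_place M' (w i) \<and> w i = induced_absval (\<sigma> i) (L' i))) \<and>
           (finite_field_ext K \<iota> K' \<and>
            (\<forall>i\<in>{1..n}. nonarch_place K' (u i) \<and> lies_over K \<iota> (u i) (v i) \<and>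
                        anabelomorphic (place_completion K' (u i)) (L' i))) \<and>
           (anabelomorphically_connected n K' u M' w \<and>
            (\<forall>i\<in>{1..n}. lies_over K \<iota> (u i) (v i)))"
proof -
  have K: "field K" using assms(1) unfolding number_field_def finite_field_ext_def by blast
  obtain M :: "complex ring" and \<sigma> where M: "field M" "cohesive_via n L M \<sigma>"
    and place: "\<And>i. i \<in> {1..n} \<Longrightarrow> nonarch_place M (induced_absval (\<sigma> i) (L i))"
    using local_fields_cohesive[of n L] assms(4) by blast
  have an: "anabelomorphic (place_completion K (v i)) (L i)" if "i \<in> {1..n}" for i
    using assms(5)[OF that] unfolding anabelomorphic_def by blast
  have dense: "dense_embedding M (\<sigma> i) (L i)" if "i \<in> {1..n}" for i
    using M(2) that unfolding cohesive_via_def by blast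
  have nf: "number_field M" using M(2) unfolding cohesive_via_def by blast
  have over: "lies_over K id (v i) (v i)" if "i \<in> {1..n}" for i
    using assms(2)[OF that] equiv_absval_refl[of K "v i"] unfolding lies_over_def nonarch_place_def by simp
  have conn: "anabelomorphically_connected n K v M (\<lambda>i. induced_absval (\<sigma> i) (L i))"
    unfolding anabelomorphically_connected_def
    using assms(1,2) nf place anabelomorphic_trans[OF an completion_anabelomorphic[OF M(1) dense]] by blast
  show ?thesis
    by (intro exI[of _ L] exI[of _ "\<lambda>_. id"] exI[of _ M] exI[of _ \<sigma>] exI[of _ "\<lambda>i. induced_absval (\<sigma> i) (L i)"]
        exI[of _ K] exI[of _ id] exI[of _ v] conjI ballI)
       (use M(2) place assms(2) over an conn finite_field_ext_refl[OF K] finite_field_ext_refl[OF local_field_facts(1)[OF assms(4)]] in auto)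
qed

end
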